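(* Let $(\mathcal X,d,\mu)$ be a space of homogeneous type with $\mu(\mathcal X)=\infty$, $\beta,\gamma\in(0,\eta)$ and $s\in(0,\beta\wedge\gamma)$. Then $\dot C^s(\mathcal X)=\dot B^s_{\infty,\infty}(\mathcal X)$ in the following sense: (i) there exists a positive constant $C$ such that, for any $f\in\dot C^s(\mathcal X)$, $\|f\|_{\dot B^s_{\infty,\infty}(\mathcal X)}\le C\|f\|_{\dot C^s(\mathcal X)}$; (ii) for any $f\in\dot B^s_{\infty,\infty}(\mathcal X)$, there exists a $g\in\dot C^s(\mathcal X)$ such that $f=g$ in $(\mathring{\mathcal G}^\eta_0(\beta,\gamma))'$ and $\|g\|_{\dot C^s(\mathcal X)}\le C\|f\|_{\dot B^s_{\infty,\infty}(\mathcal X)}$, where $C$ is a positive constant independent of $f$.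
   Context: Space. $d$ is a quasi-metric on $\mathcal X$: $d\ge0$, $d(x,y)=0$ iff $x=y$, $d$ symmetric, $d(x,z)\le A_0[d(x,y)+d(y,z)]$ for some $A_0\in[1,\infty)$. $B(x,r):=\{y:d(x,y)<r\}$. $(\mathcal X,d,\mu)$ is a space of homogeneous type: $\mu$ is a measure for which balls are measurable with $0<\mu(B)<\infty$, and $\mu(2B)\le C_{(\mu)}\mu(B)$ for every ball $B$. $V_r(x):=\mu(B(x,r))$, $V(x,y):=\mu(B(x,d(x,y)))$ ($=0$ if $x=y$). $a\wedge b:=\min\{a,b\}$. Reference points. Fix $0<c_0\le C_0<\infty$, a small $\delta\in(0,1)$ (e.g. $\delta\le(2A_0)^{-10}$) with $12A_0^3C_0\delta\le c_0$, and points $\{z^k_\alpha:k\in\mathbb Z,\alpha\in\mathcal A_k\}$, nested ($\mathcal A_k\subset\mathcal A_{k+1}$ and $z^{k+1}_\alpha=z^k_\alpha$ for $\alpha\in\mathcal A_k$), with $d(z^k_\alpha,z^k_\beta)\ge c_0\delta^k$ if $\alpha\ne\beta$ and $\min_{\alpha\in\mathcal A_k}d(x,z^k_\alpha)<C_0\delta^k$ for all $x$. $\mathcal Y^k:=\{z^{k+1}_\alpha:\alpha\in\mathcal A_{k+1}\setminus\mathcal A_k\}$, $d(x,\mathcal Y^k):=\inf_{y\in\mathcal Y^k}d(x,y)$. exp-ATI. $\eta\in(0,1)$ is a fixed exponent for which exp-ATIs exist on $\mathcal X$. An exp-ATI is a sequence $\{Q_k\}_{k\in\mathbb Z}$ of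 bounded linear integral operators on $L^2(\mathcal X)$, with kernels $Q_k(x,y)$, such that for some constants $C,\nu\in(0,\infty)$, $a\in(0,1]$, writing $$E_k(x,y):=\frac{1}{\sqrt{V_{\delta^k}(x)V_{\delta^k}(y)}}\exp\Big\{-\nu\Big[\frac{d(x,y)}{\delta^k}\Big]^a\Big\}\exp\Big\{-\nu\Big[\frac{\max\{d(x,\mathcal Y^k),d(y,\mathcal Y^k)\}}{\delta^k}\Big]^a\Big\},$$ one has: (i) $\sum_{k\in\mathbb Z}Q_k=I$ in $L^2(\mathcal X)$; and for all $k$ and all points: (ii) $|Q_k(x,y)|\le CE_k(x,y)$; (iii) if $d(x,x')\le\delta^k$, then $|Q_k(x,y)-Q_k(x',y)|+|Q_k(y,x)-Q_k(y,x')|\le C[d(x,x')/\delta^k]^\eta E_k(x,y)$; (iv) if $d(x,x')\le\delta^k$ and $d(y,y')\le\delta^k$, then $|[Q_k(x,y)-Q_k(x',y)]-[Q_k(x,y')-Q_k(x',y')]|\le C[d(x,x')/\delta^k]^\eta[d(y,y')/\delta^k]^\eta E_k(x,y)$; (v) $\int_{\mathcal X}Q_k(x,y')\,d\mu(y')=0=\int_{\mathcal X}Q_k(x',y)\,d\mu(x')$. Test functions and distributions. Fix $x_0\in\mathcal X$. For $\beta\in(0,1]$, $\gamma\in(0,\infty)$, $\mathcal G(\beta,\gamma)$ is the set of functions $f$ for which there is $C>0$ such that, with $D_\gamma(x):=\frac{1}{V_1(x_0)+V(x_0,x)}[1+d(x_0,x)]^{-\gamma}$: $|f(x)|\le CD_\gamma(x)$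 for all $x$, and $|f(x)-f(y)|\le C[\frac{d(x,y)}{1+d(x_0,x)}]^\beta D_\gamma(x)$ whenever $d(x,y)\le(2A_0)^{-1}[1+d(x_0,x)]$; its norm is the infimum of such $C$. $\mathring{\mathcal G}(\beta,\gamma):=\{f\in\mathcal G(\beta,\gamma):\int_{\mathcal X}f\,d\mu=0\}$. For $\beta,\gamma\in(0,\eta]$, $\mathring{\mathcal G}^\eta_0(\beta,\gamma)$ is the completion of $\mathring{\mathcal G}(\eta,\eta)$ in $\mathring{\mathcal G}(\beta,\gamma)$, and $(\mathring{\mathcal G}^\eta_0(\beta,\gamma))'$ is its dual. For $f$ in this dual, $Q_k(f)(x):=\langle f,Q_k(x,\cdot)\rangle$; functions act as distributions by integration. Spaces. Fix an exp-ATI $\{Q_k\}_{k\in\mathbb Z}$. $\dot B^s_{\infty,\infty}(\mathcal X)$ is the set of $f\in(\mathring{\mathcal G}^\eta_0(\beta,\gamma))'$ with $\|f\|_{\dot B^s_{\infty,\infty}(\mathcal X)}:=\sup_{k\in\mathbb Z}\delta^{-ks}\|Q_k(f)\|_{L^\infty(\mathcal X)}<\infty$. $\dot C^s(\mathcal X)$ is the set of continuous functions $f$ on $\mathcal X$ with $\|f\|_{\dot C^s(\mathcal X)}:=\sup_{x\ne y}\frac{|f(x)-f(y)|}{[d(x,y)]^s}<\infty$. *)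

theory Defs
  imports "HOL-Probability.Essential_Supremum"
begin

section \<open>Spaces of homogeneous type\<close>

text \<open>The underlying set \<open>\<X>\<close> is the whole type \<open>'a\<close>.\<close>

definition quasi_metric :: "('a \<Rightarrow> 'a \<Rightarrow> real) \<Rightarrow> real \<Rightarrow> bool" where
  "quasi_metric d A0 \<longleftrightarrow> 1 \<le> A0
     \<and> (\<forall>x y. 0 \<le> d x y)
     \<and> (\<forall>x y. d x y = 0 \<longleftrightarrow> x = y)
     \<and> (\<forall>x y. d x y = d y x)
     \<and> (\<forall>x y z. d x z \<le> A0 * (d x y + d y z))"

definition qball :: "('a \<Rightarrow> 'a \<Rightarrow> real) \<Rightarrow> 'a \<Rightarrow> real \<Rightarrow> 'a set" where
  "qball d x r = {y. d x y < r}"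

text \<open>Quasi-metric balls need not be open in this topology.\<close>

definition qm_topology :: "('a \<Rightarrow> 'a \<Rightarrow> real) \<Rightarrow> 'a topology" where
  "qm_topology d = topology (\<lambda>U. \<forall>x\<in>U. \<exists>r>0. qball d x r \<subseteq> U)"

lemma openin_qm_topology:
  "openin (qm_topology d) U \<longleftrightarrow> (\<forall>x\<in>U. \<exists>r>0. qball d x r \<subseteq> U)"
proof -
  have "istopology (\<lambda>U. \<forall>x\<in>U. \<exists>r>0. qball d x r \<subseteq> U)"
    unfolding istopology_def
  proof (intro conjI allI impI)
    fix S T
    assume S: "\<forall>x\<in>S. \<exists>r>0. qball d x r \<subseteq> S" and T: "\<forall>x\<in>T. \<exists>r>0. qball d x r \<subseteq> T"
    show "\<forall>x\<in>S \<inter> T. \<exists>r>0. qball d x r \<subseteq> S \<inter> T"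
    proof
      fix x assume "x \<in> S \<inter> T"
      then obtain r1 r2 where "r1 > 0" "qball d x r1 \<subseteq> S" "r2 > 0" "qball d x r2 \<subseteq> T"
        using S T by (metis IntE)
      then have "min r1 r2 > 0 \<and> qball d x (min r1 r2) \<subseteq> S \<inter> T"
        by (auto simp: qball_def)
      then show "\<exists>r>0. qball d x r \<subseteq> S \<inter> T" by blast
    qed
  next
    fix \<K> :: "'a set set"
    assume K: "\<forall>K\<in>\<K>. \<forall>x\<in>K. \<exists>r>0. qball d x r \<subseteq> K"
    show "\<forall>x\<in>\<Union>\<K>. \<exists>r>0. qball d x r \<subseteq> \<Union>\<K>"
      using K by (meson UnionE Union_upper subset_trans)
  qed
  then show ?thesis by (simp add: qm_topology_def)
qed

definition homogeneous_type_space ::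
  "('a \<Rightarrow> 'a \<Rightarrow> real) \<Rightarrow> real \<Rightarrow> 'a measure \<Rightarrow> bool" where
  "homogeneous_type_space d A0 \<mu> \<longleftrightarrow> quasi_metric d A0 \<and> space \<mu> = UNIV
     \<and> (\<forall>x r. 0 < r \<longrightarrow>
          qball d x r \<in> sets \<mu> \<and> 0 < emeasure \<mu> (qball d x r) \<and> emeasure \<mu> (qball d x r) < \<infinity>)
     \<and> (\<exists>C::real. \<forall>x r. 0 < r \<longrightarrow>
          emeasure \<mu> (qball d x (2 * r)) \<le> ennreal C * emeasure \<mu> (qball d x r))"

definition Vol :: "('a \<Rightarrow> 'a \<Rightarrow> real) \<Rightarrow> 'a measure \<Rightarrow> real \<Rightarrow> 'a \<Rightarrow> real" where
  "Vol d \<mu> r x = measure \<mu> (qball d x r)"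

text \<open>For \<open>x = y\<close> the ball has radius \<open>0\<close>, hence is empty and the value is \<open>0\<close>.\<close>

definition Vol2 :: "('a \<Rightarrow> 'a \<Rightarrow> real) \<Rightarrow> 'a measure \<Rightarrow> 'a \<Rightarrow> 'a \<Rightarrow> real" where
  "Vol2 d \<mu> x y = measure \<mu> (qball d x (d x y))"


section \<open>Reference points\<close>

definition reference_points ::
  "('a \<Rightarrow> 'a \<Rightarrow> real) \<Rightarrow> real \<Rightarrow> real \<Rightarrow> real \<Rightarrow> real \<Rightarrow>
   (int \<Rightarrow> 'i set) \<Rightarrow> (int \<Rightarrow> 'i \<Rightarrow> 'a) \<Rightarrow> bool" where
  "reference_points d A0 c0 C0 \<delta> \<A> z \<longleftrightarrow>
     0 < c0 \<and> c0 \<le> C0 \<and> 0 < \<delta> \<and> \<delta> < 1 \<and> 12 * A0 ^ 3 * C0 * \<delta> \<le> c0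
     \<and> (\<forall>k. \<A> k \<subseteq> \<A> (k + 1))
     \<and> (\<forall>k. \<forall>\<alpha>\<in>\<A> k. z (k + 1) \<alpha> = z k \<alpha>)
     \<and> (\<forall>k. \<forall>\<alpha>\<in>\<A> k. \<forall>\<beta>\<in>\<A> k. \<alpha> \<noteq> \<beta> \<longrightarrow> c0 * \<delta> powi k \<le> d (z k \<alpha>) (z k \<beta>))
     \<and> (\<forall>k x. \<exists>\<alpha>\<in>\<A> k. d x (z k \<alpha>) < C0 * \<delta> powi k)"

definition new_points :: "(int \<Rightarrow> 'i set) \<Rightarrow> (int \<Rightarrow> 'i \<Rightarrow> 'a) \<Rightarrow> int \<Rightarrow> 'a set" where
  "new_points \<A> z k = z (k + 1) ` (\<A> (k + 1) - \<A> k)"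

text \<open>Meaningful for nonempty \<open>Y\<close> only, because a real infimum cannot be \<open>\<infinity>\<close>.\<close>

definition dist_to_set :: "('a \<Rightarrow> 'a \<Rightarrow> real) \<Rightarrow> 'a \<Rightarrow> 'a set \<Rightarrow> real" where
  "dist_to_set d x Y = (INF y\<in>Y. d x y)"


section \<open>Approximations of the identity with exponential decay\<close>

text \<open>The bound \<open>E\<^sub>k(x,y)\<close>, with \<open>Y\<close> standing for the set of new points of level \<open>k\<close>. If \<open>Y\<close> is empty,
  the distance to \<open>Y\<close> is \<open>\<infinity>\<close>, so the second exponential factor vanishes.\<close>

definition exp_bound ::
  "('a \<Rightarrow> 'a \<Rightarrow> real) \<Rightarrow> 'a measure \<Rightarrow> real \<Rightarrow> 'a set \<Rightarrow> real \<Rightarrow> real \<Rightarrow>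
   int \<Rightarrow> 'a \<Rightarrow> 'a \<Rightarrow> real" where
  "exp_bound d \<mu> \<delta> Y \<nu> a k x y =
     1 / sqrt (Vol d \<mu> (\<delta> powi k) x * Vol d \<mu> (\<delta> powi k) y)
     * exp (- \<nu> * (d x y / \<delta> powi k) powr a)
     * (if Y = {} then 0
        else exp (- \<nu> * (max (dist_to_set d x Y) (dist_to_set d y Y) / \<delta> powi k) powr a))"

definition L2_fun :: "'a measure \<Rightarrow> ('a \<Rightarrow> complex) set" where
  "L2_fun \<mu> = {f \<in> borel_measurable \<mu>. integrable \<mu> (\<lambda>x. (norm (f x))\<^sup>2)}"

definition L2_nrm :: "'a measure \<Rightarrow> ('a \<Rightarrow> complex) \<Rightarrow> real" where
  "L2_nrm \<mu> f = sqrt (LINT x|\<mu>. (norm (f x))\<^sup>2)"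

definition kernel_op ::
  "'a measure \<Rightarrow> ('a \<Rightarrow> 'a \<Rightarrow> complex) \<Rightarrow> ('a \<Rightarrow> complex) \<Rightarrow> 'a \<Rightarrow> complex" where
  "kernel_op \<mu> K f x = (LINT y|\<mu>. K x y * f y)"

definition L2_bounded_kernel :: "'a measure \<Rightarrow> ('a \<Rightarrow> 'a \<Rightarrow> complex) \<Rightarrow> bool" where
  "L2_bounded_kernel \<mu> K \<longleftrightarrow> (\<exists>B. \<forall>f\<in>L2_fun \<mu>.
     (AE x in \<mu>. integrable \<mu> (\<lambda>y. K x y * f y))
     \<and> kernel_op \<mu> K f \<in> L2_fun \<mu>
     \<and> L2_nrm \<mu> (kernel_op \<mu> K f) \<le> B * L2_nrm \<mu> f)"

text \<open>The series over \<open>\<int>\<close> converges strongly, as the limit of its partial sums from \<open>-m\<close> to \<open>n\<close>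
  when \<open>m\<close> and \<open>n\<close> tend to infinity independently.\<close>

definition sums_to_identity_L2 :: "'a measure \<Rightarrow> (int \<Rightarrow> 'a \<Rightarrow> 'a \<Rightarrow> complex) \<Rightarrow> bool" where
  "sums_to_identity_L2 \<mu> Q \<longleftrightarrow> (\<forall>f\<in>L2_fun \<mu>.
     ((\<lambda>(m, n). L2_nrm \<mu> (\<lambda>x. (\<Sum>k = - int m..int n. kernel_op \<mu> (Q k) f x) - f x))
        \<longlongrightarrow> 0) (sequentially \<times>\<^sub>F sequentially))"

definition exp_ATI ::
  "('a \<Rightarrow> 'a \<Rightarrow> real) \<Rightarrow> 'a measure \<Rightarrow> real \<Rightarrow> (int \<Rightarrow> 'a set) \<Rightarrow> real \<Rightarrow>
   (int \<Rightarrow> 'a \<Rightarrow> 'a \<Rightarrow> complex) \<Rightarrow> bool" where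
  "exp_ATI d \<mu> \<delta> Y \<eta> Q \<longleftrightarrow>
     (\<forall>k. L2_bounded_kernel \<mu> (Q k))
     \<and> sums_to_identity_L2 \<mu> Q
     \<and> (\<forall>k x. has_bochner_integral \<mu> (\<lambda>y. Q k x y) 0)
     \<and> (\<forall>k y. has_bochner_integral \<mu> (\<lambda>x. Q k x y) 0)
     \<and> (\<exists>C \<nu> a. 0 < C \<and> 0 < \<nu> \<and> 0 < a \<and> a \<le> 1
        \<and> (\<forall>k x y. norm (Q k x y) \<le> C * exp_bound d \<mu> \<delta> (Y k) \<nu> a k x y)
        \<and> (\<forall>k x x' y. d x x' \<le> \<delta> powi k \<longrightarrow>
              norm (Q k x y - Q k x' y) + norm (Q k y x - Q k y x')
              \<le> C * (d x x' / \<delta> powi k) powr \<eta> * exp_bound d \<mu> \<delta> (Y k) \<nu> a k x y)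
        \<and> (\<forall>k x x' y y'. d x x' \<le> \<delta> powi k \<and> d y y' \<le> \<delta> powi k \<longrightarrow>
              norm ((Q k x y - Q k x' y) - (Q k x y' - Q k x' y'))
              \<le> C * (d x x' / \<delta> powi k) powr \<eta> * (d y y' / \<delta> powi k) powr \<eta>
                  * exp_bound d \<mu> \<delta> (Y k) \<nu> a k x y))"


section \<open>Test functions and distributions\<close>

definition decay ::
  "('a \<Rightarrow> 'a \<Rightarrow> real) \<Rightarrow> 'a measure \<Rightarrow> 'a \<Rightarrow> real \<Rightarrow> 'a \<Rightarrow> real" where
  "decay d \<mu> x0 \<gamma> x = 1 / (Vol d \<mu> 1 x0 + Vol2 d \<mu> x0 x) * (1 + d x0 x) powr (- \<gamma>)"

definition test_bound ::
  "('a \<Rightarrow> 'a \<Rightarrow> real) \<Rightarrow> real \<Rightarrow> 'a measure \<Rightarrow> 'a \<Rightarrow> real \<Rightarrow> real \<Rightarrow>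
   ('a \<Rightarrow> complex) \<Rightarrow> real \<Rightarrow> bool" where
  "test_bound d A0 \<mu> x0 \<beta> \<gamma> f C \<longleftrightarrow>
     (\<forall>x. norm (f x) \<le> C * decay d \<mu> x0 \<gamma> x)
     \<and> (\<forall>x y. d x y \<le> (1 + d x0 x) / (2 * A0) \<longrightarrow>
          norm (f x - f y) \<le> C * (d x y / (1 + d x0 x)) powr \<beta> * decay d \<mu> x0 \<gamma> x)"

definition test_space ::
  "('a \<Rightarrow> 'a \<Rightarrow> real) \<Rightarrow> real \<Rightarrow> 'a measure \<Rightarrow> 'a \<Rightarrow> real \<Rightarrow> real \<Rightarrow>
   ('a \<Rightarrow> complex) set" where
  "test_space d A0 \<mu> x0 \<beta> \<gamma> = {f. \<exists>C>0. test_bound d A0 \<mu> x0 \<beta> \<gamma> f C}"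

definition test_norm ::
  "('a \<Rightarrow> 'a \<Rightarrow> real) \<Rightarrow> real \<Rightarrow> 'a measure \<Rightarrow> 'a \<Rightarrow> real \<Rightarrow> real \<Rightarrow>
   ('a \<Rightarrow> complex) \<Rightarrow> real" where
  "test_norm d A0 \<mu> x0 \<beta> \<gamma> f = Inf {C. 0 < C \<and> test_bound d A0 \<mu> x0 \<beta> \<gamma> f C}"

definition test_space0 ::
  "('a \<Rightarrow> 'a \<Rightarrow> real) \<Rightarrow> real \<Rightarrow> 'a measure \<Rightarrow> 'a \<Rightarrow> real \<Rightarrow> real \<Rightarrow>
   ('a \<Rightarrow> complex) set" where
  "test_space0 d A0 \<mu> x0 \<beta> \<gamma> =
     {f \<in> test_space d A0 \<mu> x0 \<beta> \<gamma>. has_bochner_integral \<mu> f 0}"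

text \<open>The completion of \<open>test_space0 \<eta> \<eta>\<close> inside \<open>test_space0 \<beta> \<gamma>\<close>, that is, its closure there.\<close>

definition test_completion ::
  "('a \<Rightarrow> 'a \<Rightarrow> real) \<Rightarrow> real \<Rightarrow> 'a measure \<Rightarrow> 'a \<Rightarrow> real \<Rightarrow> real \<Rightarrow> real \<Rightarrow>
   ('a \<Rightarrow> complex) set" where
  "test_completion d A0 \<mu> x0 \<eta> \<beta> \<gamma> =
     {f \<in> test_space0 d A0 \<mu> x0 \<beta> \<gamma>.
        \<exists>\<phi>. (\<forall>n::nat. \<phi> n \<in> test_space0 d A0 \<mu> x0 \<eta> \<eta>)
          \<and> (\<lambda>n. test_norm d A0 \<mu> x0 \<beta> \<gamma> (\<lambda>x. \<phi> n x - f x)) \<longlonglongrightarrow> 0}"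

text \<open>Functionals are made \<open>undefined\<close> outside the test space, so that equality in the dual is
  equality of functions.\<close>

definition distributions ::
  "('a \<Rightarrow> 'a \<Rightarrow> real) \<Rightarrow> real \<Rightarrow> 'a measure \<Rightarrow> 'a \<Rightarrow> real \<Rightarrow> real \<Rightarrow> real \<Rightarrow>
   (('a \<Rightarrow> complex) \<Rightarrow> complex) set" where
  "distributions d A0 \<mu> x0 \<eta> \<beta> \<gamma> =
     {F \<in> extensional (test_completion d A0 \<mu> x0 \<eta> \<beta> \<gamma>).
        (\<forall>\<phi>\<in>test_completion d A0 \<mu> x0 \<eta> \<beta> \<gamma>. \<forall>\<psi>\<in>test_completion d A0 \<mu> x0 \<eta> \<beta> \<gamma>.
           F (\<lambda>x. \<phi> x + \<psi> x) = F \<phi> + F \<psi>)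
        \<and> (\<forall>\<phi>\<in>test_completion d A0 \<mu> x0 \<eta> \<beta> \<gamma>. \<forall>c. F (\<lambda>x. c * \<phi> x) = c * F \<phi>)
        \<and> (\<exists>B. \<forall>\<phi>\<in>test_completion d A0 \<mu> x0 \<eta> \<beta> \<gamma>.
             norm (F \<phi>) \<le> B * test_norm d A0 \<mu> x0 \<beta> \<gamma> \<phi>)}"

definition distribution_of ::
  "('a \<Rightarrow> 'a \<Rightarrow> real) \<Rightarrow> real \<Rightarrow> 'a measure \<Rightarrow> 'a \<Rightarrow> real \<Rightarrow> real \<Rightarrow> real \<Rightarrow>
   ('a \<Rightarrow> complex) \<Rightarrow> ('a \<Rightarrow> complex) \<Rightarrow> complex" where
  "distribution_of d A0 \<mu> x0 \<eta> \<beta> \<gamma> g =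
     (\<lambda>\<phi>\<in>test_completion d A0 \<mu> x0 \<eta> \<beta> \<gamma>. LINT x|\<mu>. g x * \<phi> x)"


section \<open>Besov and Hoelder spaces\<close>

text \<open>The function \<open>Q\<^sub>k(F)\<close> is \<open>\<lambda>x. F (Q k x)\<close>.\<close>

definition besov_norm ::
  "'a measure \<Rightarrow> real \<Rightarrow> (int \<Rightarrow> 'a \<Rightarrow> 'a \<Rightarrow> complex) \<Rightarrow> real \<Rightarrow>
   (('a \<Rightarrow> complex) \<Rightarrow> complex) \<Rightarrow> ennreal" where
  "besov_norm \<mu> \<delta> Q s F =
     (SUP k::int. ennreal (\<delta> powr (- (real_of_int k * s)))
        * esssup \<mu> (\<lambda>x. ennreal (norm (F (Q k x)))))"

definition besov_space ::
  "('a \<Rightarrow> 'a \<Rightarrow> real) \<Rightarrow> real \<Rightarrow> 'a measure \<Rightarrow> 'a \<Rightarrow> real \<Rightarrow> real \<Rightarrow> real \<Rightarrow>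
   real \<Rightarrow> (int \<Rightarrow> 'a \<Rightarrow> 'a \<Rightarrow> complex) \<Rightarrow> real \<Rightarrow> (('a \<Rightarrow> complex) \<Rightarrow> complex) set" where
  "besov_space d A0 \<mu> x0 \<eta> \<beta> \<gamma> \<delta> Q s =
     {F \<in> distributions d A0 \<mu> x0 \<eta> \<beta> \<gamma>. besov_norm \<mu> \<delta> Q s F < \<infinity>}"

definition hoelder_norm ::
  "('a \<Rightarrow> 'a \<Rightarrow> real) \<Rightarrow> real \<Rightarrow> ('a \<Rightarrow> complex) \<Rightarrow> ennreal" where
  "hoelder_norm d s f =
     (SUP (x, y)\<in>{(x, y). x \<noteq> y}. ennreal (norm (f x - f y) / d x y powr s))"

definition hoelder_space ::
  "('a \<Rightarrow> 'a \<Rightarrow> real) \<Rightarrow> real \<Rightarrow> ('a \<Rightarrow> complex) set" where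
  "hoelder_space d s =
     {f. continuous_map (qm_topology d) euclidean f \<and> hoelder_norm d s f < \<infinity>}"

end

(* Write u_k(x) for the pairing of F with Q_k(x,.).  For f Hoelder, the cancellation of Q_k gives
   |u_k(x)| <= C delta^(ks) at once.  Conversely, for a mean-zero test function phi, the series of the
   transposed operators Q_k^* phi converges to phi in the norm of G(beta,gamma): the cancellation of Q_k
   (fine scales) and of phi (coarse scales) gives decay delta^(epsilon |k|), and the limit is identified
   through the L2 identity tested against indicators of balls.  Approximating Q_k^* phi by Riemann sums
   of the functions Q_k(z,.) yields F(phi) = sum_k int phi u_k.  No second (Calderon) family is needed: the
   Hoelder regularity of u_k follows from this formula for phi = Q_k(x,.) - Q_k(x',.) by absorbing the
   contribution of much coarser scales.  Then g(x) = sum_k (u_k(x) - u_k(x0)) is the Hoelder function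
   that represents F. *)

theory Submission
  imports Defs
begin

section \<open>Spaces of homogeneous type\<close>

text \<open>A distribution is only continuous in the norm of the completion, so it cannot simply be
  moved under the integral that defines \<open>T k \<phi>\<close>: Riemann sums have to converge in
  that norm, and with the same nodes to the integral of \<phi> against u_k. Likewise the operators
  sum to the identity in L2, whereas the limit is needed for their transposes on test functions; two
  continuous functions with equal integrals over all balls coincide, and this bridges the gap. Every
  argument lives on the gaps s < \<gamma> < \<eta> and \<beta> < \<eta>. The differences \<eta> -
  \<beta> and \<eta> - \<gamma> give decay in k; s < \<gamma> makes Hoelder functions integrable
  against tests; since \<eta> exceeds both s and \<gamma>, the regularity of u_l sums geometrically
  over coarse scales l and, N steps away from k, costs at most half of what is to be proved. The
  exponential bounds are replaced by a polynomial kernel of exponent 3: one unit pays for a factor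
  (d/R)^\<theta> with \<theta> \<le> 1 and leaves an integrable kernel, and \<beta> + \<gamma> \<le>
  3 lets the same decay pass to the weight of the test functions.\<close>

locale homogeneous_space =
  fixes d :: "'a \<Rightarrow> 'a \<Rightarrow> real" and A0 :: real and \<mu> :: "'a measure"
  assumes homogeneous: "homogeneous_type_space d A0 \<mu>"
begin

abbreviation V :: "'a \<Rightarrow> real \<Rightarrow> real" where "V x r \<equiv> Vol d \<mu> r x"

lemma quasi_metric: "quasi_metric d A0"
  using homogeneous unfolding homogeneous_type_space_def by (elim conjE)

lemma A0_ge_1: "1 \<le> A0"
  by (metis quasi_metric quasi_metric_def)

lemma d_nonneg [simp]: "0 \<le> d x y"
  by (metis quasi_metric quasi_metric_def)

lemma d_eq_0_iff [simp]: "d x y = 0 \<longleftrightarrow> x = y"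
  by (metis quasi_metric quasi_metric_def)

lemma d_self [simp]: "d x x = 0"
  by simp

lemma d_commute: "d x y = d y x"
  by (metis quasi_metric quasi_metric_def)

lemma d_triangle: "d x z \<le> A0 * (d x y + d y z)"
  by (metis quasi_metric quasi_metric_def)

lemma A0_pos: "0 < A0"
  using A0_ge_1 by linarith

lemma d_pos_iff [simp]: "0 < d x y \<longleftrightarrow> x \<noteq> y"
  using d_nonneg[of x y] d_eq_0_iff[of x y] by (cases "x = y") (simp_all add: less_eq_real_def)

lemma space_eq [simp]: "space \<mu> = UNIV"
  using homogeneous unfolding homogeneous_type_space_def by (elim conjE)

lemma qball_empty: "r \<le> 0 \<Longrightarrow> qball d x r = {}"
  using d_nonneg[of x] by (auto simp: qball_def not_less intro: order_trans)

lemma sets_qball [measurable, simp]: "qball d x r \<in> sets \<mu>"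
proof (cases "0 < r")
  case True
  then show ?thesis
    using homogeneous unfolding homogeneous_type_space_def by blast
qed (simp add: qball_empty)

lemma emeasure_qball_less_top: "emeasure \<mu> (qball d x r) < \<infinity>"
proof (cases "0 < r")
  case True
  then show ?thesis
    using homogeneous unfolding homogeneous_type_space_def by blast
qed (simp add: qball_empty)

lemma emeasure_qball: "emeasure \<mu> (qball d x r) = ennreal (V x r)"
  unfolding Vol_def using emeasure_qball_less_top[of x r]
  by (intro emeasure_eq_ennreal_measure) auto

lemma fmeasurable_qball [simp]: "qball d x r \<in> fmeasurable \<mu>"
  by (intro fmeasurableI emeasure_qball_less_top sets_qball)

lemma V_nonneg [simp]: "0 \<le> V x r"
  by (simp add: Vol_def)

lemma V_pos: "0 < r \<Longrightarrow> 0 < V x r"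
proof -
  assume "0 < r"
  then have "0 < emeasure \<mu> (qball d x r)"
    using homogeneous unfolding homogeneous_type_space_def by blast
  then show ?thesis
    by (simp add: emeasure_qball)
qed

lemma V_subset: "qball d x r \<subseteq> qball d y s \<Longrightarrow> V x r \<le> V y s"
  unfolding Vol_def by (intro measure_mono_fmeasurable) auto

lemma V_mono: "r \<le> s \<Longrightarrow> V x r \<le> V x s"
  by (rule V_subset) (auto simp: qball_def)

lemma ex_doubling_constant: "\<exists>C\<ge>1. \<forall>x r. 0 < r \<longrightarrow> V x (2 * r) \<le> C * V x r"
proof -
  obtain C where C: "\<And>x r. 0 < r \<Longrightarrow>
      emeasure \<mu> (qball d x (2 * r)) \<le> ennreal C * emeasure \<mu> (qball d x r)"
    using homogeneous unfolding homogeneous_type_space_def by blast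
  have "V x (2 * r) \<le> max C 1 * V x r" if "0 < r" for x r
  proof -
    have "ennreal (V x (2 * r)) \<le> ennreal C * ennreal (V x r)"
      using C[OF that] by (simp add: emeasure_qball)
    also have "\<dots> \<le> ennreal (max C 1) * ennreal (V x r)"
      by (intro mult_right_mono ennreal_leI) auto
    also have "\<dots> = ennreal (max C 1 * V x r)"
      by (simp add: ennreal_mult)
    finally show ?thesis
      by (subst (asm) ennreal_le_iff) auto
  qed
  then show ?thesis
    by (intro exI[of _ "max C 1"]) auto
qed

lemma ex_doubling_constant_pow:
  obtains C where "1 \<le> C" "\<And>x r n. 0 < r \<Longrightarrow> V x (2 ^ n * r) \<le> C ^ n * V x r"
proof -
  obtain C where C: "C \<ge> 1" "\<And>x r. 0 < r \<Longrightarrow> V x (2 * r) \<le> C * V x r"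
    using ex_doubling_constant by auto
  have "V x (2 ^ n * r) \<le> C ^ n * V x r" if "0 < r" for x r n
  proof (induction n)
    case (Suc n)
    have "V x (2 ^ Suc n * r) = V x (2 * (2 ^ n * r))"
      by (simp add: mult.assoc)
    also have "\<dots> \<le> C * V x (2 ^ n * r)"
      using that by (intro C) auto
    also have "\<dots> \<le> C * (C ^ n * V x r)"
      using C(1) Suc by (intro mult_left_mono) auto
    finally show ?case
      by (simp add: mult.assoc)
  qed auto
  with C(1) that show ?thesis
    by blast
qed

text \<open>By the quasi-triangle inequality the ball about \<open>y\<close> lies in the ball about
  \<open>x\<close> of radius \<open>2 * A0 * L * r\<close>, and a number of doublings depending on
  \<open>L\<close> alone reaches that radius. Moving the centre and enlarging the radius are thus
  covered by one constant.\<close>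

lemma ex_doubling_const: "\<exists>C\<ge>1. \<forall>x y r s. 0 < r \<longrightarrow> d x y \<le> L * r \<longrightarrow> s \<le> L * r \<longrightarrow> V y s \<le> C * V x r"
proof -
  obtain C where C: "1 \<le> C" "\<And>x r n. 0 < r \<Longrightarrow> V x (2 ^ n * r) \<le> C ^ n * V x r"
    using ex_doubling_constant_pow by metis
  obtain n where n: "2 * A0 * L < 2 ^ n"
    using real_arch_pow[of 2 "2 * A0 * L"] by auto
  have "V y s \<le> C ^ n * V x r" if "0 < r" "d x y \<le> L * r" "s \<le> L * r" for x y r s
  proof -
    have "qball d y s \<subseteq> qball d x (2 ^ n * r)"
    proof
      fix w assume "w \<in> qball d y s"
      then have "d x y + d y w < 2 * (L * r)"
        using that by (simp add: qball_def)
      have "d x w \<le> A0 * (d x y + d y w)"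
        by (rule d_triangle)
      also have "\<dots> < A0 * (2 * (L * r))"
        using \<open>d x y + d y w < _\<close> A0_pos by (intro mult_strict_left_mono)
      also have "\<dots> = 2 * A0 * L * r"
        by simp
      also have "\<dots> \<le> 2 ^ n * r"
        using n that by (intro mult_right_mono) auto
      finally show "w \<in> qball d x (2 ^ n * r)"
        by (simp add: qball_def)
    qed
    then have "V y s \<le> V x (2 ^ n * r)"
      by (rule V_subset)
    also have "\<dots> \<le> C ^ n * V x r"
      using that by (intro C)
    finally show ?thesis .
  qed
  then show ?thesis
    using C(1) by (intro exI[of _ "C ^ n"]) auto
qed

text \<open>Choosing the constant once, as a function of \<open>L\<close>, lets later bounds name
  their constants explicitly and keeps them visibly independent of points and radii.\<close>

definition doubling_const :: "real \<Rightarrow> real" where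
  "doubling_const L = (SOME C. C \<ge> 1 \<and>
     (\<forall>x y r s. 0 < r \<longrightarrow> d x y \<le> L * r \<longrightarrow> s \<le> L * r \<longrightarrow> V y s \<le> C * V x r))"

lemma doubling_const_ge_1: "1 \<le> doubling_const L"
  and V_le_doubling_const: "0 < r \<Longrightarrow> d x y \<le> L * r \<Longrightarrow> s \<le> L * r \<Longrightarrow> V y s \<le> doubling_const L * V x r"
  using someI_ex[OF ex_doubling_const[of L]] unfolding doubling_const_def by blast+

lemma doubling_const_pos: "0 < doubling_const L"
  using doubling_const_ge_1[of L] by linarith

lemma inverse_V_le:
  assumes "0 < r" "0 < s" "d x y \<le> L * r" "s \<le> L * r"
  shows "1 / V x r \<le> doubling_const L / V y s"
  using V_le_doubling_const[OF assms(1,3,4)] V_pos[OF assms(1), of x] V_pos[OF assms(2), of y]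
  by (simp add: field_simps)

text \<open>Doubling is iterated about log_2 t times. The exponent is the binary logarithm of the
  doubling constant, an upper dimension of the space; this polynomial form is what exponential decay
  can absorb.\<close>

lemma ex_polynomial_doubling:
  obtains C \<omega> where "1 \<le> C" "0 \<le> \<omega>"
    "\<And>x r t. 0 < r \<Longrightarrow> 1 \<le> t \<Longrightarrow> V x (t * r) \<le> C * t powr \<omega> * V x r"
proof -
  obtain C where C: "1 \<le> C" "\<And>x r n. 0 < r \<Longrightarrow> V x (2 ^ n * r) \<le> C ^ n * V x r"
    using ex_doubling_constant_pow by metis
  define \<omega> where "\<omega> = log 2 C"
  have \<omega>: "0 \<le> \<omega>" "2 powr \<omega> = C"
    using C(1) by (auto simp: \<omega>_def)
  have "V x (t * r) \<le> C * t powr \<omega> * V x r" if "0 < r" "1 \<le> t" for x r t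
  proof -
    define n where "n = nat \<lceil>log 2 t\<rceil>"
    have n: "log 2 t \<le> real n" "real n \<le> log 2 t + 1"
      using that by (auto simp: n_def)
    have "t = 2 powr log 2 t"
      using that by simp
    also have "\<dots> \<le> 2 powr real n"
      using n by (intro powr_mono) auto
    finally have "t \<le> 2 ^ n"
      by (simp add: powr_realpow)
    then have "V x (t * r) \<le> V x (2 ^ n * r)"
      using that by (intro V_mono mult_right_mono) auto
    also have "\<dots> \<le> C ^ n * V x r"
      using that by (intro C)
    also have "C ^ n = (2 powr \<omega>) powr real n"
      using C(1) by (simp add: \<omega> powr_realpow)
    also have "\<dots> = 2 powr (\<omega> * real n)"
      by (simp add: powr_powr)
    also have "\<dots> \<le> 2 powr (\<omega> * (log 2 t + 1))"
      using n \<omega> by (intro powr_mono mult_left_mono) auto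
    also have "\<dots> = C * (2 powr log 2 t) powr \<omega>"
      by (simp add: powr_powr \<omega> ring_distribs powr_add mult.commute)
    also have "\<dots> = C * t powr \<omega>"
      using that by simp
    finally show ?thesis
      using V_pos[OF that(1), of x] by (simp add: mult_right_mono)
  qed
  then show ?thesis
    using that C(1) \<omega>(1) by blast
qed

text \<open>The sublevel sets of \<open>d x\<close> are exactly the balls about \<open>x\<close>,
  whose measurability is assumed.\<close>

lemma borel_measurable_d [measurable, simp]: "d x \<in> borel_measurable \<mu>"
  unfolding borel_measurable_iff_less using sets_qball[of x] by (simp add: qball_def)

lemma borel_measurable_V [measurable]: "V x \<in> borel_measurable borel"
  by (rule borel_measurable_mono) (auto intro!: monoI V_mono)

section \<open>Nets and measurability of continuous functions\<close>

text \<open>Packing: the balls of radius \<open>\<epsilon> / (2 * A0)\<close> about the separated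
  points are disjoint, lie in one ball of radius \<open>S\<close>, and each carries at least the
  fraction \<open>1 / doubling_const L\<close> of its measure.\<close>

lemma separated_card_bound:
  assumes "0 < \<epsilon>"
  shows "\<exists>N::nat. \<forall>Z. finite Z \<longrightarrow> Z \<subseteq> qball d x M \<longrightarrow>
    (\<forall>z\<in>Z. \<forall>w\<in>Z. z \<noteq> w \<longrightarrow> \<epsilon> \<le> d z w) \<longrightarrow> card Z \<le> N"
proof (cases "0 < M")
  case True
  define r where "r = \<epsilon> / (2 * A0)"
  define S where "S = A0 * (M + r)"
  define L where "L = max (S / r) (M / r)"
  have pos: "0 < r" "0 < S"
    using assms A0_pos True by (auto simp: r_def S_def intro!: mult_pos_pos divide_pos_pos add_pos_pos)
  have L: "S \<le> L * r" "M \<le> L * r"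
    using pos by (auto simp: L_def field_simps max_def)
  have bound: "card Z \<le> nat \<lceil>doubling_const L\<rceil>"
    if Z: "finite Z" "Z \<subseteq> qball d x M" "\<And>z w. z \<in> Z \<Longrightarrow> w \<in> Z \<Longrightarrow> z \<noteq> w \<Longrightarrow> \<epsilon> \<le> d z w" for Z
  proof -
    have disj: "disjoint_family_on (\<lambda>z. qball d z r) Z"
    proof (unfold disjoint_family_on_def, safe)
      fix z w v assume zw: "z \<in> Z" "w \<in> Z" "z \<noteq> w" and v: "v \<in> qball d z r" "v \<in> qball d w r"
      have "d z w \<le> A0 * (d z v + d v w)"
        by (rule d_triangle)
      also have "\<dots> < A0 * (r + r)"
        using v A0_pos d_commute[of v w] by (intro mult_strict_left_mono) (auto simp: qball_def)
      also have "\<dots> = \<epsilon>"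
        using A0_pos by (simp add: r_def)
      finally show "v \<in> {}"
        using Z(3)[OF zw] by simp
    qed
    have sub: "(\<Union>z\<in>Z. qball d z r) \<subseteq> qball d x S"
    proof safe
      fix z w assume "z \<in> Z" "w \<in> qball d z r"
      then have "d x z < M" "d z w < r"
        using Z by (auto simp: qball_def)
      have "d x w \<le> A0 * (d x z + d z w)"
        by (rule d_triangle)
      also have "\<dots> < S"
        unfolding S_def using \<open>d x z < M\<close> \<open>d z w < r\<close> A0_pos
        by (intro mult_strict_left_mono) auto
      finally show "w \<in> qball d x S"
        by (simp add: qball_def)
    qed
    have "real (card Z) * (V x S / doubling_const L) = (\<Sum>z\<in>Z. V x S / doubling_const L)"
      by simp
    also have "\<dots> \<le> (\<Sum>z\<in>Z. V z r)"
    proof (rule sum_mono)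
      fix z assume "z \<in> Z"
      then have "d z x \<le> L * r"
        using Z(2) L(2) by (force simp: qball_def d_commute)
      from V_le_doubling_const[OF pos(1) this L(1)] show "V x S / doubling_const L \<le> V z r"
        using doubling_const_pos[of L] by (simp add: field_simps)
    qed
    also have "\<dots> = measure \<mu> (\<Union>z\<in>Z. qball d z r)"
      unfolding Vol_def using Z(1) disj emeasure_qball_less_top
      by (intro measure_finite_Union[symmetric]) (auto simp: less_top)
    also have "\<dots> \<le> V x S"
      unfolding Vol_def using sub Z(1) by (intro measure_mono_fmeasurable) (auto intro: sets.finite_UN)
    finally have "real (card Z) \<le> doubling_const L"
      using V_pos[OF pos(2), of x] doubling_const_pos[of L] by (simp add: field_simps)
    then show ?thesis
      by linarith
  qed
  show ?thesis
    by (intro exI[of _ "nat \<lceil>doubling_const L\<rceil>"] allI impI bound) auto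
qed (auto simp: qball_empty)

text \<open>A separated set of maximal cardinality is a net, since a point at distance at least
  \<epsilon> from all of it could be added. Packing supplies the maximum.\<close>

lemma finite_net:
  assumes "0 < \<epsilon>"
  obtains Z where "finite Z" "Z \<subseteq> qball d x M" "\<And>y. y \<in> qball d x M \<Longrightarrow> \<exists>z\<in>Z. d z y < \<epsilon>"
proof -
  define P where "P Z \<longleftrightarrow> finite Z \<and> Z \<subseteq> qball d x M \<and> (\<forall>z\<in>Z. \<forall>w\<in>Z. z \<noteq> w \<longrightarrow> \<epsilon> \<le> d z w)" for Z
  have "\<exists>N. \<forall>Z. P Z \<longrightarrow> card Z \<le> N"
    using separated_card_bound[OF assms, of x M] unfolding P_def imp_conjL .
  then obtain N where N: "\<And>Z. P Z \<Longrightarrow> card Z \<le> N"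
    by blast
  have "P {}"
    by (simp add: P_def)
  then have "\<exists>Z. P Z \<and> (\<forall>W. P W \<longrightarrow> card W \<le> card Z)"
    by (rule ex_has_greatest_nat[where b = "Suc N"]) (use N in \<open>auto simp: less_Suc_eq_le\<close>)
  then obtain Z where Z: "P Z" "\<And>W. P W \<Longrightarrow> card W \<le> card Z"
    by auto
  have "\<exists>z\<in>Z. d z y < \<epsilon>" if y: "y \<in> qball d x M" for y
  proof (rule ccontr)
    assume neg: "\<not> (\<exists>z\<in>Z. d z y < \<epsilon>)"
    then have "y \<notin> Z"
      using assms by force
    moreover have "P (insert y Z)"
      using Z(1) y neg by (auto simp: P_def not_less d_commute)
    ultimately show False
      using Z(2)[of "insert y Z"] Z(1) by (simp add: P_def)
  qed
  then show ?thesis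
    using that Z(1) by (auto simp: P_def)
qed

text \<open>Supplies the cells and nodes of the Riemann sums. The balls about the net points are
  made disjoint by \<open>disjointed\<close>, which keeps them measurable.\<close>

lemma finite_partition:
  assumes "0 < \<epsilon>"
  obtains n :: nat and P z where "\<And>i. P i \<in> sets \<mu>" "disjoint_family P"
    "(\<Union>i<n. P i) = qball d x M" "\<And>i. i < n \<Longrightarrow> z i \<in> qball d x M"
    "\<And>i y. i < n \<Longrightarrow> y \<in> P i \<Longrightarrow> d y (z i) < \<epsilon>"
proof -
  obtain Z where Z: "finite Z" "Z \<subseteq> qball d x M" "\<And>y. y \<in> qball d x M \<Longrightarrow> \<exists>z\<in>Z. d z y < \<epsilon>"
    using finite_net[OF assms] by metis
  obtain n z where z: "Z = z ` {i::nat. i < n}"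
    using Z(1) by (metis finite_imp_nat_seg_image_inj_on)
  define U where "U i = qball d x M \<inter> qball d (z i) \<epsilon>" for i
  have "(\<Union>i<n. disjointed U i) = (\<Union>i<n. U i)"
    using finite_UN_disjointed_eq[of U n] by (simp add: atLeast0LessThan)
  also have "\<dots> = qball d x M"
    using Z(3) by (force simp: U_def z qball_def)
  finally have 1: "(\<Union>i<n. disjointed U i) = qball d x M" .
  have "range U \<subseteq> sets \<mu>"
    by (auto simp: U_def)
  from sets.range_disjointed_sets[OF this] have 2: "disjointed U i \<in> sets \<mu>" for i
    by auto
  have 3: "d y (z i) < \<epsilon>" if "y \<in> disjointed U i" for i y
    using that disjointed_subset[of U i] by (auto simp: U_def qball_def d_commute)
  show ?thesis
    by (rule that[of "disjointed U" n z])
      (use 1 2 3 Z(2) in \<open>auto simp: z disjoint_family_disjointed\<close>)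
qed

text \<open>Balls need not be open, but they are measurable. The nets provide a countable dense set,
  and those balls of radius 1/(n+1) about its points that lie inside \<open>U\<close> already cover
  \<open>U\<close>.\<close>

lemma sets_open_quasi:
  assumes "\<And>x. x \<in> U \<Longrightarrow> \<exists>r>0. qball d x r \<subseteq> U"
  shows "U \<in> sets \<mu>"
proof -
  have "\<exists>Z. finite Z \<and> (\<forall>y\<in>qball d x (real m). \<exists>z\<in>Z. d z y < 1 / real (Suc n))" for x m n
    using finite_net[of "1 / real (Suc n)" x "real m"] by (metis divide_pos_pos of_nat_0_less_iff zero_less_Suc zero_less_one)
  then obtain Z where Z: "\<And>x m n. finite (Z x m n)"
      "\<And>x m n y. y \<in> qball d x (real m) \<Longrightarrow> \<exists>z\<in>Z x m n. d z y < 1 / real (Suc n)"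
    by metis
  \<comment> \<open>\<open>undefined\<close> is an arbitrary base point; its balls of integer radius
    exhaust the space, so the union of their nets is dense.\<close>
  define D where "D = (\<Union>m n. Z undefined m n)"
  have cD: "countable D"
    unfolding D_def by (intro countable_UN countableI_type countable_finite Z(1))
  have dD: "\<exists>z\<in>D. d z y < 1 / real (Suc n)" for y n
  proof -
    obtain m :: nat where "d undefined y < real m"
      using reals_Archimedean2 by blast
    then show ?thesis
      using Z(2)[of y undefined m n] by (auto simp: D_def qball_def)
  qed
  define I where "I = {p \<in> D \<times> UNIV. qball d (fst p) (1 / real (Suc (snd p))) \<subseteq> U}"
  have "countable I"
    unfolding I_def by (rule countable_subset[of _ "D \<times> UNIV"]) (auto intro: cD)
  have "U = (\<Union>p\<in>I. qball d (fst p) (1 / real (Suc (snd p))))"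
  proof (intro set_eqI iffI)
    fix x assume "x \<in> U"
    then obtain r where r: "r > 0" "qball d x r \<subseteq> U"
      using assms by blast
    obtain n where n: "1 / real (Suc n) < r / (2 * A0)"
      using r A0_pos by (metis divide_pos_pos inverse_eq_divide mult_pos_pos reals_Archimedean zero_less_numeral)
    obtain z where z: "z \<in> D" "d z x < 1 / real (Suc n)"
      using dD by blast
    have "qball d z (1 / real (Suc n)) \<subseteq> qball d x r"
    proof
      fix w assume "w \<in> qball d z (1 / real (Suc n))"
      then have w: "d z w < r / (2 * A0)"
        using n by (simp add: qball_def)
      have "d x w \<le> A0 * (d x z + d z w)"
        by (rule d_triangle)
      also have "\<dots> < A0 * (r / (2 * A0) + r / (2 * A0))"
        using w z n d_commute[of x z] A0_pos by (intro mult_strict_left_mono) auto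
      also have "\<dots> = r"
        using A0_pos by simp
      finally show "w \<in> qball d x r"
        by (simp add: qball_def)
    qed
    then show "x \<in> (\<Union>p\<in>I. qball d (fst p) (1 / real (Suc (snd p))))"
      using z r by (intro UN_I[of "(z, n)"]) (auto simp: I_def qball_def)
  qed (auto simp: I_def)
  also have "\<dots> \<in> sets \<mu>"
    using \<open>countable I\<close> by (intro sets.countable_UN') auto
  finally show ?thesis .
qed

text \<open>Continuity phrased with balls as neighbourhoods, which is what Hoelder estimates
  deliver; no interior of a ball has to be found.\<close>

definition quasi_continuous :: "('a \<Rightarrow> complex) \<Rightarrow> bool" where
  "quasi_continuous u \<longleftrightarrow> (\<forall>x. \<forall>e>0. \<exists>r>0. \<forall>y. d x y < r \<longrightarrow> norm (u x - u y) < e)"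

lemma quasi_continuous_vimage:
  assumes "quasi_continuous u" "open S" "x \<in> u -` S"
  shows "\<exists>r>0. qball d x r \<subseteq> u -` S"
proof -
  obtain e where e: "e > 0" "\<And>v. dist v (u x) < e \<Longrightarrow> v \<in> S"
    using assms(2,3) unfolding open_dist by (metis vimageE)
  obtain r where "r > 0" "\<And>y. d x y < r \<Longrightarrow> norm (u x - u y) < e"
    using assms(1) e(1) unfolding quasi_continuous_def by meson
  then have "qball d x r \<subseteq> u -` S"
    using e(2) by (auto simp: qball_def dist_norm norm_minus_commute)
  with \<open>r > 0\<close> show ?thesis
    by blast
qed

lemma quasi_continuous_measurable:
  assumes "quasi_continuous u"
  shows "u \<in> borel_measurable \<mu>"
proof (rule borel_measurableI)
  fix S :: "complex set" assume "open S"
  show "u -` S \<inter> space \<mu> \<in> sets \<mu>"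
    using quasi_continuous_vimage[OF assms \<open>open S\<close>] by (auto intro!: sets_open_quasi)
qed

lemma quasi_continuous_continuous_map:
  assumes "quasi_continuous u"
  shows "continuous_map (qm_topology d) euclidean u"
proof -
  have "topspace (qm_topology d) = UNIV"
    by (metis UNIV_I openin_qm_topology openin_subset subset_UNIV subset_antisym gt_ex)
  then show ?thesis
    unfolding continuous_map_def
    using quasi_continuous_vimage[OF assms] by (auto simp: openin_qm_topology vimage_def)
qed

lemma quasi_continuous_hoelder:
  assumes "0 < \<theta>" and "\<And>x. \<exists>c r. 0 < r \<and> (\<forall>y. d x y < r \<longrightarrow> norm (u x - u y) \<le> c * d x y powr \<theta>)"
  shows "quasi_continuous u"
  unfolding quasi_continuous_def
proof (intro allI impI)
  fix x and e :: real assume "e > 0"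
  obtain c r where cr: "0 < r" "\<And>y. d x y < r \<Longrightarrow> norm (u x - u y) \<le> c * d x y powr \<theta>"
    using assms(2)[of x] by blast
  define c' where "c' = max c 1"
  \<comment> \<open>Below this radius \<open>c' * d x y powr \<theta>\<close> stays at most
    \<open>e / 2\<close>.\<close>
  define r' where "r' = min r ((e / (2 * c')) powr (1 / \<theta>))"
  have c': "c' > 0" "c \<le> c'"
    by (auto simp: c'_def)
  have "norm (u x - u y) < e" if "d x y < r'" for y
  proof -
    have "norm (u x - u y) \<le> c * d x y powr \<theta>"
      using that cr by (simp add: r'_def)
    also have "\<dots> \<le> c' * d x y powr \<theta>"
      using c' by (intro mult_right_mono) auto
    also have "\<dots> \<le> c' * ((e / (2 * c')) powr (1 / \<theta>)) powr \<theta>"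
      using that c' assms(1) by (intro mult_left_mono powr_mono2) (auto simp: r'_def)
    also have "\<dots> = e / 2"
      using c' assms(1) \<open>e > 0\<close> by (simp add: powr_powr)
    finally show ?thesis
      using \<open>e > 0\<close> by simp
  qed
  moreover have "r' > 0"
    using cr(1) c' \<open>e > 0\<close> by (simp add: r'_def)
  ultimately show "\<exists>r>0. \<forall>y. d x y < r \<longrightarrow> norm (u x - u y) < e"
    by blast
qed

text \<open>By continuity a bound that fails at one point fails on a ball, and balls have positive
  measure. This turns the essential supremum in the Besov norm into a bound at every point.\<close>

lemma AE_imp_quasi_continuous:
  assumes "quasi_continuous u" "AE x in \<mu>. norm (u x) \<le> a"
  shows "norm (u x) \<le> a"
proof (rule ccontr)
  assume "\<not> norm (u x) \<le> a"
  then obtain r where r: "r > 0" "\<And>y. d x y < r \<Longrightarrow> norm (u x - u y) < norm (u x) - a"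
    using assms(1) unfolding quasi_continuous_def by (meson diff_gt_0_iff_gt not_le)
  have "AE y in \<mu>. y \<notin> qball d x r"
    using assms(2)
  proof eventually_elim
    case (elim y)
    then show ?case
      using r(2)[of y] norm_triangle_ineq2[of "u x" "u y"] by (auto simp: qball_def)
  qed
  then have "emeasure \<mu> (qball d x r) = 0"
    by (subst (asm) AE_iff_measurable[of "qball d x r"]) auto
  then show False
    using V_pos[OF r(1), of x] by (simp add: emeasure_qball)
qed

end

section \<open>Decaying kernels and test functions\<close>

text \<open>With \<open>p = \<omega> + 3\<close>, \<omega> being the doubling exponent, this lets
  the exponential pay both for the growth of volumes and for a polynomial decay of exponent
  3.\<close>

lemma powr_le_exp_powr:
  fixes \<nu> a p :: real
  assumes "0 < \<nu>" "0 < a" "0 \<le> p"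
  shows "\<exists>C>0. \<forall>u\<ge>0. (1 + u) powr p \<le> C * exp (\<nu> * u powr a)"
proof -
  \<comment> \<open>Chosen so that \<open>a * m\<close> is at least \<open>p\<close>, which bounds
    the power of \<open>u\<close> by an integer power of \<open>u powr a\<close>.\<close>
  define m where "m = Suc (nat \<lceil>p / a\<rceil>)"
  have m: "p \<le> a * real m" "0 < m"
  proof -
    have "p / a \<le> real m"
      unfolding m_def by linarith
    then show "p \<le> a * real m"
      using assms by (simp add: field_simps)
  qed (simp add: m_def)
  define C where "C = 2 powr p * (1 + (real m / \<nu>) ^ m)"
  have "(1 + u) powr p \<le> C * exp (\<nu> * u powr a)" if "0 \<le> u" for u
  proof -
    define v where "v = u powr a"
    have v: "0 \<le> v" by (simp add: v_def)
    have "(\<nu> * v / real m) ^ m \<le> (1 + \<nu> * v / real m) ^ m"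
      using assms v by (intro power_mono) auto
    also have "\<dots> \<le> exp (\<nu> * v / real m) ^ m"
      using assms v by (intro power_mono exp_ge_add_one_self) auto
    also have "\<dots> = exp (\<nu> * v)"
      using m by (simp flip: exp_of_nat_mult)
    finally have e: "v ^ m \<le> (real m / \<nu>) ^ m * exp (\<nu> * v)"
      using assms m by (simp add: power_divide power_mult_distrib field_simps)
    have "(1 + u) powr p \<le> (2 * max 1 u) powr p"
      using that assms by (intro powr_mono2) auto
    also have "\<dots> = 2 powr p * max 1 u powr p"
      by (simp add: powr_mult)
    also have "max 1 u powr p \<le> 1 + v ^ m"
    proof (cases "u \<le> 1")
      case True
      then show ?thesis using v by (simp add: max_def)
    next
      case False
      then have "u powr p \<le> u powr (a * real m)"
        using m by (intro powr_mono) auto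
      also have "\<dots> = v ^ m"
        using False by (simp add: v_def powr_powr[symmetric] powr_realpow)
      finally show ?thesis
        using False by (simp add: max_def)
    qed
    also have "1 + v ^ m \<le> exp (\<nu> * v) + (real m / \<nu>) ^ m * exp (\<nu> * v)"
      using assms v by (intro add_mono e) auto
    finally show ?thesis
      by (simp add: C_def v_def algebra_simps mult_left_mono)
  qed
  moreover have "0 < C"
    using assms by (auto simp: C_def intro!: mult_pos_pos add_pos_nonneg)
  ultimately show ?thesis
    by auto
qed

lemma ex_dyadic_floor:
  fixes t :: real
  assumes "1 \<le> t"
  obtains j :: nat where "2 ^ j \<le> t" "t < 2 ^ Suc j"
proof -
  define j where "j = nat \<lfloor>log 2 t\<rfloor>"
  have "0 \<le> log 2 t"
    using assms by simp
  then have j: "real j \<le> log 2 t" "log 2 t < real (Suc j)"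
    by (auto simp: j_def) linarith
  have "2 powr real j \<le> t"
    using j(1) assms by (simp add: le_log_iff)
  moreover have "t < 2 powr real (Suc j)"
    using j(2) assms by (simp add: log_less_iff del: of_nat_Suc)
  ultimately show ?thesis
    using that[of j] by (simp add: powr_realpow del: of_nat_Suc)
qed

lemma norm_integral_le:
  fixes f :: "'b \<Rightarrow> complex"
  assumes "f \<in> borel_measurable M" "integrable M g" "\<And>x. norm (f x) \<le> g x"
  shows "integrable M f" "norm (integral\<^sup>L M f) \<le> integral\<^sup>L M g"
proof -
  show int: "integrable M f"
  proof (rule Bochner_Integration.integrable_bound[OF assms(2,1)])
    show "AE x in M. norm (f x) \<le> norm (g x)"
      using assms(3) by (intro AE_I2) (smt (verit) real_norm_def)
  qed
  have "norm (integral\<^sup>L M f) \<le> (LINT x|M. norm (f x))"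
    by (rule integral_norm_bound)
  also have "\<dots> \<le> integral\<^sup>L M g"
    using int assms(2,3) by (intro integral_mono) auto
  finally show "norm (integral\<^sup>L M f) \<le> integral\<^sup>L M g" .
qed

context homogeneous_space
begin

section \<open>Kernels with polynomial decay\<close>

text \<open>The profile of an approximate identity at scale \<open>R\<close> centred at
  \<open>y\<close>: for positive \<kappa> its integral is bounded uniformly in \<open>R\<close> and
  \<open>y\<close>. The single volume at radius \<open>R + d y x\<close> stands for the customary
  sum of the volumes at radii \<open>R\<close> and \<open>d y x\<close>, to which it is
  comparable.\<close>

definition pw :: "real \<Rightarrow> real \<Rightarrow> 'a \<Rightarrow> 'a \<Rightarrow> real" where
  "pw R \<kappa> y x = (R / (R + d y x)) powr \<kappa> / V y (R + d y x)"

lemma pw_nonneg [simp]: "0 \<le> pw R \<kappa> y x"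
  by (simp add: pw_def)

lemma pw_pos: "0 < R \<Longrightarrow> 0 < pw R \<kappa> y x"
proof -
  assume "0 < R"
  then have "0 < R + d y x"
    by (simp add: add_pos_nonneg)
  with \<open>0 < R\<close> show ?thesis
    using V_pos[of "R + d y x" y] by (simp add: pw_def)
qed

lemma pw_measurable [measurable]: "pw R \<kappa> y \<in> borel_measurable \<mu>"
  unfolding pw_def by measurable

lemma pw_antimono:
  assumes "0 < R" "\<kappa> \<le> \<kappa>'"
  shows "pw R \<kappa>' y x \<le> pw R \<kappa> y x"
proof -
  have "(R / (R + d y x)) powr \<kappa>' \<le> (R / (R + d y x)) powr \<kappa>"
    using assms by (intro powr_mono') (auto simp: add_pos_nonneg)
  then show ?thesis
    by (simp add: pw_def divide_right_mono)
qed

lemma pw_sym: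
  assumes "0 < R"
  shows "pw R \<kappa> x y \<le> doubling_const 1 * pw R \<kappa> y x"
proof -
  have pos: "0 < R + d y x"
    using assms by (simp add: add_pos_nonneg)
  have "1 / V x (R + d y x) \<le> doubling_const 1 / V y (R + d y x)"
    using pos assms by (intro inverse_V_le) (auto simp: d_commute)
  then have "(R / (R + d y x)) powr \<kappa> * (1 / V x (R + d y x)) \<le>
      (R / (R + d y x)) powr \<kappa> * (doubling_const 1 / V y (R + d y x))"
    by (intro mult_left_mono) auto
  then show ?thesis
    by (simp add: pw_def d_commute[of x y] mult.commute)
qed

text \<open>Where \<open>R + d y x\<close> lies between \<open>2 ^ j * R\<close> and
  \<open>2 ^ Suc j * R\<close>, the kernel is at most \<open>q ^ j\<close> over the volume of the
  ball of radius \<open>2 ^ j * R\<close>, and doubling cancels this volume against that of the ball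
  carrying the annulus. The resulting geometric series depends neither on \<open>R\<close> nor on
  \<open>y\<close>.\<close>

lemma ex_pw_tail:
  assumes "0 < \<kappa>"
  shows "\<exists>C>0. \<forall>R y. 0 < R \<longrightarrow> integrable \<mu> (pw R \<kappa> y) \<and> integral\<^sup>L \<mu> (pw R \<kappa> y) \<le> C"
proof -
  define q where "q = (1 / 2 :: real) powr \<kappa>"
  have q: "0 < q" "q < 1"
    using assms powr_less_mono'[of "1/2::real" 0 \<kappa>] by (auto simp: q_def)
  define C where "C = doubling_const 2 * (1 / (1 - q))"
  have C: "0 < C"
    using q doubling_const_pos[of 2] by (simp add: C_def)
  have "integrable \<mu> (pw R \<kappa> y) \<and> integral\<^sup>L \<mu> (pw R \<kappa> y) \<le> C" if R: "0 < R" for R y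
  proof -
    define a where "a j = q ^ j / V y (2 ^ j * R)" for j :: nat
    define B where "B j = qball d y (2 ^ Suc j * R)" for j :: nat
    have a: "0 \<le> a j" for j
      using q by (simp add: a_def)
    have pt: "ennreal (pw R \<kappa> y x) \<le> (\<Sum>j. ennreal (a j) * indicator (B j) x)" for x
    proof -
      have "1 \<le> (R + d y x) / R"
        using R by simp
      then obtain j :: nat where j: "2 ^ j \<le> (R + d y x) / R" "(R + d y x) / R < 2 ^ Suc j"
        by (rule ex_dyadic_floor)
      have j': "2 ^ j * R \<le> R + d y x" "R + d y x < 2 ^ Suc j * R"
        using j R by (auto simp: field_simps)
      have "x \<in> B j"
        using j' R by (simp add: B_def qball_def)
      have "(R / (R + d y x)) powr \<kappa> \<le> ((1 / 2) ^ j) powr \<kappa>"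
        using j' R assms by (intro powr_mono2) (auto simp: field_simps add_pos_nonneg)
      also have "\<dots> = q ^ j"
        by (simp add: q_def powr_powr powr_realpow[symmetric] mult.commute)
      finally have "pw R \<kappa> y x \<le> a j"
        unfolding pw_def a_def using R j' q V_pos[of "2 ^ j * R" y]
        by (intro frac_le V_mono) auto
      then have "ennreal (pw R \<kappa> y x) \<le> ennreal (a j) * indicator (B j) x"
        using \<open>x \<in> B j\<close> by (simp add: ennreal_leI)
      also have "\<dots> = (\<Sum>j\<in>{j}. ennreal (a j) * indicator (B j) x)"
        by (subst sum.insert) simp_all
      also have "\<dots> \<le> (\<Sum>j. ennreal (a j) * indicator (B j) x)"
        by (intro sum_le_suminf) auto
      finally show ?thesis .
    qed
    have "(\<integral>\<^sup>+x. ennreal (pw R \<kappa> y x) \<partial>\<mu>) \<le> (\<integral>\<^sup>+x. (\<Sum>j. ennreal (a j) * indicator (B j) x) \<partial>\<mu>)"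
      by (intro nn_integral_mono pt)
    also have "\<dots> = (\<Sum>j. \<integral>\<^sup>+x. ennreal (a j) * indicator (B j) x \<partial>\<mu>)"
      by (intro nn_integral_suminf) (auto simp: B_def)
    also have "\<dots> = (\<Sum>j. ennreal (a j) * emeasure \<mu> (B j))"
      by (simp add: B_def nn_integral_cmult_indicator)
    also have "\<dots> = (\<Sum>j. ennreal (a j * V y (2 ^ Suc j * R)))"
      using a by (simp add: B_def emeasure_qball ennreal_mult)
    also have "\<dots> \<le> (\<Sum>j. ennreal (doubling_const 2 * q ^ j))"
    proof (intro suminf_le summableI ennreal_leI)
      fix j :: nat
      have "V y (2 ^ Suc j * R) \<le> doubling_const 2 * V y (2 ^ j * R)"
        using R by (intro V_le_doubling_const) auto
      then show "a j * V y (2 ^ Suc j * R) \<le> doubling_const 2 * q ^ j"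
        using q R V_pos[of "2 ^ j * R" y] by (simp add: a_def divide_simps mult_left_mono)
    qed
    also have "\<dots> = ennreal (\<Sum>j. doubling_const 2 * q ^ j)"
      using q doubling_const_pos[of 2] by (intro suminf_ennreal2) (auto intro!: summable_mult summable_geometric)
    also have "(\<Sum>j. doubling_const 2 * q ^ j) = C"
      using q by (simp add: C_def suminf_mult suminf_geometric summable_geometric)
    finally have le: "(\<integral>\<^sup>+x. ennreal (pw R \<kappa> y x) \<partial>\<mu>) \<le> ennreal C" .
    have int: "integrable \<mu> (pw R \<kappa> y)"
      by (intro integrableI_nonneg) (use le in \<open>auto simp: le_less_trans\<close>)
    have "ennreal (integral\<^sup>L \<mu> (pw R \<kappa> y)) \<le> ennreal C"
      using le nn_integral_eq_integral[OF int] by simp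
    then show ?thesis
      using int C by (simp add: ennreal_le_iff)
  qed
  with C show ?thesis
    by auto
qed

definition tail_const :: "real \<Rightarrow> real" where
  "tail_const \<kappa> = (SOME C. 0 < C \<and>
     (\<forall>R y. 0 < R \<longrightarrow> integrable \<mu> (pw R \<kappa> y) \<and> integral\<^sup>L \<mu> (pw R \<kappa> y) \<le> C))"

lemma
  assumes "0 < \<kappa>"
  shows tail_const_pos: "0 < tail_const \<kappa>"
    and integrable_pw: "0 < R \<Longrightarrow> integrable \<mu> (pw R \<kappa> y)"
    and integral_pw_le: "0 < R \<Longrightarrow> integral\<^sup>L \<mu> (pw R \<kappa> y) \<le> tail_const \<kappa>"
  using someI_ex[OF ex_pw_tail[OF assms]] unfolding tail_const_def[symmetric] by blast+

text \<open>Both \<open>V x R\<close> and \<open>V y R\<close> are at least the common volume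
  \<open>W\<close> at radius \<open>R + d x y\<close>, divided by a multiple of
  \<open>(1 + d x y / R) powr \<omega>\<close>. Their geometric mean inherits this, and the
  exponential absorbs the power.\<close>

lemma exp_le_pw:
  assumes "0 < \<nu>" "0 < a"
  shows "\<exists>C>0. \<forall>R x y. 0 < R \<longrightarrow>
    1 / sqrt (V x R * V y R) * exp (- \<nu> * (d x y / R) powr a) \<le> C * pw R 3 x y"
proof -
  obtain C1 \<omega> where C1: "1 \<le> C1" "0 \<le> \<omega>"
    "\<And>x r t. 0 < r \<Longrightarrow> 1 \<le> t \<Longrightarrow> V x (t * r) \<le> C1 * t powr \<omega> * V x r"
    using ex_polynomial_doubling by metis
  obtain C2 where C2: "C2 > 0" "\<And>u. u \<ge> 0 \<Longrightarrow> (1 + u) powr (\<omega> + 3) \<le> C2 * exp (\<nu> * u powr a)"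
    using powr_le_exp_powr[OF assms, of "\<omega> + 3"] C1(2) by auto
  define C where "C = doubling_const 1 * C1 * C2"
  have D: "1 \<le> doubling_const 1"
    by (rule doubling_const_ge_1)
  have "1 / sqrt (V x R * V y R) * exp (- \<nu> * (d x y / R) powr a) \<le> C * pw R 3 x y"
    if R: "0 < R" for R x y
  proof -
    define u where "u = d x y / R"
    define t where "t = 1 + u"
    define W where "W = V x (R + d x y)"
    have u: "0 \<le> u"
      using R by (simp add: u_def)
    have t: "1 \<le> t" "t * R = R + d x y" "R / (R + d x y) = 1 / t"
      using u R by (auto simp: t_def u_def field_simps)
    have W: "0 < W"
      unfolding W_def using R by (intro V_pos) (simp add: add_pos_nonneg)
    have Vx: "0 < V x R" "0 < V y R"
      using R by (auto intro: V_pos)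
    have c0: "0 \<le> C1 * t powr \<omega>"
      using C1(1) by simp
    have "W \<le> C1 * t powr \<omega> * V x R"
      unfolding W_def t(2)[symmetric] using R t(1) by (intro C1)
    also have "\<dots> \<le> doubling_const 1 * (C1 * t powr \<omega>) * V x R"
      using c0 D Vx by (intro mult_right_mono) (auto simp: mult_le_cancel_right1)
    finally have W1: "W \<le> doubling_const 1 * (C1 * t powr \<omega>) * V x R" .
    have "W \<le> doubling_const 1 * V y (R + d x y)"
      unfolding W_def using R by (intro V_le_doubling_const) (auto simp: add_pos_nonneg d_commute)
    also have "V y (R + d x y) \<le> C1 * t powr \<omega> * V y R"
      unfolding t(2)[symmetric] using R t(1) by (intro C1)
    finally have W2: "W \<le> doubling_const 1 * (C1 * t powr \<omega>) * V y R"
      using doubling_const_pos[of 1] by simp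
    define K where "K = doubling_const 1 * (C1 * t powr \<omega>)"
    have K: "0 < K"
      using doubling_const_pos[of 1] C1(1) t(1) by (simp add: K_def)
    have "W * W \<le> (K * V x R) * (K * V y R)"
      using W1 W2 W K Vx unfolding K_def[symmetric] by (intro mult_mono) auto
    then have "W ^ 2 \<le> K ^ 2 * (V x R * V y R)"
      by (simp add: power2_eq_square algebra_simps)
    then have "W \<le> K * sqrt (V x R * V y R)"
      using W K by (metis abs_of_pos real_sqrt_abs real_sqrt_le_mono real_sqrt_mult)
    then have e1: "1 / sqrt (V x R * V y R) \<le> K / W"
      using W Vx by (simp add: field_simps)
    have "t powr (\<omega> + 3) \<le> C2 * exp (\<nu> * u powr a)"
      unfolding t_def by (rule C2(2)[OF u])
    then have e2: "exp (- \<nu> * u powr a) \<le> C2 / t powr (\<omega> + 3)"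
      using t(1) by (simp add: exp_minus field_simps)
    have "1 / sqrt (V x R * V y R) * exp (- \<nu> * u powr a) \<le> K / W * (C2 / t powr (\<omega> + 3))"
      using e1 e2 W K Vx by (intro mult_mono) auto
    also have "\<dots> = C * (1 / t powr 3 / W)"
      using t(1) by (simp add: K_def C_def powr_add field_simps)
    also have "\<dots> = C * pw R 3 x y"
      unfolding pw_def t(3) W_def using t(1) by (simp add: powr_divide)
    finally show ?thesis
      by (simp add: u_def)
  qed
  moreover have "0 < C"
    using C1(1) C2(1) D by (simp add: C_def)
  ultimately show ?thesis
    by auto
qed

lemma decay_le_pw: "decay d \<mu> x0 \<gamma> x \<le> doubling_const 2 * pw 1 \<gamma> x0 x"
  and pw_le_decay: "pw 1 \<gamma> x0 x \<le> 2 * decay d \<mu> x0 \<gamma> x"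
proof -
  define e where "e = d x0 x"
  define S where "S = V x0 1 + V x0 e"
  define W where "W = V x0 (1 + e)"
  have e: "0 \<le> e"
    by (simp add: e_def)
  have W: "0 < W"
    using e by (auto simp: W_def intro: V_pos)
  have S: "0 < S"
    using V_pos[of 1 x0] by (simp add: S_def add_pos_nonneg)
  have "W \<le> doubling_const 2 * V x0 (max 1 e)"
    unfolding W_def using e by (intro V_le_doubling_const) auto
  also have "V x0 (max 1 e) \<le> S"
    by (simp add: S_def max_def)
  finally have 1: "W \<le> doubling_const 2 * S"
    using doubling_const_pos[of 2] by simp
  have 2: "S \<le> 2 * W"
    unfolding S_def W_def using V_mono[of 1 "1 + e" x0] V_mono[of e "1 + e" x0] e by simp
  have eq: "decay d \<mu> x0 \<gamma> x = (1 / (1 + e)) powr \<gamma> / S" "pw 1 \<gamma> x0 x = (1 / (1 + e)) powr \<gamma> / W"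
    using e by (auto simp: decay_def Vol2_def Vol_def S_def pw_def W_def e_def powr_minus powr_divide divide_simps)
  have "1 / S \<le> doubling_const 2 / W" "1 / W \<le> 2 / S"
    using 1 2 W S by (auto simp: field_simps)
  from this[THEN mult_left_mono, of "(1 / (1 + e)) powr \<gamma>"]
  show "decay d \<mu> x0 \<gamma> x \<le> doubling_const 2 * pw 1 \<gamma> x0 x" "pw 1 \<gamma> x0 x \<le> 2 * decay d \<mu> x0 \<gamma> x"
    by (simp_all add: eq mult.commute)
qed

text \<open>The range in the regularity condition keeps the weights of the two points comparable:
  \<open>A0 * d y x\<close> is at most half of \<open>1 + d x0 x\<close> and is absorbed on the
  left.\<close>

lemma one_plus_d_le:
  assumes "d x y \<le> (1 + d x0 x) / (2 * A0)"
  shows "1 + d x0 x \<le> 2 * A0 * (1 + d x0 y)"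
proof -
  have "d x0 x \<le> A0 * (d x0 y + d y x)"
    by (rule d_triangle)
  moreover have "A0 * d y x \<le> (1 + d x0 x) / 2"
    using assms A0_pos by (simp add: d_commute[of y x] field_simps)
  ultimately have "1 + d x0 x \<le> 1 + A0 * d x0 y + (1 + d x0 x) / 2"
    unfolding distrib_left by linarith
  then have "1 + d x0 x \<le> 2 + 2 * (A0 * d x0 y)"
    by (simp add: field_simps)
  also have "\<dots> \<le> 2 * A0 * (1 + d x0 y)"
    using A0_ge_1 by (simp add: ring_distribs)
  finally show ?thesis .
qed

end

section \<open>Test functions and the completion\<close>

locale pointed_homogeneous_space = homogeneous_space +
  fixes x0 :: 'a
begin

abbreviation "pd \<gamma> \<equiv> pw 1 \<gamma> x0"

lemma one_plus_pos [simp]: "0 < 1 + d x y"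
  by (simp add: add_pos_nonneg)

lemma pd_shift:
  assumes "d x y \<le> (1 + d x0 x) / (2 * A0)" "0 \<le> \<gamma>"
  shows "pd \<gamma> y \<le> (2 * A0) powr \<gamma> * doubling_const (2 * A0) * pd \<gamma> x"
proof -
  have *: "1 + d x0 x \<le> 2 * A0 * (1 + d x0 y)"
    using assms(1) by (rule one_plus_d_le)
  have "(1 / (1 + d x0 y)) powr \<gamma> \<le> (2 * A0 * (1 / (1 + d x0 x))) powr \<gamma>"
    using * assms(2) A0_pos by (intro powr_mono2) (auto simp: divide_simps)
  also have "\<dots> = (2 * A0) powr \<gamma> * (1 / (1 + d x0 x)) powr \<gamma>"
    using A0_pos by (subst powr_mult) auto
  finally have 1: "(1 / (1 + d x0 y)) powr \<gamma> \<le> (2 * A0) powr \<gamma> * (1 / (1 + d x0 x)) powr \<gamma>" .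
  have 2: "1 / V x0 (1 + d x0 y) \<le> doubling_const (2 * A0) / V x0 (1 + d x0 x)"
    using * A0_pos by (intro inverse_V_le) auto
  have "pd \<gamma> y = (1 / (1 + d x0 y)) powr \<gamma> * (1 / V x0 (1 + d x0 y))"
    by (simp add: pw_def)
  also have "\<dots> \<le> (2 * A0) powr \<gamma> * (1 / (1 + d x0 x)) powr \<gamma> * (doubling_const (2 * A0) / V x0 (1 + d x0 x))"
    using 1 2 by (intro mult_mono) auto
  also have "\<dots> = (2 * A0) powr \<gamma> * doubling_const (2 * A0) * pd \<gamma> x"
    by (simp add: pw_def)
  finally show ?thesis .
qed

text \<open>This is \<open>test_bound\<close> with its decay factor replaced by the comparable kernel \<open>pd\<close>.\<close>

definition tb :: "real \<Rightarrow> real \<Rightarrow> ('a \<Rightarrow> complex) \<Rightarrow> real \<Rightarrow> bool" where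
  "tb \<beta> \<gamma> f C \<longleftrightarrow> (\<forall>x. norm (f x) \<le> C * pd \<gamma> x) \<and>
     (\<forall>x y. d x y \<le> (1 + d x0 x) / (2 * A0) \<longrightarrow>
        norm (f x - f y) \<le> C * (d x y / (1 + d x0 x)) powr \<beta> * pd \<gamma> x)"

lemma tbI:
  assumes "\<And>x. norm (f x) \<le> C * pd \<gamma> x"
    "\<And>x y. d x y \<le> (1 + d x0 x) / (2 * A0) \<Longrightarrow>
        norm (f x - f y) \<le> C * (d x y / (1 + d x0 x)) powr \<beta> * pd \<gamma> x"
  shows "tb \<beta> \<gamma> f C"
  using assms by (simp add: tb_def)

lemma tb_size: "tb \<beta> \<gamma> f C \<Longrightarrow> norm (f x) \<le> C * pd \<gamma> x"
  by (simp add: tb_def)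

lemma tb_reg: "tb \<beta> \<gamma> f C \<Longrightarrow> d x y \<le> (1 + d x0 x) / (2 * A0) \<Longrightarrow>
    norm (f x - f y) \<le> C * (d x y / (1 + d x0 x)) powr \<beta> * pd \<gamma> x"
  by (simp add: tb_def)

lemma tb_nonneg: "tb \<beta> \<gamma> f C \<Longrightarrow> 0 \<le> C"
  using tb_size[of \<beta> \<gamma> f C x0] pw_pos[of 1 \<gamma> x0 x0] norm_ge_zero[of "f x0"]
  by (metis order_trans zero_le_mult_iff zero_less_one not_le)

lemma pd_pos: "0 < pd \<gamma> x"
  by (rule pw_pos) simp

lemma tb_mono:
  assumes "tb \<beta> \<gamma> f C" "C \<le> C'" shows "tb \<beta> \<gamma> f C'"
proof (rule tbI)
  show "norm (f x) \<le> C' * pd \<gamma> x" for x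
    using tb_size[OF assms(1), of x] assms(2) by (meson mult_right_mono order_trans pw_nonneg)
  show "norm (f x - f y) \<le> C' * (d x y / (1 + d x0 x)) powr \<beta> * pd \<gamma> x"
    if "d x y \<le> (1 + d x0 x) / (2 * A0)" for x y
    using tb_reg[OF assms(1) that] assms(2)
    by (meson mult_right_mono order_trans pw_nonneg powr_ge_zero)
qed

text \<open>Within the range of the regularity condition the ratio
  \<open>d x y / (1 + d x0 x)\<close> is at most 1, so lowering either exponent only weakens the
  bounds.\<close>

lemma tb_exponents:
  assumes "tb \<beta> \<gamma> f C" "\<beta>' \<le> \<beta>" "\<gamma>' \<le> \<gamma>" shows "tb \<beta>' \<gamma>' f C"
proof (rule tbI)
  have C: "0 \<le> C"
    using assms(1) by (rule tb_nonneg)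
  show "norm (f x) \<le> C * pd \<gamma>' x" for x
    using tb_size[OF assms(1), of x] pw_antimono[of 1 \<gamma>' \<gamma> x0 x] assms(3) C
    by (meson mult_left_mono order_trans zero_less_one)
  show "norm (f x - f y) \<le> C * (d x y / (1 + d x0 x)) powr \<beta>' * pd \<gamma>' x"
    if *: "d x y \<le> (1 + d x0 x) / (2 * A0)" for x y
  proof -
    have "(1 + d x0 x) / (2 * A0) \<le> (1 + d x0 x) / 1"
      using A0_ge_1 by (intro divide_left_mono) auto
    from order_trans[OF * this] have "d x y \<le> 1 + d x0 x"
      by simp
    then have "d x y / (1 + d x0 x) \<le> 1"
      by (simp add: divide_le_eq_1_pos)
    then have "(d x y / (1 + d x0 x)) powr \<beta> \<le> (d x y / (1 + d x0 x)) powr \<beta>'"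
      using assms(2) by (intro powr_mono') auto
    moreover have "pd \<gamma> x \<le> pd \<gamma>' x"
      using assms(3) by (intro pw_antimono) auto
    ultimately have "C * (d x y / (1 + d x0 x)) powr \<beta> * pd \<gamma> x \<le> C * (d x y / (1 + d x0 x)) powr \<beta>' * pd \<gamma>' x"
      using C by (intro mult_mono) auto
    then show ?thesis
      using tb_reg[OF assms(1) *] by linarith
  qed
qed

lemma tb_add:
  assumes "tb \<beta> \<gamma> f C" "tb \<beta> \<gamma> g D" shows "tb \<beta> \<gamma> (\<lambda>x. f x + g x) (C + D)"
proof (rule tbI)
  show "norm (f x + g x) \<le> (C + D) * pd \<gamma> x" for x
    using tb_size[OF assms(1), of x] tb_size[OF assms(2), of x] norm_triangle_ineq[of "f x" "g x"]
    by (simp add: ring_distribs)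
  show "norm (f x + g x - (f y + g y)) \<le> (C + D) * (d x y / (1 + d x0 x)) powr \<beta> * pd \<gamma> x"
    if "d x y \<le> (1 + d x0 x) / (2 * A0)" for x y
    using tb_reg[OF assms(1) that] tb_reg[OF assms(2) that]
      norm_triangle_ineq[of "f x - f y" "g x - g y"]
    by (simp add: ring_distribs add_diff_add)
qed

lemma tb_cmult:
  assumes "tb \<beta> \<gamma> f C" shows "tb \<beta> \<gamma> (\<lambda>x. c * f x) (norm c * C)"
proof (rule tbI)
  show "norm (c * f x) \<le> norm c * C * pd \<gamma> x" for x
    using mult_left_mono[OF tb_size[OF assms, of x], of "norm c"] by (simp add: norm_mult mult.assoc)
  show "norm (c * f x - c * f y) \<le> norm c * C * (d x y / (1 + d x0 x)) powr \<beta> * pd \<gamma> x"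
    if "d x y \<le> (1 + d x0 x) / (2 * A0)" for x y
    using mult_left_mono[OF tb_reg[OF assms that], of "norm c"]
    by (simp add: norm_mult mult.assoc flip: right_diff_distrib)
qed

lemma tb_zero: "tb \<beta> \<gamma> (\<lambda>x. 0) 0"
  by (simp add: tb_def)

lemma tb_diff:
  assumes "tb \<beta> \<gamma> f C" "tb \<beta> \<gamma> g D" shows "tb \<beta> \<gamma> (\<lambda>x. f x - g x) (C + D)"
  using tb_add[OF assms(1) tb_cmult[OF assms(2), of "-1"]] by simp

lemma tb_minus_commute: "tb \<beta> \<gamma> (\<lambda>x. f x - g x) C \<Longrightarrow> tb \<beta> \<gamma> (\<lambda>x. g x - f x) C"
  using tb_cmult[of \<beta> \<gamma> "\<lambda>x. f x - g x" C "-1"] by simp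

lemma tb_sum:
  assumes "finite I" "\<And>i. i \<in> I \<Longrightarrow> tb \<beta> \<gamma> (f i) (C i)"
  shows "tb \<beta> \<gamma> (\<lambda>x. \<Sum>i\<in>I. f i x) (\<Sum>i\<in>I. C i)"
  using assms by (induction I) (auto intro: tb_zero tb_add)

text \<open>Both conditions are closed under pointwise limits. This takes the place of completeness
  of the test space when series are summed.\<close>

lemma tb_limit:
  assumes "\<And>n. tb \<beta> \<gamma> (f n) C" "\<And>x. (\<lambda>n::nat. f n x) \<longlonglongrightarrow> g x"
  shows "tb \<beta> \<gamma> g C"
proof (rule tbI)
  show "norm (g x) \<le> C * pd \<gamma> x" for x
    by (rule Lim_norm_ubound[OF _ assms(2)]) (auto intro!: always_eventually tb_size assms(1))
  show "norm (g x - g y) \<le> C * (d x y / (1 + d x0 x)) powr \<beta> * pd \<gamma> x"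
    if "d x y \<le> (1 + d x0 x) / (2 * A0)" for x y
    by (rule Lim_norm_ubound[OF _ tendsto_diff[OF assms(2) assms(2)]])
      (auto intro!: always_eventually tb_reg that assms(1))
qed

lemma tb_quasi_continuous:
  assumes "tb \<beta> \<gamma> f C" "0 < \<beta>"
  shows "quasi_continuous f"
proof (rule quasi_continuous_hoelder[OF assms(2)])
  fix x
  have "norm (f x - f y) \<le> C / (1 + d x0 x) powr \<beta> * pd \<gamma> x * d x y powr \<beta>"
    if "d x y < (1 + d x0 x) / (2 * A0)" for y
  proof -
    have "norm (f x - f y) \<le> C * (d x y / (1 + d x0 x)) powr \<beta> * pd \<gamma> x"
      using that by (intro tb_reg[OF assms(1)]) simp
    also have "(d x y / (1 + d x0 x)) powr \<beta> = d x y powr \<beta> / (1 + d x0 x) powr \<beta>"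
      by (subst powr_divide) (auto simp: less_imp_le)
    finally show ?thesis
      by (simp add: field_simps)
  qed
  moreover have "0 < (1 + d x0 x) / (2 * A0)"
    using A0_pos by simp
  ultimately show "\<exists>c r. 0 < r \<and> (\<forall>y. d x y < r \<longrightarrow> norm (f x - f y) \<le> c * d x y powr \<beta>)"
    by blast
qed

lemma tb_measurable: "tb \<beta> \<gamma> f C \<Longrightarrow> 0 < \<beta> \<Longrightarrow> f \<in> borel_measurable \<mu>"
  by (intro quasi_continuous_measurable tb_quasi_continuous)

lemma tb_integrable:
  assumes "tb \<beta> \<gamma> f C" "0 < \<beta>" "0 < \<gamma>"
  shows "integrable \<mu> f" "(LINT x|\<mu>. norm (f x)) \<le> C * tail_const \<gamma>"
proof -
  have int: "integrable \<mu> (\<lambda>x. C * pd \<gamma> x)"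
    using integrable_pw[OF assms(3)] by simp
  show i: "integrable \<mu> f"
    using tb_size[OF assms(1)] tb_measurable[OF assms(1,2)] int by (intro norm_integral_le(1)[where g = "\<lambda>x. C * pd \<gamma> x"])
  have "(LINT x|\<mu>. norm (f x)) \<le> (LINT x|\<mu>. C * pd \<gamma> x)"
    using tb_size[OF assms(1)] i int by (intro integral_mono) auto
  also have "\<dots> = C * (LINT x|\<mu>. pd \<gamma> x)"
    by simp
  also have "\<dots> \<le> C * tail_const \<gamma>"
    using tb_nonneg[OF assms(1)] integral_pw_le[OF assms(3)] by (intro mult_left_mono) auto
  finally show "(LINT x|\<mu>. norm (f x)) \<le> C * tail_const \<gamma>" .
qed

lemma decay_pos: "0 < decay d \<mu> x0 \<gamma> x"
  using pw_le_decay[of \<gamma> x0 x] pd_pos[of \<gamma> x] by linarith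

lemma tb_imp_test_bound:
  assumes "tb \<beta> \<gamma> f C" shows "test_bound d A0 \<mu> x0 \<beta> \<gamma> f (2 * C)"
  unfolding test_bound_def
proof (intro conjI allI impI)
  have C: "0 \<le> C"
    using assms by (rule tb_nonneg)
  show "norm (f x) \<le> 2 * C * decay d \<mu> x0 \<gamma> x" for x
    using tb_size[OF assms, of x] mult_left_mono[OF pw_le_decay[of \<gamma> x0 x] C] by simp
  show "norm (f x - f y) \<le> 2 * C * (d x y / (1 + d x0 x)) powr \<beta> * decay d \<mu> x0 \<gamma> x"
    if "d x y \<le> (1 + d x0 x) / (2 * A0)" for x y
    using tb_reg[OF assms that] C
      mult_left_mono[OF pw_le_decay[of \<gamma> x0 x], of "C * (d x y / (1 + d x0 x)) powr \<beta>"]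
    by (simp add: algebra_simps)
qed

lemma test_bound_imp_tb:
  assumes "test_bound d A0 \<mu> x0 \<beta> \<gamma> f C" shows "tb \<beta> \<gamma> f (doubling_const 2 * C)" "0 \<le> C"
proof -
  have b: "norm (f x) \<le> C * decay d \<mu> x0 \<gamma> x" for x
    using assms by (simp add: test_bound_def)
  show C: "0 \<le> C"
    using b[of x0] decay_pos[of \<gamma> x0] norm_ge_zero[of "f x0"]
    by (metis order_trans zero_le_mult_iff not_le)
  show "tb \<beta> \<gamma> f (doubling_const 2 * C)"
  proof (rule tbI)
    show "norm (f x) \<le> doubling_const 2 * C * pd \<gamma> x" for x
      using b[of x] mult_left_mono[OF decay_le_pw[of x0 \<gamma> x] C] by (simp add: algebra_simps)
    show "norm (f x - f y) \<le> doubling_const 2 * C * (d x y / (1 + d x0 x)) powr \<beta> * pd \<gamma> x"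
      if *: "d x y \<le> (1 + d x0 x) / (2 * A0)" for x y
    proof -
      have "norm (f x - f y) \<le> C * (d x y / (1 + d x0 x)) powr \<beta> * decay d \<mu> x0 \<gamma> x"
        using assms * by (simp add: test_bound_def)
      then show ?thesis
        using C mult_left_mono[OF decay_le_pw[of x0 \<gamma> x], of "C * (d x y / (1 + d x0 x)) powr \<beta>"]
        by (simp add: algebra_simps)
    qed
  qed
qed

lemma test_space_iff: "f \<in> test_space d A0 \<mu> x0 \<beta> \<gamma> \<longleftrightarrow> (\<exists>C. tb \<beta> \<gamma> f C)"
proof
  assume "f \<in> test_space d A0 \<mu> x0 \<beta> \<gamma>"
  then show "\<exists>C. tb \<beta> \<gamma> f C"
    unfolding test_space_def using test_bound_imp_tb(1) by blast
next
  assume "\<exists>C. tb \<beta> \<gamma> f C"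
  then obtain C where C: "tb \<beta> \<gamma> f C"
    by blast
  have "tb \<beta> \<gamma> f (C + 1)"
    using C by (rule tb_mono) simp
  from tb_imp_test_bound[OF this] show "f \<in> test_space d A0 \<mu> x0 \<beta> \<gamma>"
    unfolding test_space_def using tb_nonneg[OF C] by (intro CollectI exI[of _ "2 * (C + 1)"]) auto
qed

lemma test_norm_le:
  assumes "tb \<beta> \<gamma> f C"
  shows "test_norm d A0 \<mu> x0 \<beta> \<gamma> f \<le> 2 * C"
proof (rule field_le_epsilon)
  fix e :: real assume "0 < e"
  have C: "0 \<le> C"
    using assms by (rule tb_nonneg)
  have "tb \<beta> \<gamma> f (C + e / 2)"
    using assms by (rule tb_mono) (use \<open>0 < e\<close> in simp)
  then have "test_bound d A0 \<mu> x0 \<beta> \<gamma> f (2 * C + e)"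
    using tb_imp_test_bound by fastforce
  then show "test_norm d A0 \<mu> x0 \<beta> \<gamma> f \<le> 2 * C + e"
    unfolding test_norm_def using C \<open>0 < e\<close>
    by (intro cInf_lower) (auto intro!: bdd_belowI[of _ 0])
qed

lemma test_norm_nonneg:
  assumes "tb \<beta> \<gamma> f C"
  shows "0 \<le> test_norm d A0 \<mu> x0 \<beta> \<gamma> f"
proof -
  have "f \<in> test_space d A0 \<mu> x0 \<beta> \<gamma>"
    using assms by (auto simp: test_space_iff)
  then have "{C. 0 < C \<and> test_bound d A0 \<mu> x0 \<beta> \<gamma> f C} \<noteq> {}"
    by (auto simp: test_space_def)
  then show ?thesis
    unfolding test_norm_def by (intro cInf_greatest) auto
qed

lemma test_norm_less:
  assumes "tb \<beta> \<gamma> f C" "test_norm d A0 \<mu> x0 \<beta> \<gamma> f < e"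
  shows "tb \<beta> \<gamma> f (doubling_const 2 * e)"
proof -
  have "f \<in> test_space d A0 \<mu> x0 \<beta> \<gamma>"
    using assms by (auto simp: test_space_iff)
  then have "{C. 0 < C \<and> test_bound d A0 \<mu> x0 \<beta> \<gamma> f C} \<noteq> {}"
    by (auto simp: test_space_def)
  from cInf_lessD[OF this assms(2)[unfolded test_norm_def]]
  obtain D where D: "test_bound d A0 \<mu> x0 \<beta> \<gamma> f D" "D < e"
    by auto
  show ?thesis
    using test_bound_imp_tb(1)[OF D(1)] by (rule tb_mono) (use D doubling_const_pos[of 2] in auto)
qed

lemma test_space0_iff:
  "f \<in> test_space0 d A0 \<mu> x0 \<beta> \<gamma> \<longleftrightarrow> (\<exists>C. tb \<beta> \<gamma> f C) \<and> has_bochner_integral \<mu> f 0"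
  by (simp add: test_space0_def test_space_iff)

text \<open>Approximation in the norm, rephrased with \<open>tb\<close> and without sequences;
  membership in the completion is handled in this form throughout.\<close>

lemma test_completion_iff:
  assumes "\<beta> \<le> \<eta>" "\<gamma> \<le> \<eta>"
  shows "f \<in> test_completion d A0 \<mu> x0 \<eta> \<beta> \<gamma> \<longleftrightarrow>
    f \<in> test_space0 d A0 \<mu> x0 \<beta> \<gamma> \<and>
    (\<forall>e>0. \<exists>\<phi>\<in>test_space0 d A0 \<mu> x0 \<eta> \<eta>. tb \<beta> \<gamma> (\<lambda>x. \<phi> x - f x) e)"
proof (intro iffI conjI allI impI)
  assume f: "f \<in> test_completion d A0 \<mu> x0 \<eta> \<beta> \<gamma>"
  then show f0: "f \<in> test_space0 d A0 \<mu> x0 \<beta> \<gamma>"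
    by (simp add: test_completion_def)
  fix e :: real assume "0 < e"
  obtain \<phi> where \<phi>: "\<And>n::nat. \<phi> n \<in> test_space0 d A0 \<mu> x0 \<eta> \<eta>"
    "(\<lambda>n. test_norm d A0 \<mu> x0 \<beta> \<gamma> (\<lambda>x. \<phi> n x - f x)) \<longlonglongrightarrow> 0"
    using f unfolding test_completion_def by blast
  have "0 < e / doubling_const 2"
    using \<open>0 < e\<close> doubling_const_pos[of 2] by simp
  from order_tendstoD(2)[OF \<phi>(2) this]
  obtain n where n: "test_norm d A0 \<mu> x0 \<beta> \<gamma> (\<lambda>x. \<phi> n x - f x) < e / doubling_const 2"
    by (auto simp: eventually_sequentially)
  obtain C D where "tb \<eta> \<eta> (\<phi> n) C" "tb \<beta> \<gamma> f D"
    using \<phi>(1)[of n] f0 by (auto simp: test_space0_iff)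
  then have "tb \<beta> \<gamma> (\<lambda>x. \<phi> n x - f x) (C + D)"
    using assms by (intro tb_diff) (auto intro: tb_exponents)
  from test_norm_less[OF this n] have "tb \<beta> \<gamma> (\<lambda>x. \<phi> n x - f x) e"
    using doubling_const_pos[of 2] by simp
  then show "\<exists>\<phi>\<in>test_space0 d A0 \<mu> x0 \<eta> \<eta>. tb \<beta> \<gamma> (\<lambda>x. \<phi> x - f x) e"
    using \<phi>(1) by blast
next
  assume *: "f \<in> test_space0 d A0 \<mu> x0 \<beta> \<gamma> \<and>
    (\<forall>e>0. \<exists>\<phi>\<in>test_space0 d A0 \<mu> x0 \<eta> \<eta>. tb \<beta> \<gamma> (\<lambda>x. \<phi> x - f x) e)"
  then have "\<forall>n. \<exists>\<phi>\<in>test_space0 d A0 \<mu> x0 \<eta> \<eta>. tb \<beta> \<gamma> (\<lambda>x. \<phi> x - f x) (1 / real (Suc n))"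
    by simp
  then obtain \<phi> where \<phi>: "\<And>n. \<phi> n \<in> test_space0 d A0 \<mu> x0 \<eta> \<eta>"
      "\<And>n. tb \<beta> \<gamma> (\<lambda>x. \<phi> n x - f x) (1 / real (Suc n))"
    by metis
  have "(\<lambda>n. test_norm d A0 \<mu> x0 \<beta> \<gamma> (\<lambda>x. \<phi> n x - f x)) \<longlonglongrightarrow> 0"
  proof (rule tendsto_sandwich)
    show "\<forall>\<^sub>F n in sequentially. 0 \<le> test_norm d A0 \<mu> x0 \<beta> \<gamma> (\<lambda>x. \<phi> n x - f x)"
      using test_norm_nonneg[OF \<phi>(2)] by simp
    show "\<forall>\<^sub>F n in sequentially. test_norm d A0 \<mu> x0 \<beta> \<gamma> (\<lambda>x. \<phi> n x - f x) \<le> 2 * (1 / real (Suc n))"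
      by (intro always_eventually allI test_norm_le \<phi>(2))
    show "(\<lambda>n. 2 * (1 / real (Suc n))) \<longlonglongrightarrow> 0"
      using tendsto_mult_left[OF LIMSEQ_inverse_real_of_nat, of 2] by (simp add: inverse_eq_divide)
  qed simp
  then show "f \<in> test_completion d A0 \<mu> x0 \<eta> \<beta> \<gamma>"
    unfolding test_completion_def using * \<phi>(1) by blast
qed

section \<open>Pairing a localised kernel with a test function\<close>

text \<open>Common form of a column \<open>x \<mapsto> Q k x y\<close> and of a difference of two
  columns, so that size and regularity of \<open>T k \<psi>\<close> come out of one pairing
  estimate. Regularity is asked for only against \<open>x0\<close>, the value that is subtracted at
  coarse scales.\<close>

definition admissible :: "real \<Rightarrow> real \<Rightarrow> 'a \<Rightarrow> ('a \<Rightarrow> complex) \<Rightarrow> real \<Rightarrow> bool" where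
  "admissible R \<theta> y K l \<longleftrightarrow> 0 \<le> l \<and> has_bochner_integral \<mu> K 0
     \<and> (\<forall>x. norm (K x) \<le> l * pw R 3 y x)
     \<and> (\<forall>x. norm (K x - K x0) \<le> l * (d x0 x / R) powr \<theta> * (pw R 3 y x + pw R 3 y x0))"

lemma admissibleD:
  assumes "admissible R \<theta> y K l"
  shows "0 \<le> l" "integrable \<mu> K" "integral\<^sup>L \<mu> K = 0" "K \<in> borel_measurable \<mu>"
    "norm (K x) \<le> l * pw R 3 y x"
    "norm (K x - K x0) \<le> l * (d x0 x / R) powr \<theta> * (pw R 3 y x + pw R 3 y x0)"
  using assms unfolding admissible_def has_bochner_integral_iff by auto

text \<open>The integral of \<open>K \<psi>\<close> is split at \<open>near\<close>, where the regularity of \<open>\<psi>\<close> at \<open>y\<close> is available; off this set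
  \<open>K\<close> is bounded by a constant of the size \<open>far_size\<close>, uniformly in the variable of integration.\<close>

definition near :: "real \<Rightarrow> 'a \<Rightarrow> 'a set" where
  "near R y = {x. 2 * A0 * (R + d y x) < 1 + d x0 y}"

text \<open>Off \<open>near\<close>, \<open>R + d y x\<close> is at least
  \<open>outer_scale R y / (2 * A0)\<close>, so bounds there can be read off at this scale and with
  volumes centred at \<open>x0\<close>; \<open>far_size\<close> is the kernel \<open>pw\<close> of
  exponent 3 so evaluated.\<close>

definition outer_scale :: "real \<Rightarrow> 'a \<Rightarrow> real" where
  "outer_scale R y = max R (1 + d x0 y)"

definition far_size :: "real \<Rightarrow> 'a \<Rightarrow> real" where
  "far_size R y = (R / outer_scale R y) powr 3 / V x0 (outer_scale R y)"

definition rel_scale :: "real \<Rightarrow> 'a \<Rightarrow> real" where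
  "rel_scale R y = min 1 (R / (1 + d x0 y))"

definition far_const :: real where
  "far_const = (2 * A0) powr 3 * doubling_const (2 * A0)"

lemma far_const_pos: "0 < far_const"
  using A0_pos doubling_const_pos by (simp add: far_const_def)

lemma near_measurable [measurable]: "near R y \<in> sets \<mu>"
proof -
  have "{x \<in> space \<mu>. 2 * A0 * (R + d y x) < 1 + d x0 y} \<in> sets \<mu>"
    by measurable
  then show ?thesis
    by (simp add: near_def)
qed

lemma Compl_measurable [measurable, simp]: "N \<in> sets \<mu> \<Longrightarrow> - N \<in> sets \<mu>"
  using sets.compl_sets[of N \<mu>] by (simp add: Compl_eq_Diff_UNIV)

lemma near_dist:
  assumes "0 < R" "x \<in> near R y"
  shows "d y x \<le> (1 + d x0 y) / (2 * A0)" "R < 1 + d x0 y"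
proof -
  have *: "2 * A0 * (R + d y x) < 1 + d x0 y"
    using assms by (simp add: near_def)
  have "2 * A0 * d y x \<le> 2 * A0 * (R + d y x)"
    using A0_pos assms by simp
  then show "d y x \<le> (1 + d x0 y) / (2 * A0)"
    using * A0_pos by (simp add: field_simps)
  have "1 * R \<le> 2 * A0 * (R + d y x)"
    using A0_ge_1 assms by (intro mult_mono) auto
  then show "R < 1 + d x0 y"
    using * by linarith
qed

lemma outer_scale_pos: "0 < outer_scale R y"
  by (simp add: outer_scale_def less_max_iff_disj)

lemma far_size_nonneg [simp]: "0 \<le> far_size R y"
  by (simp add: far_size_def)

lemma rel_scale_eq: "0 < R \<Longrightarrow> rel_scale R y = R / outer_scale R y"
  by (auto simp: rel_scale_def outer_scale_def min_def max_def divide_simps add_nonneg_eq_0_iff)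

lemma not_near_pw_le:
  assumes "0 < R" "x \<notin> near R y"
  shows "pw R 3 y x \<le> far_const * far_size R y"
proof -
  have pos: "0 < R + d y x"
    using assms by (simp add: add_pos_nonneg)
  have "1 + d x0 y \<le> 2 * A0 * (R + d y x)"
    using assms by (simp add: near_def)
  moreover have "1 * R \<le> 2 * A0 * (R + d y x)"
    using A0_ge_1 assms by (intro mult_mono) auto
  ultimately have S: "outer_scale R y \<le> 2 * A0 * (R + d y x)"
    by (simp add: outer_scale_def)
  have "R / (R + d y x) \<le> 2 * A0 * (R / outer_scale R y)"
    using mult_left_mono[OF S, of R] pos assms outer_scale_pos[of R y] by (simp add: field_simps)
  then have "(R / (R + d y x)) powr 3 \<le> (2 * A0 * (R / outer_scale R y)) powr 3"
    using assms pos by (intro powr_mono2) auto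
  also have "\<dots> = (2 * A0) powr 3 * (R / outer_scale R y) powr 3"
    using A0_pos assms outer_scale_pos[of R y] by (subst powr_mult) auto
  finally have 1: "(R / (R + d y x)) powr 3 \<le> (2 * A0) powr 3 * (R / outer_scale R y) powr 3" .
  have "d y x0 \<le> outer_scale R y"
    by (simp add: outer_scale_def d_commute le_max_iff_disj)
  then have 2: "1 / V y (R + d y x) \<le> doubling_const (2 * A0) / V x0 (outer_scale R y)"
    using S pos outer_scale_pos by (intro inverse_V_le) auto
  have "pw R 3 y x = (R / (R + d y x)) powr 3 * (1 / V y (R + d y x))"
    by (simp add: pw_def)
  also have "\<dots> \<le> ((2 * A0) powr 3 * (R / outer_scale R y) powr 3) * (doubling_const (2 * A0) / V x0 (outer_scale R y))"
    using 1 2 by (intro mult_mono) auto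
  finally show ?thesis
    by (simp add: far_const_def far_size_def mult_ac)
qed

lemma pw_succ:
  assumes "0 < R"
  shows "pw R (\<kappa> + 1) y x = R / (R + d y x) * pw R \<kappa> y x"
  using assms by (simp add: pw_def powr_add add_pos_nonneg)

text \<open>One of the three powers of decay pays for the growth of
  \<open>(d y x / R) powr \<theta>\<close>, and exponent 2 is still integrable.\<close>

lemma powr_d_pw_le:
  assumes "0 < R" "0 \<le> \<theta>" "\<theta> \<le> 1"
  shows "(d y x / R) powr \<theta> * pw R 3 y x \<le> pw R 2 y x"
proof -
  have pos: "0 < R + d y x"
    using assms by (simp add: add_pos_nonneg)
  have "(d y x / R) powr \<theta> \<le> ((R + d y x) / R) powr \<theta>"
    using assms by (intro powr_mono2) (auto simp: divide_right_mono)
  also have "\<dots> \<le> ((R + d y x) / R) powr 1"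
    using assms by (intro powr_mono) auto
  finally have "(d y x / R) powr \<theta> \<le> (R + d y x) / R"
    using assms by simp
  then have "(d y x / R) powr \<theta> * pw R 3 y x \<le> (R + d y x) / R * pw R 3 y x"
    by (intro mult_right_mono) auto
  also have "\<dots> = pw R 2 y x"
    using pw_succ[OF assms(1), of 2 y x] pos assms by simp
  finally show ?thesis .
qed

lemma powr_d_pd_le:
  assumes "0 \<le> \<theta>"
  shows "d x0 x powr \<theta> * pd \<gamma> x \<le> pd (\<gamma> - \<theta>) x"
proof -
  have "d x0 x powr \<theta> \<le> (1 + d x0 x) powr \<theta>"
    using assms by (intro powr_mono2) auto
  then have "d x0 x powr \<theta> * pd \<gamma> x \<le> (1 + d x0 x) powr \<theta> * pd \<gamma> x"
    by (intro mult_right_mono) auto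
  also have "\<dots> = pd (\<gamma> - \<theta>) x"
    by (simp add: pw_def powr_divide powr_diff less_imp_le)
  finally show ?thesis .
qed

lemma pd_split: "pd \<gamma> x = (1 + d x0 x) powr (- \<theta>) * pd (\<gamma> - \<theta>) x"
proof -
  have "(1 / (1 + d x0 x)) powr p = (1 + d x0 x) powr (- p)" for p
    by (simp add: powr_divide powr_minus_divide less_imp_le)
  then show ?thesis
    by (simp add: pw_def powr_add[symmetric])
qed

text \<open>\<psi> is compared with its value at \<open>y\<close>. What remains is
  \<open>\<psi> y\<close> times the integral of \<open>K\<close> over the near set; by the
  cancellation of \<open>K\<close> this is minus the integral over the far set, where one power of
  the decay yields the factor \<open>rel_scale R y powr \<beta>\<close>.\<close>

lemma near_part:
  assumes R: "0 < R" and K: "admissible R \<theta> y K l" and \<psi>: "tb \<beta> \<gamma> \<psi> b"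
    and \<beta>: "0 < \<beta>" "\<beta> \<le> 1"
  shows "norm (LINT x|\<mu>. indicator (near R y) x *\<^sub>R (K x * \<psi> x)) \<le>
    tail_const 2 * (1 + 2 * A0) * l * b * (if R < 1 + d x0 y then rel_scale R y powr \<beta> * pd \<gamma> y else 0)"
proof (cases "R < 1 + d x0 y")
  case False
  then have "near R y = {}"
    using near_dist(2)[OF R] by blast
  then show ?thesis
    using False by simp
next
  case True
  define N where "N = near R y"
  have [measurable]: "N \<in> sets \<mu>"
    by (simp add: N_def)
  define r where "r = R / (1 + d x0 y)"
  have r: "0 < r" "rel_scale R y = r"
    using R True by (auto simp: r_def rel_scale_def)
  have b: "0 \<le> b"
    by (rule tb_nonneg[OF \<psi>])
  have [measurable]: "K \<in> borel_measurable \<mu>" "\<psi> \<in> borel_measurable \<mu>"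
    using admissibleD(4)[OF K] tb_measurable[OF \<psi> \<beta>(1)] by auto
  have ip: "integrable \<mu> (\<lambda>x. c * pw R 2 y x)" for c
    using integrable_pw[of 2 R y] R by simp
  have ile: "(LINT x|\<mu>. c * pw R 2 y x) \<le> c * tail_const 2" if "0 \<le> c" for c
    using integral_pw_le[of 2 R y] R that by (simp add: mult_left_mono)
  define c1 where "c1 = l * b * r powr \<beta> * pd \<gamma> y"
  have c1: "0 \<le> c1"
    using admissibleD(1)[OF K] b by (simp add: c1_def)
  have p1: "norm (indicator N x *\<^sub>R (K x * (\<psi> x - \<psi> y))) \<le> c1 * pw R 2 y x" for x
  proof (cases "x \<in> N")
    case x: True
    have "norm (\<psi> x - \<psi> y) \<le> b * (d y x / (1 + d x0 y)) powr \<beta> * pd \<gamma> y"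
      using tb_reg[OF \<psi> near_dist(1)[OF R]] x by (simp add: norm_minus_commute N_def)
    also have "d y x / (1 + d x0 y) = d y x / R * r"
      using R by (simp add: r_def)
    also have "(d y x / R * r) powr \<beta> = (d y x / R) powr \<beta> * r powr \<beta>"
      using R r by (subst powr_mult) auto
    finally have "norm (K x) * norm (\<psi> x - \<psi> y) \<le>
        (l * pw R 3 y x) * (b * ((d y x / R) powr \<beta> * r powr \<beta>) * pd \<gamma> y)"
      using admissibleD(1,5)[OF K] by (intro mult_mono) auto
    also have "\<dots> = c1 * ((d y x / R) powr \<beta> * pw R 3 y x)"
      by (simp add: c1_def)
    also have "\<dots> \<le> c1 * pw R 2 y x"
      using c1 R \<beta> by (intro mult_left_mono powr_d_pw_le) auto
    finally show ?thesis
      using x by (simp add: norm_mult)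
  qed (use c1 in simp)
  have i1: "integrable \<mu> (\<lambda>x. indicator N x *\<^sub>R (K x * (\<psi> x - \<psi> y)))"
    and n1: "norm (LINT x|\<mu>. indicator N x *\<^sub>R (K x * (\<psi> x - \<psi> y))) \<le> c1 * tail_const 2"
    using norm_integral_le[OF _ ip p1] ile[OF c1] by (force, force)
  define c2 where "c2 = l * (2 * A0) * r powr \<beta>"
  have c2: "0 \<le> c2"
    using admissibleD(1)[OF K] A0_pos by (simp add: c2_def)
  have p2: "norm (indicator (- N) x *\<^sub>R K x) \<le> c2 * pw R 2 y x" for x
  proof (cases "x \<in> N")
    case x: False
    have pos: "0 < R + d y x"
      using R by (simp add: add_pos_nonneg)
    have far: "1 + d x0 y \<le> 2 * A0 * (R + d y x)"
      using x by (simp add: near_def N_def)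
    have "R / (R + d y x) \<le> (R / (R + d y x)) powr \<beta>"
      using powr_mono'[of \<beta> 1 "R / (R + d y x)"] \<beta> R pos by simp
    also have "\<dots> \<le> (2 * A0 * r) powr \<beta>"
      using mult_left_mono[OF far, of R] R pos \<beta> by (intro powr_mono2) (auto simp: r_def field_simps)
    also have "\<dots> = (2 * A0) powr \<beta> * r powr \<beta>"
      using A0_pos r by (subst powr_mult) auto
    also have "(2 * A0) powr \<beta> \<le> (2 * A0) powr 1"
      using A0_ge_1 \<beta> by (intro powr_mono) auto
    finally have *: "R / (R + d y x) \<le> 2 * A0 * r powr \<beta>"
      using A0_pos by (simp add: mult_right_mono)
    have "norm (K x) \<le> l * (R / (R + d y x) * pw R 2 y x)"
      using admissibleD(5)[OF K, of x] pw_succ[OF R, of 2 y x] by simp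
    also have "\<dots> \<le> l * (2 * A0 * r powr \<beta> * pw R 2 y x)"
      using * admissibleD(1)[OF K] by (intro mult_left_mono mult_right_mono) auto
    finally show ?thesis
      using x by (simp add: c2_def mult.assoc)
  qed (use c2 in simp)
  have i2: "integrable \<mu> (\<lambda>x. indicator (- N) x *\<^sub>R K x)"
    and n2: "norm (LINT x|\<mu>. indicator (- N) x *\<^sub>R K x) \<le> c2 * tail_const 2"
    using norm_integral_le[OF _ ip p2] ile[OF c2] by (force, force)
  have i3: "integrable \<mu> (\<lambda>x. indicator N x *\<^sub>R K x)"
    using admissibleD(2)[OF K] by (intro integrable_mult_indicator) auto
  have "0 = (LINT x|\<mu>. indicator N x *\<^sub>R K x + indicator (- N) x *\<^sub>R K x)"
    using admissibleD(3)[OF K] by (simp flip: scaleR_left_distrib add: indicator_compl)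
  also have "\<dots> = (LINT x|\<mu>. indicator N x *\<^sub>R K x) + (LINT x|\<mu>. indicator (- N) x *\<^sub>R K x)"
    using i2 i3 by simp
  finally have eq: "(LINT x|\<mu>. indicator N x *\<^sub>R K x) = - (LINT x|\<mu>. indicator (- N) x *\<^sub>R K x)"
    by (simp add: eq_neg_iff_add_eq_0)
  have "(LINT x|\<mu>. indicator N x *\<^sub>R (K x * \<psi> x)) =
      (LINT x|\<mu>. indicator N x *\<^sub>R (K x * (\<psi> x - \<psi> y)) + \<psi> y * (indicator N x *\<^sub>R K x))"
    by (intro Bochner_Integration.integral_cong refl) (auto simp: algebra_simps scaleR_right_diff_distrib)
  also have "\<dots> = (LINT x|\<mu>. indicator N x *\<^sub>R (K x * (\<psi> x - \<psi> y))) -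
      \<psi> y * (LINT x|\<mu>. indicator (- N) x *\<^sub>R K x)"
    using i1 i3 by (simp add: eq del: mult_scaleR_right)
  also have "norm \<dots> \<le> c1 * tail_const 2 + (b * pd \<gamma> y) * (c2 * tail_const 2)"
  proof (rule order_trans[OF norm_triangle_ineq4 add_mono[OF n1]])
    show "norm (\<psi> y * (LINT x|\<mu>. indicator (- N) x *\<^sub>R K x)) \<le> (b * pd \<gamma> y) * (c2 * tail_const 2)"
      unfolding norm_mult using n2 tb_size[OF \<psi>, of y] b by (intro mult_mono) auto
  qed
  also have "\<dots> = tail_const 2 * (1 + 2 * A0) * l * b * (r powr \<beta> * pd \<gamma> y)"
    by (simp add: c1_def c2_def algebra_simps)
  finally show ?thesis
    using True by (simp add: r N_def)
qed

lemma far_part: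
  assumes R: "0 < R" and K: "admissible R \<theta> y K l" and \<psi>: "tb \<beta> \<gamma> \<psi> b" and "0 < \<beta>" "0 < \<gamma>"
  shows "integrable \<mu> (\<lambda>x. indicator (- near R y) x *\<^sub>R (K x * \<psi> x))"
    and "norm (LINT x|\<mu>. indicator (- near R y) x *\<^sub>R (K x * \<psi> x)) \<le>
      far_const * tail_const \<gamma> * l * b * far_size R y"
proof -
  have [measurable]: "K \<in> borel_measurable \<mu>" "\<psi> \<in> borel_measurable \<mu>"
    using admissibleD(4)[OF K] tb_measurable[OF \<psi> assms(4)] by auto
  define c where "c = l * (far_const * far_size R y) * b"
  have c: "0 \<le> c"
    using admissibleD(1)[OF K] tb_nonneg[OF \<psi>] far_const_pos by (simp add: c_def)
  have p: "norm (indicator (- near R y) x *\<^sub>R (K x * \<psi> x)) \<le> c * pd \<gamma> x" for x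
  proof (cases "x \<in> near R y")
    case False
    have "norm (K x) \<le> l * (far_const * far_size R y)"
      using admissibleD(1)[OF K] admissibleD(5)[OF K, of x] not_near_pw_le[OF R False] by (meson mult_left_mono order_trans)
    then have "norm (K x) * norm (\<psi> x) \<le> (l * (far_const * far_size R y)) * (b * pd \<gamma> x)"
      using tb_size[OF \<psi>, of x] admissibleD(1)[OF K] far_const_pos by (intro mult_mono) auto
    then show ?thesis
      using False by (simp add: c_def norm_mult mult.assoc)
  qed (use c in simp)
  have "integrable \<mu> (\<lambda>x. c * pd \<gamma> x)"
    using integrable_pw[OF assms(5)] by simp
  note n = norm_integral_le[OF _ this p]
  show "integrable \<mu> (\<lambda>x. indicator (- near R y) x *\<^sub>R (K x * \<psi> x))"
    by (rule n(1)) simp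
  have "norm (LINT x|\<mu>. indicator (- near R y) x *\<^sub>R (K x * \<psi> x)) \<le> (LINT x|\<mu>. c * pd \<gamma> x)"
    by (rule n(2)) simp
  also have "\<dots> \<le> c * tail_const \<gamma>"
    using integral_pw_le[OF assms(5), of 1 x0] c by (simp add: mult_left_mono)
  finally show "norm (LINT x|\<mu>. indicator (- near R y) x *\<^sub>R (K x * \<psi> x)) \<le>
      far_const * tail_const \<gamma> * l * b * far_size R y"
    by (simp add: c_def algebra_simps)
qed

text \<open>At coarse scales the gain \<open>R powr (- \<theta>)\<close> comes from replacing \<open>K\<close> by \<open>K - K x0\<close>; the correction is an
  integral of \<open>\<psi>\<close> over the far set, hence, as \<open>\<psi>\<close> has mean zero, over \<open>near\<close>.\<close>

lemma far_part_cancel: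
  assumes R: "1 \<le> R" and K: "admissible R \<theta> y K l" and \<psi>: "tb \<beta> \<gamma> \<psi> b"
    and "0 < \<beta>" "0 < \<theta>" "\<theta> < \<gamma>" and int0: "integral\<^sup>L \<mu> \<psi> = 0"
  shows "norm (LINT x|\<mu>. indicator (- near R y) x *\<^sub>R (K x * \<psi> x)) \<le>
      far_const * (2 + (2 * A0) powr \<theta>) * tail_const (\<gamma> - \<theta>) * l * b * R powr (- \<theta>) * far_size R y"
proof -
  define N where "N = near R y"
  have R0: "0 < R"
    using R by simp
  have \<gamma>: "0 < \<gamma>" "0 < \<gamma> - \<theta>"
    using assms by auto
  have [measurable]: "N \<in> sets \<mu>"
    by (simp add: N_def)
  have [measurable]: "K \<in> borel_measurable \<mu>" "\<psi> \<in> borel_measurable \<mu>"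
    using admissibleD(4)[OF K] tb_measurable[OF \<psi> assms(4)] by auto
  have l: "0 \<le> l"
    by (rule admissibleD(1)[OF K])
  have b: "0 \<le> b"
    by (rule tb_nonneg[OF \<psi>])
  define F where "F = far_const * far_size R y"
  have F: "0 \<le> F"
    using far_const_pos by (simp add: F_def)
  have ip: "integrable \<mu> (\<lambda>x. c * pd (\<gamma> - \<theta>) x)" for c
    using integrable_pw[OF \<gamma>(2)] by simp
  have ile: "(LINT x|\<mu>. c * pd (\<gamma> - \<theta>) x) \<le> c * tail_const (\<gamma> - \<theta>)" if "0 \<le> c" for c
    using integral_pw_le[OF \<gamma>(2), of 1 x0] that by (simp add: mult_left_mono)
  \<comment> \<open>Since \<open>R\<close> is at least 1, \<open>x0\<close> itself lies off
    \<open>near\<close>, so the subtracted value \<open>K x0\<close> is of far size as well.\<close>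
  have "1 * (1 + d x0 y) \<le> 2 * A0 * (R + d y x0)"
    using R A0_ge_1 by (intro mult_mono) (auto simp: d_commute)
  then have x0: "x0 \<notin> near R y"
    by (simp add: near_def)
  define c1 where "c1 = l * R powr (- \<theta>) * (2 * F) * b"
  have c1: "0 \<le> c1"
    using l b F by (simp add: c1_def)
  have p1: "norm (indicator (- N) x *\<^sub>R ((K x - K x0) * \<psi> x)) \<le> c1 * pd (\<gamma> - \<theta>) x" for x
  proof (cases "x \<in> N")
    case False
    have eq: "(d x0 x / R) powr \<theta> = R powr (- \<theta>) * d x0 x powr \<theta>"
      using R0 by (simp add: powr_divide powr_minus field_simps)
    have "norm (K x - K x0) \<le> l * (d x0 x / R) powr \<theta> * (pw R 3 y x + pw R 3 y x0)"
      by (rule admissibleD(6)[OF K])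
    also have "\<dots> \<le> l * (d x0 x / R) powr \<theta> * (F + F)"
      unfolding F_def using l False x0
      by (intro mult_left_mono add_mono not_near_pw_le[OF R0]) (auto simp: N_def)
    finally have "norm (K x - K x0) \<le> l * (R powr (- \<theta>) * d x0 x powr \<theta>) * (2 * F)"
      by (simp add: eq)
    then have "norm (K x - K x0) * norm (\<psi> x) \<le>
        (l * (R powr (- \<theta>) * d x0 x powr \<theta>) * (2 * F)) * (b * pd \<gamma> x)"
      using tb_size[OF \<psi>, of x] l F by (intro mult_mono) auto
    also have "\<dots> = c1 * (d x0 x powr \<theta> * pd \<gamma> x)"
      by (simp add: c1_def)
    also have "\<dots> \<le> c1 * pd (\<gamma> - \<theta>) x"
      using assms c1 by (intro mult_left_mono powr_d_pd_le) auto
    finally show ?thesis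
      using False by (simp add: norm_mult)
  qed (use c1 in simp)
  have i1: "integrable \<mu> (\<lambda>x. indicator (- N) x *\<^sub>R ((K x - K x0) * \<psi> x))"
    and n1: "norm (LINT x|\<mu>. indicator (- N) x *\<^sub>R ((K x - K x0) * \<psi> x)) \<le> c1 * tail_const (\<gamma> - \<theta>)"
    using norm_integral_le[OF _ ip p1] ile[OF c1] by (force, force)
  define c2 where "c2 = b * ((2 * A0) powr \<theta> * R powr (- \<theta>))"
  have c2: "0 \<le> c2"
    using b by (simp add: c2_def)
  \<comment> \<open>On the near set \<open>1 + d x0 x\<close> is at least
    \<open>R / (2 * A0)\<close>, so part of the decay of \<psi> turns into the gain
    \<open>R powr (- \<theta>)\<close>.\<close>
  have p2: "norm (indicator N x *\<^sub>R \<psi> x) \<le> c2 * pd (\<gamma> - \<theta>) x" for x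
  proof (cases "x \<in> N")
    case True
    then have nd: "d y x \<le> (1 + d x0 y) / (2 * A0)" "R < 1 + d x0 y"
      using near_dist[OF R0] by (auto simp: N_def)
    have "R \<le> 2 * A0 * (1 + d x0 x)"
      using one_plus_d_le[OF nd(1)] nd(2) by linarith
    then have "1 / (1 + d x0 x) \<le> 2 * A0 / R"
      using R0 by (simp add: field_simps)
    then have "(1 / (1 + d x0 x)) powr \<theta> \<le> (2 * A0 / R) powr \<theta>"
      using assms by (intro powr_mono2) (auto simp: less_imp_le)
    also have "\<dots> = (2 * A0) powr \<theta> * R powr (- \<theta>)"
      using R0 A0_pos by (simp add: powr_divide powr_minus field_simps)
    finally have *: "(1 + d x0 x) powr (- \<theta>) \<le> (2 * A0) powr \<theta> * R powr (- \<theta>)"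
      by (simp add: powr_divide powr_minus less_imp_le field_simps)
    have "norm (\<psi> x) \<le> b * ((1 + d x0 x) powr (- \<theta>) * pd (\<gamma> - \<theta>) x)"
      using tb_size[OF \<psi>, of x] by (simp flip: pd_split)
    also have "\<dots> \<le> b * ((2 * A0) powr \<theta> * R powr (- \<theta>) * pd (\<gamma> - \<theta>) x)"
      using * b by (intro mult_left_mono mult_right_mono) auto
    finally show ?thesis
      using True by (simp add: c2_def mult.assoc)
  qed (use c2 in simp)
  have i2: "integrable \<mu> (\<lambda>x. indicator N x *\<^sub>R \<psi> x)"
    and n2: "norm (LINT x|\<mu>. indicator N x *\<^sub>R \<psi> x) \<le> c2 * tail_const (\<gamma> - \<theta>)"
    using norm_integral_le[OF _ ip p2] ile[OF c2] by (force, force)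
  have i3: "integrable \<mu> (\<lambda>x. indicator (- N) x *\<^sub>R \<psi> x)"
    using tb_integrable(1)[OF \<psi> assms(4) \<gamma>(1)] by (intro integrable_mult_indicator) auto
  have "0 = (LINT x|\<mu>. indicator N x *\<^sub>R \<psi> x + indicator (- N) x *\<^sub>R \<psi> x)"
    using int0 by (simp flip: scaleR_left_distrib add: indicator_compl)
  also have "\<dots> = (LINT x|\<mu>. indicator N x *\<^sub>R \<psi> x) + (LINT x|\<mu>. indicator (- N) x *\<^sub>R \<psi> x)"
    using i2 i3 by simp
  finally have eq: "(LINT x|\<mu>. indicator (- N) x *\<^sub>R \<psi> x) = - (LINT x|\<mu>. indicator N x *\<^sub>R \<psi> x)"
    by (simp add: eq_neg_iff_add_eq_0 add.commute)
  have "(LINT x|\<mu>. indicator (- N) x *\<^sub>R (K x * \<psi> x)) =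
      (LINT x|\<mu>. indicator (- N) x *\<^sub>R ((K x - K x0) * \<psi> x) + K x0 * (indicator (- N) x *\<^sub>R \<psi> x))"
    by (intro Bochner_Integration.integral_cong refl) (auto simp: algebra_simps scaleR_right_diff_distrib)
  also have "\<dots> = (LINT x|\<mu>. indicator (- N) x *\<^sub>R ((K x - K x0) * \<psi> x)) -
      K x0 * (LINT x|\<mu>. indicator N x *\<^sub>R \<psi> x)"
    using i1 i3 by (simp add: eq del: mult_scaleR_right)
  also have "norm \<dots> \<le> c1 * tail_const (\<gamma> - \<theta>) + (l * F) * (c2 * tail_const (\<gamma> - \<theta>))"
  proof (rule order_trans[OF norm_triangle_ineq4 add_mono[OF n1]])
    have "norm (K x0) \<le> l * F"
      unfolding F_def using admissibleD(5)[OF K, of x0] not_near_pw_le[OF R0 x0] l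
      by (meson mult_left_mono order_trans)
    then show "norm (K x0 * (LINT x|\<mu>. indicator N x *\<^sub>R \<psi> x)) \<le> (l * F) * (c2 * tail_const (\<gamma> - \<theta>))"
      unfolding norm_mult using n2 l F by (intro mult_mono) auto
  qed
  also have "\<dots> = far_const * (2 + (2 * A0) powr \<theta>) * tail_const (\<gamma> - \<theta>) * l * b * R powr (- \<theta>) * far_size R y"
    by (simp add: c1_def c2_def F_def algebra_simps)
  finally show ?thesis
    by (simp add: N_def)
qed

text \<open>The exponent 3 is distributed: \<beta> units go to the relative scale and \<gamma> units
  to the decay away from \<open>x0\<close>, the latter at the price
  \<open>R powr \<gamma>\<close>.\<close>

lemma far_size_le:
  assumes "0 < R" "0 \<le> \<beta>" "0 \<le> \<gamma>" "\<beta> + \<gamma> \<le> 3"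
  shows "far_size R y \<le> R powr \<gamma> * (rel_scale R y powr \<beta> * pd \<gamma> y)"
proof -
  define S where "S = outer_scale R y"
  have S: "0 < S" "R \<le> S" "1 + d x0 y \<le> S"
    using outer_scale_pos by (auto simp: S_def outer_scale_def)
  have "(R / S) powr 3 \<le> (R / S) powr (\<beta> + \<gamma>)"
    using assms S by (intro powr_mono') auto
  also have "\<dots> = (R / S) powr \<beta> * ((R powr \<gamma>) * (1 / S) powr \<gamma>)"
    using assms S by (simp add: powr_add powr_divide)
  also have "\<dots> \<le> (R / S) powr \<beta> * ((R powr \<gamma>) * (1 / (1 + d x0 y)) powr \<gamma>)"
    using assms S by (intro mult_left_mono powr_mono2) (auto intro!: divide_left_mono simp: less_imp_le)
  finally have 1: "(R / S) powr 3 \<le> (R / S) powr \<beta> * ((R powr \<gamma>) * (1 / (1 + d x0 y)) powr \<gamma>)" .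
  have "far_size R y \<le> (R / S) powr \<beta> * ((R powr \<gamma>) * (1 / (1 + d x0 y)) powr \<gamma>) / V x0 (1 + d x0 y)"
    unfolding far_size_def S_def[symmetric]
    using 1 S by (intro frac_le V_mono V_pos) auto
  also have "\<dots> = R powr \<gamma> * (rel_scale R y powr \<beta> * pd \<gamma> y)"
    by (simp add: rel_scale_eq[OF assms(1)] S_def pw_def)
  finally show ?thesis .
qed

lemma integral_near_far:
  assumes R: "0 < R" and K: "admissible R \<theta> y K l" and \<psi>: "tb \<beta> \<gamma> \<psi> b" and "0 < \<beta>" "0 < \<gamma>"
  shows "integrable \<mu> (\<lambda>x. K x * \<psi> x)"
    "(LINT x|\<mu>. K x * \<psi> x) = (LINT x|\<mu>. indicator (near R y) x *\<^sub>R (K x * \<psi> x)) +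
      (LINT x|\<mu>. indicator (- near R y) x *\<^sub>R (K x * \<psi> x))"
proof -
  have [measurable]: "K \<in> borel_measurable \<mu>" "\<psi> \<in> borel_measurable \<mu>"
    using admissibleD(4)[OF K] tb_measurable[OF \<psi> assms(4)] by auto
  have bound: "norm (K x * \<psi> x) \<le> norm (K x) * (b * pd \<gamma> x0)" for x
  proof -
    have "(1 / (1 + d x0 x)) powr \<gamma> \<le> 1 powr \<gamma>"
      using assms(5) by (intro powr_mono2) (auto simp: less_imp_le divide_le_eq_1_pos)
    then have "pd \<gamma> x \<le> pd \<gamma> x0"
      unfolding pw_def by (intro frac_le V_mono V_pos) auto
    then have "norm (\<psi> x) \<le> b * pd \<gamma> x0"
      using tb_size[OF \<psi>, of x] tb_nonneg[OF \<psi>] by (meson mult_left_mono order_trans)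
    then show ?thesis
      by (simp add: norm_mult mult_left_mono)
  qed
  show i: "integrable \<mu> (\<lambda>x. K x * \<psi> x)"
  proof (rule norm_integral_le(1)[OF _ _ bound])
    show "integrable \<mu> (\<lambda>x. norm (K x) * (b * pd \<gamma> x0))"
      using admissibleD(2)[OF K] by (intro integrable_mult_left integrable_norm)
  qed measurable
  have "integrable \<mu> (\<lambda>x. indicator N x *\<^sub>R (K x * \<psi> x))" if "N \<in> sets \<mu>" for N
    using i that by (intro integrable_mult_indicator)
  from this[of "near R y"] this[of "- near R y"]
  show "(LINT x|\<mu>. K x * \<psi> x) = (LINT x|\<mu>. indicator (near R y) x *\<^sub>R (K x * \<psi> x)) +
      (LINT x|\<mu>. indicator (- near R y) x *\<^sub>R (K x * \<psi> x))"
    by (subst Bochner_Integration.integral_add[symmetric])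
      (auto simp flip: scaleR_left_distrib simp: indicator_compl)
qed

text \<open>The factor \<open>rel_scale R y powr \<beta>\<close> is what turns a size bound into a regularity bound for two points
  at distance more than \<open>R\<close>.\<close>

lemma pairing_bound:
  assumes "0 < \<beta>" "\<beta> \<le> 1" "0 < \<gamma>" "\<gamma> \<le> 1"
  obtains C where "0 < C" "\<And>R \<theta> y K l \<psi> b. 0 < R \<Longrightarrow> admissible R \<theta> y K l \<Longrightarrow> tb \<beta> \<gamma> \<psi> b \<Longrightarrow>
    norm (LINT x|\<mu>. K x * \<psi> x) \<le> C * (1 + R powr \<gamma>) * l * b * (rel_scale R y powr \<beta> * pd \<gamma> y)"
proof -
  define C where "C = tail_const 2 * (1 + 2 * A0) + far_const * tail_const \<gamma>"
  have t: "0 < tail_const 2" "0 < tail_const \<gamma>"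
    using assms by (auto intro: tail_const_pos)
  have c1: "0 \<le> tail_const 2 * (1 + 2 * A0)" "0 \<le> far_const * tail_const \<gamma>"
    using t A0_pos far_const_pos by (auto simp: less_imp_le)
  have "0 < C"
    unfolding C_def using t A0_pos far_const_pos by (intro add_pos_pos mult_pos_pos) auto
  moreover have "norm (LINT x|\<mu>. K x * \<psi> x) \<le>
      C * (1 + R powr \<gamma>) * l * b * (rel_scale R y powr \<beta> * pd \<gamma> y)"
    if R: "0 < R" and K: "admissible R \<theta> y K l" and \<psi>: "tb \<beta> \<gamma> \<psi> b" for R \<theta> y K l \<psi> b
  proof -
    define P where "P = rel_scale R y powr \<beta> * pd \<gamma> y"
    have P: "0 \<le> P"
      by (simp add: P_def)
    have lb: "0 \<le> l * b"
      using admissibleD(1)[OF K] tb_nonneg[OF \<psi>] by simp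
    have "norm (LINT x|\<mu>. K x * \<psi> x) \<le> tail_const 2 * (1 + 2 * A0) * l * b * (if R < 1 + d x0 y then P else 0) +
        far_const * tail_const \<gamma> * l * b * far_size R y"
      unfolding integral_near_far(2)[OF R K \<psi> assms(1,3)] P_def
      by (intro order_trans[OF norm_triangle_ineq] add_mono near_part[OF R K \<psi>] far_part(2)[OF R K \<psi>] assms)
    also have "\<dots> \<le> tail_const 2 * (1 + 2 * A0) * l * b * ((1 + R powr \<gamma>) * P) +
        far_const * tail_const \<gamma> * l * b * ((1 + R powr \<gamma>) * P)"
    proof (intro add_mono mult_left_mono)
      show "(if R < 1 + d x0 y then P else 0) \<le> (1 + R powr \<gamma>) * P"
        using P by (simp add: mult_le_cancel_right1)
      have "far_size R y \<le> R powr \<gamma> * P"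
        unfolding P_def using assms R by (intro far_size_le) auto
      also have "\<dots> \<le> (1 + R powr \<gamma>) * P"
        using P by (intro mult_right_mono) auto
      finally show "far_size R y \<le> (1 + R powr \<gamma>) * P" .
      show "0 \<le> tail_const 2 * (1 + 2 * A0) * l * b" "0 \<le> far_const * tail_const \<gamma> * l * b"
        using mult_nonneg_nonneg[OF c1(1) lb] mult_nonneg_nonneg[OF c1(2) lb] by (simp_all add: mult.assoc)
    qed
    also have "\<dots> = C * (1 + R powr \<gamma>) * l * b * P"
      by (simp add: C_def algebra_simps)
    finally show ?thesis
      by (simp add: P_def)
  qed
  ultimately show ?thesis
    by (rule that)
qed

text \<open>The bounds on \<epsilon> list the gains. For small \<open>R\<close> the near part gains
  \<open>R powr (\<eta> - \<beta>)\<close>, by lowering the regularity exponent, and the far part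
  \<open>R powr \<gamma>\<close>. For large \<open>R\<close> the near part gains
  \<open>R powr (- (\<eta> - \<gamma>))\<close>, by lowering the decay exponent, and the far part
  \<open>R powr (\<gamma> - \<theta>)\<close>, by the mean zero of \<psi>.\<close>

lemma pairing_decay:
  assumes "0 < \<beta>" "\<beta> < \<eta>" "0 < \<gamma>" "\<gamma> < \<eta>" "\<eta> \<le> 1"
    and \<epsilon>: "0 \<le> \<epsilon>" "\<epsilon> \<le> \<gamma>" "\<epsilon> \<le> \<eta> - \<beta>" "\<epsilon> \<le> (\<eta> - \<gamma>) / 2"
  obtains C where "0 < C" "\<And>R y K l \<psi> b. 0 < R \<Longrightarrow> admissible R ((\<eta> + \<gamma>) / 2) y K l \<Longrightarrow>
    tb \<eta> \<eta> \<psi> b \<Longrightarrow> integral\<^sup>L \<mu> \<psi> = 0 \<Longrightarrow>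
    norm (LINT x|\<mu>. K x * \<psi> x) \<le> C * min (R powr \<epsilon>) (R powr (- \<epsilon>)) * l * b * (rel_scale R y powr \<beta> * pd \<gamma> y)"
proof -
  \<comment> \<open>The midpoint meets two demands: \<theta> < \<eta> keeps
    \<open>pd (\<eta> - \<theta>)\<close> integrable, and \<theta> > \<gamma> lets the cancellation
    beat the loss \<open>R powr \<gamma>\<close> of \<open>far_size_le\<close>.\<close>
  define \<theta> where "\<theta> = (\<eta> + \<gamma>) / 2"
  have \<theta>: "0 < \<theta>" "\<theta> < \<eta>" "\<gamma> - \<theta> \<le> - \<epsilon>"
    using assms by (auto simp: \<theta>_def field_simps)
  define a1 where "a1 = tail_const 2 * (1 + 2 * A0)"
  define a2 where "a2 = far_const * tail_const \<eta>"
  define a3 where "a3 = far_const * (2 + (2 * A0) powr \<theta>) * tail_const (\<eta> - \<theta>)"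
  have t: "0 < tail_const 2" "0 < tail_const \<eta>" "0 < tail_const (\<eta> - \<theta>)"
    using assms \<theta> by (auto intro!: tail_const_pos)
  have a: "0 < a1" "0 < a2" "0 < a3"
    unfolding a1_def a2_def a3_def using t A0_pos far_const_pos
    by (auto intro!: mult_pos_pos add_pos_nonneg)
  define C where "C = a1 + (a2 + a3)"
  have "0 < C"
    using a by (simp add: C_def)
  moreover have "norm (LINT x|\<mu>. K x * \<psi> x) \<le>
      C * min (R powr \<epsilon>) (R powr (- \<epsilon>)) * l * b * (rel_scale R y powr \<beta> * pd \<gamma> y)"
    if R: "0 < R" and K': "admissible R ((\<eta> + \<gamma>) / 2) y K l" and \<psi>: "tb \<eta> \<eta> \<psi> b"
      and int0: "integral\<^sup>L \<mu> \<psi> = 0" for R y K l \<psi> b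
  proof -
    have K: "admissible R \<theta> y K l"
      using K' by (simp add: \<theta>_def)
    define P where "P = rel_scale R y powr \<beta> * pd \<gamma> y"
    define m where "m = min (R powr \<epsilon>) (R powr (- \<epsilon>))"
    have P: "0 \<le> P"
      by (simp add: P_def)
    have lb: "0 \<le> l * b"
      using admissibleD(1)[OF K] tb_nonneg[OF \<psi>] by simp
    have \<eta>: "0 < \<eta>"
      using assms by simp
    have near: "(if R < 1 + d x0 y then rel_scale R y powr \<eta> * pd \<eta> y else 0) \<le> m * P"
    proof (cases "R < 1 + d x0 y")
      case True
      have rs: "rel_scale R y = R / (1 + d x0 y)"
        using True by (simp add: rel_scale_def)
      have pos: "0 < rel_scale R y"
        using R by (simp add: rs)
      show ?thesis
      proof (cases "R \<le> 1")
        case R1: True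
        have "rel_scale R y powr (\<eta> - \<beta>) \<le> R powr (\<eta> - \<beta>)"
          using pos assms R by (intro powr_mono2) (auto simp: rs field_simps)
        also have "R powr (\<eta> - \<beta>) \<le> m"
          using R1 assms R by (auto simp: m_def intro!: powr_mono')
        finally have "rel_scale R y powr \<beta> * rel_scale R y powr (\<eta> - \<beta>) \<le> rel_scale R y powr \<beta> * m"
          by (intro mult_left_mono) auto
        then have "rel_scale R y powr \<eta> \<le> rel_scale R y powr \<beta> * m"
          by (simp flip: powr_add)
        then have "rel_scale R y powr \<eta> * pd \<eta> y \<le> (rel_scale R y powr \<beta> * m) * pd \<gamma> y"
          using assms by (intro mult_mono pw_antimono) (auto simp: m_def)
        then show ?thesis
          using True by (simp add: P_def mult_ac)
      next
        case R1: False
        have "rel_scale R y powr \<eta> \<le> rel_scale R y powr \<beta>"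
          using pos assms True by (intro powr_mono') (auto simp: rs)
        moreover have "pd \<eta> y \<le> m * pd \<gamma> y"
        proof -
          have "(1 + d x0 y) powr (- (\<eta> - \<gamma>)) \<le> R powr (- (\<eta> - \<gamma>))"
            using True R assms by (intro powr_mono2') auto
          also have "\<dots> \<le> m"
            using R1 assms by (auto simp: m_def intro!: powr_mono)
          finally show ?thesis
            by (subst pd_split[of \<eta> y "\<eta> - \<gamma>"]) (auto intro: mult_right_mono)
        qed
        ultimately have "rel_scale R y powr \<eta> * pd \<eta> y \<le> rel_scale R y powr \<beta> * (m * pd \<gamma> y)"
          by (intro mult_mono) auto
        then show ?thesis
          using True by (simp add: P_def mult_ac)
      qed
    qed (use P in \<open>simp add: m_def\<close>)
    have fs: "far_size R y \<le> R powr \<gamma> * P"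
      unfolding P_def using assms R by (intro far_size_le) auto
    have nn: "0 \<le> l * b * (m * P)"
      using lb P by (simp add: m_def)
    have far: "norm (LINT x|\<mu>. indicator (- near R y) x *\<^sub>R (K x * \<psi> x)) \<le> (a2 + a3) * (l * b * (m * P))"
    proof (cases "R \<le> 1")
      case True
      have "far_size R y \<le> m * P"
      proof (rule order_trans[OF fs])
        show "R powr \<gamma> * P \<le> m * P"
          using True P R assms by (intro mult_right_mono) (auto simp: m_def intro!: powr_mono')
      qed
      then have "a2 * l * b * far_size R y \<le> a2 * l * b * (m * P)"
        using a lb by (intro mult_left_mono) (auto simp: mult.assoc)
      also have "\<dots> \<le> (a2 + a3) * (l * b * (m * P))"
        using a mult_right_mono[OF _ nn, of _ "a2 + a3"] by (simp add: mult.assoc)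
      finally show ?thesis
        using far_part(2)[OF R K \<psi> \<eta> \<eta>] by (simp add: a2_def)
    next
      case False
      have "R powr (- \<theta>) * far_size R y \<le> R powr (- \<theta>) * (R powr \<gamma> * P)"
        using fs by (intro mult_left_mono) auto
      also have "\<dots> = R powr (\<gamma> - \<theta>) * P"
        by (simp add: powr_add[symmetric])
      also have "\<dots> \<le> m * P"
        using False P \<theta> assms by (intro mult_right_mono) (auto simp: m_def intro!: powr_mono)
      finally have "a3 * l * b * (R powr (- \<theta>) * far_size R y) \<le> a3 * l * b * (m * P)"
        using a lb by (intro mult_left_mono) (auto simp: mult.assoc)
      also have "\<dots> \<le> (a2 + a3) * (l * b * (m * P))"
        using a mult_right_mono[OF _ nn, of _ "a2 + a3"] by (simp add: mult.assoc)
      finally show ?thesis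
        using far_part_cancel[OF _ K \<psi> \<eta> \<theta>(1,2) int0] False by (simp add: a3_def mult.assoc)
    qed
    have "norm (LINT x|\<mu>. K x * \<psi> x) \<le>
        a1 * l * b * (if R < 1 + d x0 y then rel_scale R y powr \<eta> * pd \<eta> y else 0) +
        (a2 + a3) * (l * b * (m * P))"
      unfolding integral_near_far(2)[OF R K \<psi> \<eta> \<eta>] a1_def
      by (intro order_trans[OF norm_triangle_ineq] add_mono near_part[OF R K \<psi>] far \<eta> assms)
    also have "\<dots> \<le> a1 * l * b * (m * P) + (a2 + a3) * (l * b * (m * P))"
      using a lb by (intro add_right_mono mult_left_mono near) (auto simp: mult.assoc)
    also have "\<dots> = C * m * l * b * P"
      by (simp add: C_def algebra_simps)
    finally show ?thesis
      by (simp add: P_def m_def)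
  qed
  ultimately show ?thesis
    by (rule that)
qed

end

section \<open>The operators and their transposes\<close>

text \<open>The estimates of an exp-ATI with its exponential factors bounded by one polynomial
  kernel of exponent 3.\<close>

locale decaying_kernels = pointed_homogeneous_space +
  fixes \<delta> \<eta> Cq :: real and Q :: "int \<Rightarrow> 'a \<Rightarrow> 'a \<Rightarrow> complex"
  assumes \<delta>: "0 < \<delta>" "\<delta> < 1" and \<eta>: "0 < \<eta>" "\<eta> < 1" and Cq: "0 < Cq"
    and Q_row: "has_bochner_integral \<mu> (\<lambda>y. Q k x y) 0"
    and Q_column: "has_bochner_integral \<mu> (\<lambda>x. Q k x y) 0"
    and Q_size: "norm (Q k x y) \<le> Cq * pw (\<delta> powi k) 3 x y"
    and Q_reg1: "d x x' \<le> \<delta> powi k \<Longrightarrow>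
      norm (Q k x y - Q k x' y) \<le> Cq * (d x x' / \<delta> powi k) powr \<eta> * pw (\<delta> powi k) 3 x y"
    and Q_reg2: "d x x' \<le> \<delta> powi k \<Longrightarrow>
      norm (Q k y x - Q k y x') \<le> Cq * (d x x' / \<delta> powi k) powr \<eta> * pw (\<delta> powi k) 3 x y"
    and Q_reg12: "d x x' \<le> \<delta> powi k \<Longrightarrow> d y y' \<le> \<delta> powi k \<Longrightarrow>
      norm ((Q k x y - Q k x' y) - (Q k x y' - Q k x' y'))
        \<le> Cq * (d x x' / \<delta> powi k) powr \<eta> * (d y y' / \<delta> powi k) powr \<eta> * pw (\<delta> powi k) 3 x y"
begin

abbreviation R :: "int \<Rightarrow> real" where "R k \<equiv> \<delta> powi k"

lemma R_pos [simp]: "0 < R k"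
  using \<delta> by simp

lemma R_nonneg [simp]: "0 \<le> R k"
  by (rule less_imp_le[OF R_pos])

lemma R_eq: "R k = \<delta> powr real_of_int k"
  using \<delta> by (simp add: powr_real_of_int')

definition column_const :: real where "column_const = Cq * doubling_const 1"

lemma column_const_pos: "0 < column_const"
  using Cq doubling_const_pos by (simp add: column_const_def)

lemma Q_measurable [measurable]: "Q k x \<in> borel_measurable \<mu>" "(\<lambda>x. Q k x y) \<in> borel_measurable \<mu>"
  using Q_row[of k x] Q_column[of k y] by (auto simp: has_bochner_integral_iff)

lemma Cq_pw_le: "Cq * u * pw (R k) 3 x y \<le> column_const * u * pw (R k) 3 y x"
  "Cq * u * pw (R k) 3 x y \<le> column_const * u * pw (R k) 3 x y" if "0 \<le> u" for u
proof -
  have "Cq * u * pw (R k) 3 x y \<le> Cq * u * (doubling_const 1 * pw (R k) 3 y x)"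
    using that Cq by (intro mult_left_mono pw_sym) auto
  then show "Cq * u * pw (R k) 3 x y \<le> column_const * u * pw (R k) 3 y x"
    by (simp add: column_const_def mult_ac)
  have "Cq \<le> column_const"
    using Cq doubling_const_ge_1[of 1] by (simp add: column_const_def)
  then show "Cq * u * pw (R k) 3 x y \<le> column_const * u * pw (R k) 3 x y"
    using that by (intro mult_right_mono) auto
qed

lemma one_le_powr_ratio: "0 < r \<Longrightarrow> r \<le> t \<Longrightarrow> 0 \<le> \<theta> \<Longrightarrow> 1 \<le> (t / r) powr \<theta>" for r t \<theta> :: real
  by (intro ge_one_powr_ge_zero) auto

text \<open>Regularity of the kernel is given for points within \<open>R k\<close>. At larger
  distances the ratio to the power \<theta> is at least 1, and the size bound suffices.\<close>

lemma admissible_column: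
  assumes "0 < \<theta>" "\<theta> \<le> \<eta>"
  shows "admissible (R k) \<theta> y (\<lambda>x. Q k x y) column_const"
  unfolding admissible_def
proof (intro conjI allI)
  show "0 \<le> column_const"
    using column_const_pos by simp
  show size: "norm (Q k x y) \<le> column_const * pw (R k) 3 y x" for x
    using order_trans[OF Q_size] Cq_pw_le(1)[of 1 k x y] by simp
  show "norm (Q k x y - Q k x0 y) \<le> column_const * (d x0 x / R k) powr \<theta> * (pw (R k) 3 y x + pw (R k) 3 y x0)" for x
  proof (cases "d x0 x \<le> R k")
    case True
    have "norm (Q k x0 y - Q k x y) \<le> Cq * (d x0 x / R k) powr \<eta> * pw (R k) 3 x0 y"
      by (rule Q_reg1[OF True])
    also have "\<dots> \<le> column_const * (d x0 x / R k) powr \<eta> * pw (R k) 3 y x0"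
      by (rule Cq_pw_le) simp
    also have "\<dots> \<le> column_const * (d x0 x / R k) powr \<theta> * (pw (R k) 3 y x + pw (R k) 3 y x0)"
      using True assms column_const_pos by (intro mult_mono powr_mono') (auto simp: less_imp_le)
    finally show ?thesis
      by (simp add: norm_minus_commute)
  next
    case False
    have "norm (Q k x y - Q k x0 y) \<le> column_const * 1 * (pw (R k) 3 y x + pw (R k) 3 y x0)"
      using norm_triangle_ineq4[of "Q k x y" "Q k x0 y"] size[of x] size[of x0]
      by (simp add: ring_distribs)
    also have "\<dots> \<le> column_const * (d x0 x / R k) powr \<theta> * (pw (R k) 3 y x + pw (R k) 3 y x0)"
      using False assms column_const_pos by (intro mult_mono one_le_powr_ratio) (auto simp: less_imp_le)
    finally show ?thesis .
  qed
qed (rule Q_column)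

text \<open>The second difference bound supplies the regularity against \<open>x0\<close>. The
  factor \<open>(d y y' / R k) powr \<eta>\<close> in the amplitude is what becomes the regularity
  of \<open>T k \<psi>\<close> at distances below \<open>R k\<close>.\<close>

lemma admissible_column_diff:
  assumes "0 < \<theta>" "\<theta> \<le> \<eta>" "d y y' \<le> R k"
  shows "admissible (R k) \<theta> y (\<lambda>x. Q k x y - Q k x y') (column_const * (d y y' / R k) powr \<eta>)"
  unfolding admissible_def
proof (intro conjI allI)
  define r where "r = (d y y' / R k) powr \<eta>"
  have r: "0 \<le> r"
    by (simp add: r_def)
  show "has_bochner_integral \<mu> (\<lambda>x. Q k x y - Q k x y') 0"
    using has_bochner_integral_diff[OF Q_column Q_column] by simp
  show "0 \<le> column_const * (d y y' / R k) powr \<eta>"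
    using column_const_pos by simp
  show size: "norm (Q k x y - Q k x y') \<le> column_const * (d y y' / R k) powr \<eta> * pw (R k) 3 y x" for x
    using order_trans[OF Q_reg2[OF assms(3)] Cq_pw_le(2)] by simp
  show "norm (Q k x y - Q k x y' - (Q k x0 y - Q k x0 y')) \<le>
      column_const * (d y y' / R k) powr \<eta> * (d x0 x / R k) powr \<theta> * (pw (R k) 3 y x + pw (R k) 3 y x0)" for x
  proof (cases "d x0 x \<le> R k")
    case True
    have "norm ((Q k x0 y - Q k x y) - (Q k x0 y' - Q k x y')) \<le>
        Cq * (d x0 x / R k) powr \<eta> * (d y y' / R k) powr \<eta> * pw (R k) 3 x0 y"
      by (rule Q_reg12[OF True assms(3)])
    also have "\<dots> = Cq * ((d x0 x / R k) powr \<eta> * r) * pw (R k) 3 x0 y"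
      by (simp add: r_def)
    also have "\<dots> \<le> column_const * ((d x0 x / R k) powr \<eta> * r) * pw (R k) 3 y x0"
      using r by (intro Cq_pw_le) simp
    also have "\<dots> \<le> column_const * ((d x0 x / R k) powr \<theta> * r) * (pw (R k) 3 y x + pw (R k) 3 y x0)"
      using True assms column_const_pos r by (intro mult_mono powr_mono') (auto simp: less_imp_le)
    finally show ?thesis
      by (simp add: r_def norm_minus_commute algebra_simps)
  next
    case False
    have "norm (Q k x y - Q k x y' - (Q k x0 y - Q k x0 y')) \<le>
        column_const * (r * 1) * (pw (R k) 3 y x + pw (R k) 3 y x0)"
      using norm_triangle_ineq4[of "Q k x y - Q k x y'" "Q k x0 y - Q k x0 y'"] size[of x] size[of x0]
      by (simp add: ring_distribs r_def)
    also have "\<dots> \<le> column_const * (r * (d x0 x / R k) powr \<theta>) * (pw (R k) 3 y x + pw (R k) 3 y x0)"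
      using False assms column_const_pos r by (intro mult_mono one_le_powr_ratio) (auto simp: less_imp_le)
    finally show ?thesis
      by (simp add: r_def mult.assoc)
  qed
qed

text \<open>The transpose of the operator with kernel \<open>Q k\<close>, in the bilinear sense: no
  complex conjugate is taken.\<close>

definition T :: "int \<Rightarrow> ('a \<Rightarrow> complex) \<Rightarrow> 'a \<Rightarrow> complex" where
  "T k \<psi> y = (LINT x|\<mu>. Q k x y * \<psi> x)"

text \<open>The summand 1 accounts for the value at \<open>y\<close>, the product for moving the
  bound at \<open>y'\<close> back to \<open>y\<close>.\<close>

definition shift_const :: "real \<Rightarrow> real \<Rightarrow> real" where
  "shift_const \<beta> \<gamma> = 1 + (2 * A0) powr \<beta> * ((2 * A0) powr \<gamma> * doubling_const (2 * A0))"

lemma shift_const_pos: "0 < shift_const \<beta> \<gamma>"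
  using less_imp_le[OF doubling_const_pos[of "2 * A0"]] by (simp add: shift_const_def add_pos_nonneg)

lemma shift_const_ge_1: "1 \<le> shift_const \<beta> \<gamma>"
  using less_imp_le[OF doubling_const_pos[of "2 * A0"]] by (simp add: shift_const_def)

text \<open>For points farther apart than the scale \<open>r\<close>, regularity follows from size:
  in \<open>(r / (1 + d x0 w)) powr \<beta>\<close> the scale may be enlarged to the distance of the
  points, and \<open>pd_shift\<close> transports the weight from \<open>y'\<close> to
  \<open>y\<close>.\<close>

lemma two_point_bound:
  assumes "d y y' \<le> (1 + d x0 y) / (2 * A0)" "0 < \<beta>" "0 \<le> \<gamma>"
    and "0 \<le> r" "r \<le> d y y'" "0 \<le> D"
    and "\<And>w. norm (f w) \<le> D * ((r / (1 + d x0 w)) powr \<beta> * pd \<gamma> w)"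
  shows "norm (f y - f y') \<le> shift_const \<beta> \<gamma> * D * (d y y' / (1 + d x0 y)) powr \<beta> * pd \<gamma> y"
proof -
  define P where "P = (d y y' / (1 + d x0 y)) powr \<beta> * pd \<gamma> y"
  have "norm (f y) \<le> D * ((r / (1 + d x0 y)) powr \<beta> * pd \<gamma> y)"
    by (rule assms)
  also have "\<dots> \<le> D * P"
    unfolding P_def using assms
    by (intro mult_left_mono mult_right_mono powr_mono2) (auto intro!: divide_right_mono simp: less_imp_le)
  finally have 1: "norm (f y) \<le> D * P" .
  have "1 + d x0 y \<le> 2 * A0 * (1 + d x0 y')"
    by (rule one_plus_d_le) (rule assms)
  then have "d y y' * (1 + d x0 y) \<le> d y y' * (2 * A0 * (1 + d x0 y'))"
    by (intro mult_left_mono) auto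
  then have "d y y' / (1 + d x0 y') \<le> 2 * A0 * (d y y' / (1 + d x0 y))"
    by (simp add: field_simps add_pos_nonneg)
  moreover have "r / (1 + d x0 y') \<le> d y y' / (1 + d x0 y')"
    using assms by (intro divide_right_mono) (auto simp: less_imp_le)
  ultimately have "(r / (1 + d x0 y')) powr \<beta> \<le> (2 * A0 * (d y y' / (1 + d x0 y))) powr \<beta>"
    using assms by (intro powr_mono2) (auto simp: less_imp_le)
  also have "\<dots> = (2 * A0) powr \<beta> * (d y y' / (1 + d x0 y)) powr \<beta>"
    using A0_pos by (subst powr_mult) (auto simp: less_imp_le)
  finally have "(r / (1 + d x0 y')) powr \<beta> * pd \<gamma> y' \<le>
      ((2 * A0) powr \<beta> * (d y y' / (1 + d x0 y)) powr \<beta>) * ((2 * A0) powr \<gamma> * doubling_const (2 * A0) * pd \<gamma> y)"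
    using pd_shift[OF assms(1,3)] by (intro mult_mono) auto
  then have "norm (f y') \<le> D * (((2 * A0) powr \<beta> * (d y y' / (1 + d x0 y)) powr \<beta>) *
      ((2 * A0) powr \<gamma> * doubling_const (2 * A0) * pd \<gamma> y))"
    using assms(7)[of y'] assms(6) by (meson mult_left_mono order_trans)
  also have "\<dots> = (shift_const \<beta> \<gamma> - 1) * (D * P)"
    by (simp add: shift_const_def P_def mult_ac)
  finally have "norm (f y - f y') \<le> D * P + (shift_const \<beta> \<gamma> - 1) * (D * P)"
    using 1 norm_triangle_ineq4[of "f y" "f y'"] by linarith
  then show ?thesis
    by (simp add: P_def algebra_simps)
qed

text \<open>The pairing estimate is applied to a column for the size and to a difference of columns
  for the regularity below \<open>R k\<close>; above \<open>R k\<close> two size bounds suffice.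
  \<Theta> stays abstract because it is used both with a mere bound and with decay in
  \<open>k\<close>.\<close>

lemma tb_T:
  assumes \<psi>: "tb \<beta>' \<gamma>' \<psi> b" "0 < \<beta>'" "0 < \<gamma>'" and \<beta>: "0 < \<beta>" "\<beta> \<le> \<eta>" "0 \<le> \<gamma>"
    and \<theta>: "0 < \<theta>" "\<theta> \<le> \<eta>" and \<Theta>: "0 \<le> \<Theta>"
    and pair: "\<And>y K l. admissible (R k) \<theta> y K l \<Longrightarrow>
      norm (LINT x|\<mu>. K x * \<psi> x) \<le> \<Theta> * l * (rel_scale (R k) y powr \<beta> * pd \<gamma> y)"
  shows "tb \<beta> \<gamma> (T k \<psi>) (shift_const \<beta> \<gamma> * column_const * \<Theta>)"
proof -
  define D where "D = \<Theta> * column_const"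
  have D: "0 \<le> D"
    using \<Theta> column_const_pos by (simp add: D_def)
  have le_sc: "u \<le> shift_const \<beta> \<gamma> * u" if "0 \<le> u" for u
    using mult_right_mono[OF shift_const_ge_1[of \<beta> \<gamma>] that] by simp
  have s1: "norm (T k \<psi> w) \<le> D * (rel_scale (R k) w powr \<beta> * pd \<gamma> w)" for w
    unfolding T_def D_def by (rule pair[OF admissible_column[OF \<theta>]])
  have rs: "rel_scale (R k) w \<le> R k / (1 + d x0 w)" "rel_scale (R k) w \<le> 1" "0 \<le> rel_scale (R k) w" for w
    by (auto simp: rel_scale_def less_imp_le)
  have "tb \<beta> \<gamma> (T k \<psi>) (shift_const \<beta> \<gamma> * D)"
  proof (rule tbI)
    fix y
    have "norm (T k \<psi> y) \<le> D * (rel_scale (R k) y powr \<beta> * pd \<gamma> y)"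
      by (rule s1)
    also have "rel_scale (R k) y powr \<beta> \<le> 1"
      using rs \<beta> by (simp add: powr_le1)
    finally have "norm (T k \<psi> y) \<le> D * (1 * pd \<gamma> y)"
      using D by (simp add: mult_left_mono mult_right_mono)
    also have "\<dots> \<le> shift_const \<beta> \<gamma> * D * pd \<gamma> y"
      using le_sc[of "D * pd \<gamma> y"] D by (simp add: mult.assoc)
    finally show "norm (T k \<psi> y) \<le> shift_const \<beta> \<gamma> * D * pd \<gamma> y" .
  next
    fix y y' assume yy: "d y y' \<le> (1 + d x0 y) / (2 * A0)"
    show "norm (T k \<psi> y - T k \<psi> y') \<le> shift_const \<beta> \<gamma> * D * (d y y' / (1 + d x0 y)) powr \<beta> * pd \<gamma> y"
    proof (cases "d y y' \<le> R k")
      case True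
      have "integrable \<mu> (\<lambda>x. Q k x w * \<psi> x)" for w
        by (rule integral_near_far(1)[OF R_pos admissible_column[OF \<theta>] \<psi>])
      then have "T k \<psi> y - T k \<psi> y' = (LINT x|\<mu>. (Q k x y - Q k x y') * \<psi> x)"
        by (simp add: T_def left_diff_distrib)
      also have "norm \<dots> \<le> \<Theta> * (column_const * (d y y' / R k) powr \<eta>) * (rel_scale (R k) y powr \<beta> * pd \<gamma> y)"
        by (rule pair[OF admissible_column_diff[OF \<theta> True]])
      also have "\<dots> = D * ((d y y' / R k) powr \<eta> * rel_scale (R k) y powr \<beta> * pd \<gamma> y)"
        by (simp add: D_def)
      also have "\<dots> \<le> D * ((d y y' / (1 + d x0 y)) powr \<beta> * pd \<gamma> y)"
      proof (intro mult_left_mono mult_right_mono D pw_nonneg)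
        have "(d y y' / R k) powr \<eta> * rel_scale (R k) y powr \<beta> \<le>
            (d y y' / R k) powr \<beta> * (R k / (1 + d x0 y)) powr \<beta>"
          using True \<beta> rs[of y] by (intro mult_mono powr_mono' powr_mono2) (auto simp: less_imp_le)
        also have "\<dots> = (d y y' / R k * (R k / (1 + d x0 y))) powr \<beta>"
          by (subst powr_mult) (auto simp: less_imp_le)
        also have "d y y' / R k * (R k / (1 + d x0 y)) = d y y' / (1 + d x0 y)"
          using \<delta> by simp
        finally show "(d y y' / R k) powr \<eta> * rel_scale (R k) y powr \<beta> \<le> (d y y' / (1 + d x0 y)) powr \<beta>" .
      qed
      also have "\<dots> \<le> shift_const \<beta> \<gamma> * (D * ((d y y' / (1 + d x0 y)) powr \<beta> * pd \<gamma> y))"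
        using D by (intro le_sc) simp
      finally show ?thesis
        by (simp add: mult.assoc)
    next
      case False
      show ?thesis
      proof (rule two_point_bound[OF yy \<beta>(1,3) _ _ D])
        show "norm (T k \<psi> w) \<le> D * ((R k / (1 + d x0 w)) powr \<beta> * pd \<gamma> w)" for w
          using rs[of w] \<beta> D
          by (intro order_trans[OF s1] mult_left_mono mult_right_mono powr_mono2) auto
      qed (use False in \<open>auto simp: less_imp_le\<close>)
    qed
  qed
  then show ?thesis
    by (simp add: D_def mult_ac)
qed

text \<open>The constant may depend on \<open>k\<close>, since this bound is used one scale at a
  time; no mean zero condition on \<psi> is imposed, so that it also applies to truncated
  functions.\<close>

lemma T_bounded:
  assumes "0 < \<beta>" "\<beta> \<le> \<eta>" "0 < \<gamma>" "\<gamma> \<le> \<eta>"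
  obtains C where "0 < C" "\<And>\<psi> b. tb \<beta> \<gamma> \<psi> b \<Longrightarrow> tb \<beta> \<gamma> (T k \<psi>) (C * b)"
proof -
  obtain C where C: "0 < C" "\<And>R \<theta> y K l \<psi> b. 0 < R \<Longrightarrow> admissible R \<theta> y K l \<Longrightarrow> tb \<beta> \<gamma> \<psi> b \<Longrightarrow>
      norm (LINT x|\<mu>. K x * \<psi> x) \<le> C * (1 + R powr \<gamma>) * l * b * (rel_scale R y powr \<beta> * pd \<gamma> y)"
    by (rule pairing_bound[of \<beta> \<gamma>]) (use assms \<eta> that in auto)
  define D where "D = shift_const \<beta> \<gamma> * column_const * (C * (1 + R k powr \<gamma>))"
  have "0 < D"
    using C(1) shift_const_pos column_const_pos by (auto simp: D_def intro!: mult_pos_pos add_pos_nonneg)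
  moreover have "tb \<beta> \<gamma> (T k \<psi>) (D * b)" if \<psi>: "tb \<beta> \<gamma> \<psi> b" for \<psi> b
  proof -
    have "tb \<beta> \<gamma> (T k \<psi>) (shift_const \<beta> \<gamma> * column_const * (C * (1 + R k powr \<gamma>) * b))"
    proof (rule tb_T[OF \<psi> assms(1,3,1,2)])
      show "norm (LINT x|\<mu>. K x * \<psi> x) \<le> C * (1 + R k powr \<gamma>) * b * l * (rel_scale (R k) y powr \<beta> * pd \<gamma> y)"
        if "admissible (R k) \<eta> y K l" for y K l
        using C(2)[OF R_pos that \<psi>] by (simp add: mult_ac)
    qed (use assms \<eta> C(1) tb_nonneg[OF \<psi>] in auto)
    then show ?thesis
      by (simp add: D_def mult_ac)
  qed
  ultimately show ?thesis
    by (rule that)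
qed

lemma min_R_powr: "0 \<le> \<epsilon> \<Longrightarrow> min (R k powr \<epsilon>) (R k powr (- \<epsilon>)) = \<delta> powr (\<epsilon> * \<bar>real_of_int k\<bar>)"
proof -
  assume \<epsilon>: "0 \<le> \<epsilon>"
  have e: "R k powr p = \<delta> powr (real_of_int k * p)" for p
    by (simp add: R_eq powr_powr)
  show ?thesis
  proof (cases "0 \<le> k")
    case True
    then have "\<delta> powr (real_of_int k * \<epsilon>) \<le> \<delta> powr (real_of_int k * (- \<epsilon>))"
      using \<epsilon> \<delta> by (intro powr_mono' mult_left_mono) auto
    then show ?thesis
      using True by (simp add: e min_def mult.commute)
  next
    case False
    then have "\<delta> powr (real_of_int k * (- \<epsilon>)) \<le> \<delta> powr (real_of_int k * \<epsilon>)"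
      using \<epsilon> \<delta> by (intro powr_mono' mult_left_mono_neg) auto
    then show ?thesis
      using False by (auto simp add: e min_def mult.commute)
  qed
qed

lemma T_decay:
  assumes "0 < \<beta>" "\<beta> < \<eta>" "0 < \<gamma>" "\<gamma> < \<eta>"
  obtains C \<epsilon> where "0 < C" "0 < \<epsilon>" "\<And>k \<psi> b. tb \<eta> \<eta> \<psi> b \<Longrightarrow> integral\<^sup>L \<mu> \<psi> = 0 \<Longrightarrow>
    tb \<beta> \<gamma> (T k \<psi>) (C * \<delta> powr (\<epsilon> * \<bar>real_of_int k\<bar>) * b)"
proof -
  \<comment> \<open>The largest rate that \<open>pairing_decay\<close> allows.\<close>
  define \<epsilon> where "\<epsilon> = min \<gamma> (min (\<eta> - \<beta>) ((\<eta> - \<gamma>) / 2))"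
  have \<epsilon>: "0 < \<epsilon>" "0 \<le> \<epsilon>" "\<epsilon> \<le> \<gamma>" "\<epsilon> \<le> \<eta> - \<beta>" "\<epsilon> \<le> (\<eta> - \<gamma>) / 2"
    using assms by (auto simp: \<epsilon>_def min_def)
  obtain C where C: "0 < C" "\<And>R y K l \<psi> b. 0 < R \<Longrightarrow> admissible R ((\<eta> + \<gamma>) / 2) y K l \<Longrightarrow>
    tb \<eta> \<eta> \<psi> b \<Longrightarrow> integral\<^sup>L \<mu> \<psi> = 0 \<Longrightarrow>
    norm (LINT x|\<mu>. K x * \<psi> x) \<le> C * min (R powr \<epsilon>) (R powr (- \<epsilon>)) * l * b * (rel_scale R y powr \<beta> * pd \<gamma> y)"
    by (rule pairing_decay[OF assms less_imp_le[OF \<eta>(2)] \<epsilon>(2-)]) (use that in auto)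
  define D where "D = shift_const \<beta> \<gamma> * column_const * C"
  have "0 < D"
    using C(1) shift_const_pos column_const_pos by (simp add: D_def)
  moreover have "tb \<beta> \<gamma> (T k \<psi>) (D * \<delta> powr (\<epsilon> * \<bar>real_of_int k\<bar>) * b)"
    if \<psi>: "tb \<eta> \<eta> \<psi> b" and int0: "integral\<^sup>L \<mu> \<psi> = 0" for k \<psi> b
  proof -
    have "tb \<beta> \<gamma> (T k \<psi>) (shift_const \<beta> \<gamma> * column_const * (C * \<delta> powr (\<epsilon> * \<bar>real_of_int k\<bar>) * b))"
    proof (rule tb_T[OF \<psi> \<eta>(1) \<eta>(1) assms(1) _ _ _ _])
      show "norm (LINT x|\<mu>. K x * \<psi> x) \<le>
          C * \<delta> powr (\<epsilon> * \<bar>real_of_int k\<bar>) * b * l * (rel_scale (R k) y powr \<beta> * pd \<gamma> y)"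
        if "admissible (R k) ((\<eta> + \<gamma>) / 2) y K l" for y K l
        using C(2)[OF R_pos that \<psi> int0] by (simp add: mult_ac min_R_powr[OF \<epsilon>(2)])
    qed (use assms \<eta> C(1) tb_nonneg[OF \<psi>] in auto)
    then show ?thesis
      by (simp add: D_def mult_ac)
  qed
  ultimately show ?thesis
    using \<epsilon>(1) by (intro that)
qed

section \<open>The kernels as test functions\<close>

text \<open>A bump of scale \<open>r\<close> about \<open>x\<close> is a test function about
  \<open>x0\<close> as soon as \<open>L * r\<close> dominates both the unit scale and the distance
  of the centres. Of its decay, \<gamma> units give the weight, at the cost
  \<open>r powr \<gamma>\<close>, and \<beta> units the regularity at distances beyond
  \<open>r\<close>. The amplitude \<open>l\<close> is kept so that rows and differences of rows are
  treated together.\<close>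

lemma kernel_tb:
  assumes "0 < \<beta>" "\<beta> \<le> \<eta>" "0 < \<gamma>" "\<gamma> \<le> \<eta>" "1 \<le> L"
    and r: "0 < r" and l: "0 \<le> l"
    and x: "d x0 x \<le> L * r" "\<And>y. 1 + d x0 y \<le> L * (r + d x y)"
    and size: "\<And>y. norm (h y) \<le> l * pw r 3 x y"
    and reg: "\<And>y y'. d y y' \<le> r \<Longrightarrow> norm (h y - h y') \<le> l * (d y y' / r) powr \<eta> * pw r 3 x y"
  shows "tb \<beta> \<gamma> h (shift_const \<beta> \<gamma> * doubling_const L * L powr (\<beta> + \<gamma>) * l * r powr \<gamma>)"
proof -
  have p: "pw r 3 x y \<le> doubling_const L * (L * r) powr p * pd p y" if "0 \<le> p" "p \<le> 3" for y p
  proof -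
    have pos: "0 < r + d x y"
      using r by (simp add: add_pos_nonneg)
    have "(r / (r + d x y)) powr 3 \<le> (r / (r + d x y)) powr p"
      using that pos r by (intro powr_mono') auto
    also have "\<dots> \<le> ((L * r) * (1 / (1 + d x0 y))) powr p"
      using mult_left_mono[OF x(2)[of y], of r] that pos r
      by (intro powr_mono2) (auto simp: field_simps add_pos_nonneg)
    also have "\<dots> = (L * r) powr p * (1 / (1 + d x0 y)) powr p"
      using assms(5) r by (subst powr_mult) (auto simp: less_imp_le)
    finally have 1: "(r / (r + d x y)) powr 3 \<le> (L * r) powr p * (1 / (1 + d x0 y)) powr p" .
    have "d x x0 \<le> L * (r + d x y)"
      using x(1) assms(5) d_commute[of x x0] by (simp add: ring_distribs add_increasing2)
    then have 2: "1 / V x (r + d x y) \<le> doubling_const L / V x0 (1 + d x0 y)"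
      using pos x(2)[of y] by (intro inverse_V_le) auto
    have "pw r 3 x y = (r / (r + d x y)) powr 3 * (1 / V x (r + d x y))"
      by (simp add: pw_def)
    also have "\<dots> \<le> ((L * r) powr p * (1 / (1 + d x0 y)) powr p) * (doubling_const L / V x0 (1 + d x0 y))"
      using 1 2 by (intro mult_mono) auto
    finally show ?thesis
      by (simp add: pw_def mult_ac)
  qed
  define D where "D = doubling_const L * L powr (\<beta> + \<gamma>) * l * r powr \<gamma>"
  have D: "0 \<le> D"
    using doubling_const_pos[of L] l by (simp add: D_def)
  have le_sc: "u \<le> shift_const \<beta> \<gamma> * u" if "0 \<le> u" for u
    using mult_right_mono[OF shift_const_ge_1[of \<beta> \<gamma>] that] by simp
  have p2: "l * pw r 3 x y \<le> D * ((r / (1 + d x0 y)) powr \<beta> * pd \<gamma> y)" for y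
  proof -
    have "l * pw r 3 x y \<le> l * (doubling_const L * (L * r) powr (\<beta> + \<gamma>) * pd (\<beta> + \<gamma>) y)"
      using assms \<eta> by (intro mult_left_mono p) auto
    also have "pd (\<beta> + \<gamma>) y = (1 + d x0 y) powr (- \<beta>) * pd \<gamma> y"
      using pd_split[of "\<beta> + \<gamma>" y \<beta>] by simp
    also have "l * (doubling_const L * (L * r) powr (\<beta> + \<gamma>) * ((1 + d x0 y) powr (- \<beta>) * pd \<gamma> y)) =
        D * ((r / (1 + d x0 y)) powr \<beta> * pd \<gamma> y)"
      using assms(5) r
      by (simp add: D_def powr_mult powr_divide powr_add powr_minus_divide less_imp_le)
    finally show ?thesis .
  qed
  have "tb \<beta> \<gamma> h (shift_const \<beta> \<gamma> * D)"
  proof (rule tbI)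
    fix y
    have "norm (h y) \<le> l * (doubling_const L * (L * r) powr \<gamma> * pd \<gamma> y)"
      using assms \<eta> by (intro order_trans[OF size] mult_left_mono p) auto
    also have "\<dots> = doubling_const L * L powr \<gamma> * l * r powr \<gamma> * pd \<gamma> y"
      using assms(5) r by (simp add: powr_mult)
    also have "\<dots> \<le> D * pd \<gamma> y"
      unfolding D_def using assms doubling_const_pos[of L]
      by (intro mult_right_mono mult_left_mono powr_mono) (auto simp: less_imp_le)
    also have "\<dots> \<le> shift_const \<beta> \<gamma> * D * pd \<gamma> y"
      using le_sc[of "D * pd \<gamma> y"] D by (simp add: mult.assoc)
    finally show "norm (h y) \<le> shift_const \<beta> \<gamma> * D * pd \<gamma> y" .
  next
    fix y y' assume yy: "d y y' \<le> (1 + d x0 y) / (2 * A0)"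
    show "norm (h y - h y') \<le> shift_const \<beta> \<gamma> * D * (d y y' / (1 + d x0 y)) powr \<beta> * pd \<gamma> y"
    proof (cases "d y y' \<le> r")
      case True
      have "norm (h y - h y') \<le> (d y y' / r) powr \<eta> * (l * pw r 3 x y)"
        using reg[OF True] by (simp add: mult_ac)
      also have "\<dots> \<le> (d y y' / r) powr \<beta> * (D * ((r / (1 + d x0 y)) powr \<beta> * pd \<gamma> y))"
        using True assms by (intro mult_mono p2 powr_mono') auto
      also have "\<dots> = D * (((d y y' / r) powr \<beta> * (r / (1 + d x0 y)) powr \<beta>) * pd \<gamma> y)"
        by simp
      also have "(d y y' / r) powr \<beta> * (r / (1 + d x0 y)) powr \<beta> = (d y y' / r * (r / (1 + d x0 y))) powr \<beta>"
        using r by (subst powr_mult) (auto simp: less_imp_le)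
      also have "d y y' / r * (r / (1 + d x0 y)) = d y y' / (1 + d x0 y)"
        using r by simp
      also have "D * ((d y y' / (1 + d x0 y)) powr \<beta> * pd \<gamma> y) \<le>
          shift_const \<beta> \<gamma> * (D * ((d y y' / (1 + d x0 y)) powr \<beta> * pd \<gamma> y))"
        using D by (intro le_sc) simp
      finally show ?thesis
        by (simp add: mult.assoc)
    next
      case False
      show ?thesis
      proof (rule two_point_bound[OF yy assms(1) _ _ _ D])
        show "norm (h w) \<le> D * ((r / (1 + d x0 w)) powr \<beta> * pd \<gamma> w)" for w
          by (rule order_trans[OF size p2])
      qed (use False assms in auto)
    qed
  qed
  then show ?thesis
    by (simp add: D_def mult_ac)
qed

text \<open>The constant is uniform over a bounded set of base points and over all scales from
  \<rho> upwards; only the factor \<open>R k powr \<gamma>\<close> grows. This growth is the a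
  priori bound from which the regularity argument for \<open>x \<mapsto> L (Q k x)\<close>
  starts.\<close>

lemma rows_tb:
  assumes "0 < \<beta>" "\<beta> \<le> \<eta>" "0 < \<gamma>" "\<gamma> \<le> \<eta>" "0 < \<rho>"
  obtains C where "0 < C"
    "\<And>k x. d x0 x \<le> M \<Longrightarrow> \<rho> \<le> R k \<Longrightarrow> tb \<beta> \<gamma> (Q k x) (C * R k powr \<gamma>)"
    "\<And>k x x'. d x0 x \<le> M \<Longrightarrow> \<rho> \<le> R k \<Longrightarrow> d x x' \<le> R k \<Longrightarrow>
      tb \<beta> \<gamma> (\<lambda>y. Q k x y - Q k x' y) (C * (d x x' / R k) powr \<eta> * R k powr \<gamma>)"
proof -
  define M' where "M' = max M 0"
  \<comment> \<open>The summands dominate, in turn, the constant 1, the coefficient of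
    \<open>d x y\<close> in the quasi-triangle inequality, the remaining constant
    \<open>1 + A0 * M'\<close> relative to \<rho>, and the distance from \<open>x0\<close> relative
    to \<rho>.\<close>
  define L where "L = 1 + A0 + (1 + A0 * M') / \<rho> + M' / \<rho>"
  have M': "0 \<le> M'" "M \<le> M'"
    by (auto simp: M'_def)
  have L: "1 \<le> L"
    using A0_pos M' assms by (simp add: L_def add_increasing2 add_nonneg_nonneg)
  have L1: "d x0 x \<le> L * R k" "1 + d x0 y \<le> L * (R k + d x y)" if "d x0 x \<le> M" "\<rho> \<le> R k" for x y k
  proof -
    have "0 \<le> (1 + A0 * M') / \<rho>" "0 \<le> M' / \<rho>"
      using A0_pos M' assms by simp_all
    then have "M' / \<rho> \<le> L" "(1 + A0 * M') / \<rho> \<le> L" "A0 \<le> L"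
      using A0_pos unfolding L_def by linarith+
    have "M' \<le> M' / \<rho> * R k"
      using that assms M' mult_left_mono[OF that(2), of M'] by (simp add: field_simps)
    also have "\<dots> \<le> L * R k"
      using \<open>M' / \<rho> \<le> L\<close> by (intro mult_right_mono) auto
    finally show "d x0 x \<le> L * R k"
      using that M' by linarith
    have "d x0 y \<le> A0 * (d x0 x + d x y)"
      by (rule d_triangle)
    also have "\<dots> \<le> A0 * (M' + d x y)"
      using that M' A0_pos by (intro mult_left_mono) auto
    finally have "1 + d x0 y \<le> (1 + A0 * M') + A0 * d x y"
      by (simp add: ring_distribs)
    also have "1 + A0 * M' \<le> (1 + A0 * M') / \<rho> * R k"
      using that assms M' A0_pos mult_left_mono[OF that(2), of "1 + A0 * M'"] by (simp add: field_simps)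
    also have "\<dots> \<le> L * R k"
      using \<open>(1 + A0 * M') / \<rho> \<le> L\<close> by (intro mult_right_mono) auto
    also have "A0 * d x y \<le> L * d x y"
      using \<open>A0 \<le> L\<close> by (intro mult_right_mono) auto
    finally show "1 + d x0 y \<le> L * (R k + d x y)"
      by (simp add: ring_distribs)
  qed
  define B where "B = shift_const \<beta> \<gamma> * doubling_const L * L powr (\<beta> + \<gamma>)"
  have B: "0 < B"
    using shift_const_pos doubling_const_pos L by (simp add: B_def)
  have "tb \<beta> \<gamma> (Q k x) (B * column_const * R k powr \<gamma>)" if "d x0 x \<le> M" "\<rho> \<le> R k" for k x
    unfolding B_def
  proof (rule kernel_tb[OF assms(1-4) L R_pos _ L1[OF that]])
    show "norm (Q k x y) \<le> column_const * pw (R k) 3 x y" for y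
      using order_trans[OF Q_size] Cq_pw_le(2)[of 1 k x y] by simp
    show "norm (Q k x y - Q k x y') \<le> column_const * (d y y' / R k) powr \<eta> * pw (R k) 3 x y"
      if "d y y' \<le> R k" for y y'
      using order_trans[OF Q_reg2[OF that] Cq_pw_le(1)] by simp
  qed (use column_const_pos in auto)
  moreover have "tb \<beta> \<gamma> (\<lambda>y. Q k x y - Q k x' y) (B * (column_const * (d x x' / R k) powr \<eta>) * R k powr \<gamma>)"
    if "d x0 x \<le> M" "\<rho> \<le> R k" and xx: "d x x' \<le> R k" for k x x'
    unfolding B_def
  proof (rule kernel_tb[OF assms(1-4) L R_pos _ L1[OF that(1,2)]])
    show "norm (Q k x y - Q k x' y) \<le> column_const * (d x x' / R k) powr \<eta> * pw (R k) 3 x y" for y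
      using order_trans[OF Q_reg1[OF xx] Cq_pw_le(2)] by simp
    show "norm ((Q k x y - Q k x' y) - (Q k x y' - Q k x' y')) \<le>
        column_const * (d x x' / R k) powr \<eta> * (d y y' / R k) powr \<eta> * pw (R k) 3 x y"
      if "d y y' \<le> R k" for y y'
      using order_trans[OF Q_reg12[OF xx that]]
        Cq_pw_le(2)[of "(d x x' / R k) powr \<eta> * (d y y' / R k) powr \<eta>" k x y] by (simp add: mult.assoc)
  qed (use column_const_pos in auto)
  ultimately show ?thesis
    using B column_const_pos by (intro that[of "B * column_const"]) (auto simp: mult.assoc)
qed

lemma row_tb:
  assumes "0 < \<beta>" "\<beta> \<le> \<eta>" "0 < \<gamma>" "\<gamma> \<le> \<eta>"
  shows "\<exists>C. tb \<beta> \<gamma> (Q k x) C"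
  using rows_tb[OF assms R_pos[of k], of "d x0 x"] by (metis order_refl)

lemma row_test_space0: "Q k x \<in> test_space0 d A0 \<mu> x0 \<eta> \<eta>"
  unfolding test_space0_iff using row_tb[of \<eta> \<eta>] \<eta> Q_row by simp

end

section \<open>Truncation of test functions and Riemann sums for the transposed operators\<close>

definition clamp :: "real \<Rightarrow> complex \<Rightarrow> complex" where
  "clamp t = closest_point (cball 0 t)"

lemma
  assumes "0 < t"
  shows norm_clamp_le: "norm (clamp t v) \<le> t"
    and clamp_eq: "norm v \<le> t \<Longrightarrow> clamp t v = v"
    and clamp_lipschitz: "norm (clamp t v - clamp t w) \<le> norm (v - w)"
    and norm_clamp_le_norm: "norm (clamp t v) \<le> norm v"
proof -
  have ne: "cball (0 :: complex) t \<noteq> {}"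
    using assms by auto
  show "norm (clamp t v) \<le> t" for v
    using closest_point_in_set[OF closed_cball ne, of v] by (simp add: clamp_def)
  show c: "norm v \<le> t \<Longrightarrow> clamp t v = v" for v
    by (simp add: clamp_def closest_point_self)
  show l: "norm (clamp t v - clamp t w) \<le> norm (v - w)" for v w
    using closest_point_lipschitz[OF convex_cball closed_cball ne, of v w]
    by (simp add: clamp_def dist_norm)
  show "norm (clamp t v) \<le> norm v"
    using l[of v 0] c[of 0] assms by simp
qed

lemma clamp_measurable [measurable]:
  assumes "0 < t"
  shows "clamp t \<in> borel_measurable borel"
proof (rule borel_measurable_continuous_onI)
  have "dist (clamp t v) (clamp t w) \<le> 1 * dist v w" for v w
    using clamp_lipschitz[OF assms, of v w] by (simp add: dist_norm)
  then have "1-lipschitz_on UNIV (clamp t)"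
    by (intro lipschitz_onI) auto
  then show "continuous_on UNIV (clamp t)"
    by (rule lipschitz_on_continuous_on)
qed

context pointed_homogeneous_space
begin

lemma pd_tail:
  assumes "0 < \<kappa>" "0 < e"
  shows "\<exists>M\<ge>0. \<forall>x. M \<le> d x0 x \<longrightarrow> (1 + d x0 x) powr (- \<kappa>) \<le> e"
proof (intro exI conjI allI impI)
  show "0 \<le> e powr (- 1 / \<kappa>)"
    by simp
  fix x assume "e powr (- 1 / \<kappa>) \<le> d x0 x"
  then have "e powr (- 1 / \<kappa>) \<le> 1 + d x0 x"
    by simp
  then have "(1 + d x0 x) powr (- \<kappa>) \<le> (e powr (- 1 / \<kappa>)) powr (- \<kappa>)"
    using assms by (intro powr_mono2') auto
  then show "(1 + d x0 x) powr (- \<kappa>) \<le> e"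
    using assms by (simp add: powr_powr)
qed

text \<open>Clamping the values keeps the regularity of a test function and removes a function of bounded
  support. Multiplication by a cutoff function would need a Hoelder continuous cutoff,
  which a quasi-metric need not provide directly.\<close>

lemma tb_clamp:
  assumes \<phi>: "tb \<eta> \<eta> \<phi> b" and "0 < \<beta>" "\<beta> < \<eta>" "0 < \<gamma>" "\<gamma> < \<eta>" "0 < e"
  shows "\<exists>t>0. tb \<beta> \<gamma> (\<lambda>x. clamp t (\<phi> x)) e"
proof -
  define b' where "b' = b + 1"
  have b': "0 < b'" "tb \<eta> \<eta> \<phi> b'"
    using tb_nonneg[OF \<phi>] tb_mono[OF \<phi>] by (auto simp: b'_def)
  define c where "c = 1 + (2 * A0) powr \<gamma> * doubling_const (2 * A0)"
  have c: "0 < c"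
    using less_imp_le[OF doubling_const_pos[of "2 * A0"]] by (simp add: c_def add_pos_nonneg)
  \<comment> \<open>For ratios up to \<open>r0\<close> the surplus regularity makes the increment
    small: \<open>b' * r0 powr (\<eta> - \<beta>)\<close> equals \<open>e\<close>.\<close>
  define r0 where "r0 = (e / b') powr (1 / (\<eta> - \<beta>))"
  have r0: "0 < r0"
    using assms b' by (simp add: r0_def)
  \<comment> \<open>For ratios above \<open>r0\<close> only size is used; \<open>e'\<close> is so
    small that the two sizes, whose sum costs the factor \<open>c\<close>, stay below
    \<open>e * r0 powr \<beta>\<close>.\<close>
  define e' where "e' = min e (e * r0 powr \<beta> / c)"
  have e': "0 < e'" "e' \<le> e" "c * e' \<le> e * r0 powr \<beta>"
    using assms r0 c by (auto simp: e'_def field_simps min_def)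
  obtain M where M: "0 \<le> M" "\<And>x. M \<le> d x0 x \<Longrightarrow> (1 + d x0 x) powr (- (\<eta> - \<gamma>)) \<le> e' / b'"
    using pd_tail[of "\<eta> - \<gamma>" "e' / b'"] assms e' b' by auto
  \<comment> \<open>A lower bound for \<open>pd \<gamma>\<close> inside the ball of radius
    \<open>M\<close>. Clamping at \<open>e' * m\<close> gives the size bound there, while beyond
    \<open>M\<close> the surplus decay of \<phi> gives it.\<close>
  define m where "m = (1 / (1 + M)) powr \<gamma> / V x0 (1 + M)"
  have m: "0 < m"
    using M V_pos[of "1 + M" x0] by (simp add: m_def)
  define t where "t = e' * m"
  have t: "0 < t"
    using e' m by (simp add: t_def)
  have size: "norm (clamp t (\<phi> x)) \<le> e' * pd \<gamma> x" for x
  proof (cases "M \<le> d x0 x")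
    case True
    have "norm (clamp t (\<phi> x)) \<le> b' * ((1 + d x0 x) powr (- (\<eta> - \<gamma>)) * pd \<gamma> x)"
      using order_trans[OF norm_clamp_le_norm[OF t] tb_size[OF b'(2), of x]] pd_split[of \<eta> x "\<eta> - \<gamma>"] by simp
    also have "\<dots> \<le> b' * (e' / b' * pd \<gamma> x)"
      using M(2)[OF True] b' by (intro mult_left_mono mult_right_mono) auto
    finally show ?thesis
      using b' by simp
  next
    case False
    have "1 / (1 + M) \<le> 1 / (1 + d x0 x)"
      using False by (intro divide_left_mono mult_pos_pos) (auto intro: add_pos_nonneg M(1))
    then have "m \<le> pd \<gamma> x"
      unfolding m_def pw_def using False assms M(1) by (intro frac_le V_mono V_pos powr_mono2) auto
    then have "t \<le> e' * pd \<gamma> x"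
      using e' by (simp add: t_def)
    then show ?thesis
      using norm_clamp_le[OF t, of "\<phi> x"] by linarith
  qed
  have "tb \<beta> \<gamma> (\<lambda>x. clamp t (\<phi> x)) e"
  proof (rule tbI)
    show "norm (clamp t (\<phi> x)) \<le> e * pd \<gamma> x" for x
      using size[of x] e'(2) by (meson mult_right_mono order_trans pw_nonneg)
    fix x y assume xy: "d x y \<le> (1 + d x0 x) / (2 * A0)"
    define r where "r = d x y / (1 + d x0 x)"
    have r: "0 \<le> r"
      by (simp add: r_def less_imp_le)
    show "norm (clamp t (\<phi> x) - clamp t (\<phi> y)) \<le> e * (d x y / (1 + d x0 x)) powr \<beta> * pd \<gamma> x"
    proof (cases "r \<le> r0")
      case True
      have "norm (clamp t (\<phi> x) - clamp t (\<phi> y)) \<le> b' * r powr \<eta> * pd \<eta> x"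
        unfolding r_def by (rule order_trans[OF clamp_lipschitz[OF t] tb_reg[OF b'(2) xy]])
      also have "\<dots> \<le> b' * (r powr (\<eta> - \<beta>) * r powr \<beta>) * pd \<gamma> x"
        using assms b' by (intro mult_mono pw_antimono) (auto simp flip: powr_add)
      also have "r powr (\<eta> - \<beta>) \<le> r0 powr (\<eta> - \<beta>)"
        using True r assms by (intro powr_mono2) auto
      also have "r0 powr (\<eta> - \<beta>) = e / b'"
        using assms b' by (simp add: r0_def powr_powr)
      finally show ?thesis
        using b' by (simp add: r_def mult_left_mono mult_right_mono)
    next
      case False
      have "norm (clamp t (\<phi> y)) \<le> e' * ((2 * A0) powr \<gamma> * doubling_const (2 * A0) * pd \<gamma> x)"
        using order_trans[OF size[of y] mult_left_mono[OF pd_shift[OF xy]]] e' assms by simp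
      then have "norm (clamp t (\<phi> x) - clamp t (\<phi> y)) \<le> c * e' * pd \<gamma> x"
        using norm_triangle_ineq4[of "clamp t (\<phi> x)" "clamp t (\<phi> y)"] size[of x]
        by (simp add: c_def algebra_simps)
      also have "\<dots> \<le> e * r0 powr \<beta> * pd \<gamma> x"
        using e' by (intro mult_right_mono) auto
      also have "\<dots> \<le> e * r powr \<beta> * pd \<gamma> x"
        using False r0 assms by (intro mult_right_mono mult_left_mono powr_mono2) auto
      finally show ?thesis
        by (simp add: r_def)
    qed
  qed
  with t show ?thesis
    by blast
qed

lemma tb_small_outside:
  assumes \<phi>: "tb \<beta> \<gamma> \<phi> b" and "0 < \<gamma>" "0 < t"
  shows "\<exists>M>0. \<forall>x. M \<le> d x0 x \<longrightarrow> norm (\<phi> x) \<le> t"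
proof -
  define e where "e = t * V x0 1 / (b + 1)"
  have b: "0 \<le> b"
    by (rule tb_nonneg[OF \<phi>])
  have e: "0 < e"
    using assms b V_pos[of 1 x0] by (simp add: e_def)
  obtain M where M: "0 \<le> M" "\<And>x. M \<le> d x0 x \<Longrightarrow> (1 + d x0 x) powr (- \<gamma>) \<le> e"
    using pd_tail[OF assms(2) e] by auto
  have "norm (\<phi> x) \<le> t" if "M + 1 \<le> d x0 x" for x
  proof -
    have "pd \<gamma> x = (1 + d x0 x) powr (- \<gamma>) / V x0 (1 + d x0 x)"
      by (simp add: pw_def powr_divide powr_minus_divide less_imp_le)
    also have "\<dots> \<le> e / V x0 1"
      using M(2)[of x] that e by (intro frac_le V_mono V_pos) auto
    finally have "norm (\<phi> x) \<le> (b + 1) * (e / V x0 1)"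
      using tb_size[OF \<phi>, of x] b by (meson mult_mono add_increasing2 order_trans order_refl pw_nonneg zero_le_one add_nonneg_nonneg)
    also have "\<dots> = t"
      using b V_pos[of 1 x0] by (simp add: e_def)
    finally show ?thesis .
  qed
  then show ?thesis
    using M(1) by (intro exI[of _ "M + 1"]) auto
qed

text \<open>Minkowski's inequality for the test norm: a superposition of test functions with weight
  \<psi> costs the integral of the modulus of the weight over \<open>P\<close>.\<close>

lemma tb_integral:
  assumes H: "\<And>x. x \<in> P \<Longrightarrow> tb \<beta> \<gamma> (H x) C" and C: "0 \<le> C"
    and [measurable]: "\<And>y. (\<lambda>x. H x y) \<in> borel_measurable \<mu>" "P \<in> sets \<mu>"
    and \<psi>: "integrable \<mu> \<psi>"
  shows "tb \<beta> \<gamma> (\<lambda>y. LINT x|\<mu>. indicator P x *\<^sub>R (H x y * \<psi> x)) (C * (LINT x|\<mu>. indicator P x * norm (\<psi> x)))"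
    and "integrable \<mu> (\<lambda>x. indicator P x *\<^sub>R (H x y * \<psi> x))"
proof -
  have [measurable]: "\<psi> \<in> borel_measurable \<mu>"
    using \<psi> by simp
  have i: "integrable \<mu> (\<lambda>x. indicator P x * norm (\<psi> x))"
    using integrable_mult_indicator[OF assms(4) integrable_norm[OF \<psi>]] by simp
  have s: "norm (indicator P x *\<^sub>R (h * \<psi> x)) \<le> D * (indicator P x * norm (\<psi> x))"
    if "x \<in> P \<Longrightarrow> norm h \<le> D" for x h D
    using that by (cases "x \<in> P") (auto simp: norm_mult mult_right_mono)
  show int: "integrable \<mu> (\<lambda>x. indicator P x *\<^sub>R (H x y * \<psi> x))" for y
  proof (rule norm_integral_le(1)[OF _ _ s])
    show "integrable \<mu> (\<lambda>x. C * pd \<gamma> y * (indicator P x * norm (\<psi> x)))"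
      using i by simp
  qed (auto intro: tb_size[OF H])
  show "tb \<beta> \<gamma> (\<lambda>y. LINT x|\<mu>. indicator P x *\<^sub>R (H x y * \<psi> x)) (C * (LINT x|\<mu>. indicator P x * norm (\<psi> x)))"
  proof (rule tbI)
    fix y
    have "norm (LINT x|\<mu>. indicator P x *\<^sub>R (H x y * \<psi> x)) \<le> (LINT x|\<mu>. C * pd \<gamma> y * (indicator P x * norm (\<psi> x)))"
    proof (rule norm_integral_le(2)[OF _ _ s])
      show "integrable \<mu> (\<lambda>x. C * pd \<gamma> y * (indicator P x * norm (\<psi> x)))"
        using i by simp
    qed (auto intro: tb_size[OF H])
    also have "\<dots> = C * (LINT x|\<mu>. indicator P x * norm (\<psi> x)) * pd \<gamma> y"
      by (subst integral_mult_right_zero) (simp add: mult_ac)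
    finally show "norm (LINT x|\<mu>. indicator P x *\<^sub>R (H x y * \<psi> x)) \<le>
        C * (LINT x|\<mu>. indicator P x * norm (\<psi> x)) * pd \<gamma> y" .
  next
    fix y y' assume yy: "d y y' \<le> (1 + d x0 y) / (2 * A0)"
    define D where "D = C * (d y y' / (1 + d x0 y)) powr \<beta> * pd \<gamma> y"
    have "(LINT x|\<mu>. indicator P x *\<^sub>R (H x y * \<psi> x)) - (LINT x|\<mu>. indicator P x *\<^sub>R (H x y' * \<psi> x)) =
        (LINT x|\<mu>. indicator P x *\<^sub>R ((H x y - H x y') * \<psi> x))"
      using int by (simp add: left_diff_distrib scaleR_right_diff_distrib)
    also have "norm \<dots> \<le> (LINT x|\<mu>. D * (indicator P x * norm (\<psi> x)))"
    proof (rule norm_integral_le(2)[OF _ _ s])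
      show "integrable \<mu> (\<lambda>x. D * (indicator P x * norm (\<psi> x)))"
        using i by simp
      show "norm (H x y - H x y') \<le> D" if "x \<in> P" for x
        unfolding D_def by (rule tb_reg[OF H[OF that] yy])
    qed auto
    also have "\<dots> = C * (LINT x|\<mu>. indicator P x * norm (\<psi> x)) * (d y y' / (1 + d x0 y)) powr \<beta> * pd \<gamma> y"
      by (subst integral_mult_right_zero) (simp add: D_def mult_ac)
    finally show "norm ((LINT x|\<mu>. indicator P x *\<^sub>R (H x y * \<psi> x)) - (LINT x|\<mu>. indicator P x *\<^sub>R (H x y' * \<psi> x))) \<le>
        C * (LINT x|\<mu>. indicator P x * norm (\<psi> x)) * (d y y' / (1 + d x0 y)) powr \<beta> * pd \<gamma> y" .
  qed
qed

end

context decaying_kernels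
begin

lemma integrable_Q_mult:
  assumes "integrable \<mu> \<psi>"
  shows "integrable \<mu> (\<lambda>x. Q k x y * \<psi> x)"
proof -
  have [measurable]: "\<psi> \<in> borel_measurable \<mu>"
    using assms by simp
  define D where "D = column_const / V y (R k)"
  have "norm (Q k x y * \<psi> x) \<le> D * norm (\<psi> x)" for x
  proof -
    have "norm (Q k x y) \<le> column_const * pw (R k) 3 y x"
      by (rule admissibleD(5)[OF admissible_column[OF \<eta>(1) order_refl]])
    also have "pw (R k) 3 y x \<le> 1 / V y (R k)"
      unfolding pw_def using R_pos[of k]
      by (intro frac_le V_mono V_pos) (auto intro!: power_le_one simp: divide_le_eq_1_pos add_pos_nonneg simp del: R_pos)
    finally have "norm (Q k x y) \<le> D"
      using column_const_pos by (simp add: D_def)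
    then show ?thesis
      by (simp add: norm_mult mult_right_mono)
  qed
  then show ?thesis
    using assms by (intro norm_integral_le(1)[where g = "\<lambda>x. D * norm (\<psi> x)"]) auto
qed

text \<open>One set of nodes has to serve two purposes: the sum of rows approximates
  \<open>T k \<psi>\<close> in the test norm, and the same sum approximates the integral of \<psi>
  against any bounded \<open>G\<close> whose increments are controlled by the test norms of row
  differences. The case in mind is \<open>G x = L (Q k x)\<close> for a continuous functional
  \<open>L\<close>. Both follow because rows vary by at most \<open>e1\<close> within a
  cell.\<close>

lemma riemann_sum_bounded_support:
  assumes "0 < \<beta>" "\<beta> \<le> \<eta>" "0 < \<gamma>" "\<gamma> \<le> \<eta>" "0 < e"
    and \<psi>: "integrable \<mu> \<psi>" "\<And>x. M \<le> d x0 x \<Longrightarrow> \<psi> x = 0"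
  shows "\<exists>(n::nat) c z. tb \<beta> \<gamma> (\<lambda>y. T k \<psi> y - (\<Sum>i<n. c i * Q k (z i) y)) e \<and>
    (\<forall>G A B. G \<in> borel_measurable \<mu> \<longrightarrow> (\<forall>x. norm (G x) \<le> A) \<longrightarrow> 0 \<le> B \<longrightarrow>
      (\<forall>x x' C. tb \<beta> \<gamma> (\<lambda>y. Q k x y - Q k x' y) C \<longrightarrow> norm (G x - G x') \<le> B * C) \<longrightarrow>
      norm ((LINT x|\<mu>. \<psi> x * G x) - (\<Sum>i<n. c i * G (z i))) \<le> B * e)"
proof -
  have [measurable]: "\<psi> \<in> borel_measurable \<mu>"
    using \<psi> by simp
  obtain C where C: "0 < C" "\<And>x x'. d x0 x \<le> M \<Longrightarrow> d x x' \<le> R k \<Longrightarrow>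
      tb \<beta> \<gamma> (\<lambda>y. Q k x y - Q k x' y) (C * (d x x' / R k) powr \<eta> * R k powr \<gamma>)"
    by (rule rows_tb[OF assms(1-4) R_pos[of k], of M]) (use that in auto)
  define I where "I = (LINT x|\<mu>. norm (\<psi> x))"
  have I: "0 \<le> I"
    by (simp add: I_def)
  \<comment> \<open>Error allowed per unit of mass of \<psi>; the added 1 keeps the quotient defined
    when \<psi> has no mass.\<close>
  define e1 where "e1 = e / (I + 1)"
  have e1: "0 < e1"
    using assms I by (simp add: e1_def)
  \<comment> \<open>Relative mesh for which the row variation is at most \<open>e1\<close>; the cap
    1 keeps cells within the range \<open>R k\<close> of the kernel regularity.\<close>
  define u where "u = min 1 ((e1 / (C * R k powr \<gamma>)) powr (1 / \<eta>))"
  have u: "0 < u" "u \<le> 1"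
    using e1 C(1) \<delta> by (auto simp: u_def)
  have "u powr \<eta> \<le> ((e1 / (C * R k powr \<gamma>)) powr (1 / \<eta>)) powr \<eta>"
    using u \<eta> by (intro powr_mono2) (auto simp: u_def)
  also have "\<dots> = e1 / (C * R k powr \<gamma>)"
    using \<eta> e1 C by (simp add: powr_powr)
  finally have ue: "C * u powr \<eta> * R k powr \<gamma> \<le> e1"
    using C(1) by (subst (asm) pos_le_divide_eq) (use \<delta> in \<open>auto intro!: mult_pos_pos simp: mult_ac\<close>)
  obtain n P z where P: "\<And>i::nat. P i \<in> sets \<mu>" "disjoint_family P" "(\<Union>i<n. P i) = qball d x0 M"
    "\<And>i. i < n \<Longrightarrow> z i \<in> qball d x0 M" "\<And>i y. i < n \<Longrightarrow> y \<in> P i \<Longrightarrow> d y (z i) < u * R k"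
    by (rule finite_partition[of "u * R k" x0 M]) (use u that in auto)
  note [measurable] = P(1)
  have Qd: "tb \<beta> \<gamma> (\<lambda>y. Q k x y - Q k (z i) y) e1" if "i < n" "x \<in> P i" for i x
  proof -
    have x: "d x0 x < M" "d x (z i) \<le> u * R k"
      using that P(3) P(5)[OF that] by (auto simp: qball_def)
    have uR: "u * R k \<le> R k"
      using mult_right_mono[OF u(2), of "R k"] by simp
    have "tb \<beta> \<gamma> (\<lambda>y. Q k x y - Q k (z i) y) (C * (d x (z i) / R k) powr \<eta> * R k powr \<gamma>)"
      by (intro C(2)) (use x uR in linarith)+
    moreover have "C * (d x (z i) / R k) powr \<eta> * R k powr \<gamma> \<le> C * u powr \<eta> * R k powr \<gamma>"
      using x C \<eta> R_pos[of k]
      by (intro mult_right_mono mult_left_mono powr_mono2) (auto simp: pos_divide_le_eq simp del: R_pos)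
    ultimately show ?thesis
      using tb_mono ue by (meson order_trans)
  qed
  define c where "c i = (LINT x|\<mu>. indicator (P i) x *\<^sub>R \<psi> x)" for i
  have ind_sum: "(\<Sum>i<n. indicator (P i) x :: real) = indicator (\<Union>i<n. P i) x" for x
    using P(2) by (subst indicator_UN_disjoint) (auto simp: disjoint_family_on_def)
  have split: "(\<Sum>i<n. indicator (P i) x *\<^sub>R (g x * \<psi> x)) = g x * \<psi> x" for x and g :: "'a \<Rightarrow> complex"
  proof -
    have "(\<Sum>i<n. indicator (P i) x *\<^sub>R (g x * \<psi> x)) = (\<Sum>i<n. indicator (P i) x :: real) *\<^sub>R (g x * \<psi> x)"
      by (simp add: scaleR_sum_left)
    also have "(\<Sum>i<n. indicator (P i) x :: real) = indicator (\<Union>i<n. P i) x"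
      by (rule ind_sum)
    finally show ?thesis
      using \<psi>(2)[of x] by (auto simp: P(3) qball_def indicator_def)
  qed
  have nsum: "(\<Sum>i<n. LINT x|\<mu>. indicator (P i) x * norm (\<psi> x)) \<le> I"
  proof -
    have i: "integrable \<mu> (\<lambda>x. indicator (P i) x * norm (\<psi> x))" for i
      using integrable_mult_indicator[OF P(1) integrable_norm[OF \<psi>(1)], of i] by simp
    have "(\<Sum>i<n. LINT x|\<mu>. indicator (P i) x * norm (\<psi> x)) = (LINT x|\<mu>. (\<Sum>i<n. indicator (P i) x * norm (\<psi> x)))"
      by (rule Bochner_Integration.integral_sum[symmetric]) (rule i)
    also have "\<dots> \<le> I"
      unfolding I_def
    proof (rule integral_mono)
      show "(\<Sum>i<n. indicator (P i) x * norm (\<psi> x)) \<le> norm (\<psi> x)" for x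
      proof -
        have "(\<Sum>i<n. indicator (P i) x * norm (\<psi> x)) = indicator (\<Union>i<n. P i) x * norm (\<psi> x)"
          unfolding ind_sum[symmetric] by (rule sum_distrib_right[symmetric])
        also have "\<dots> \<le> 1 * norm (\<psi> x)"
          by (intro mult_right_mono indicator_le_1 norm_ge_zero)
        finally show ?thesis
          by simp
      qed
      show "integrable \<mu> (\<lambda>x. \<Sum>i<n. indicator (P i) x * norm (\<psi> x))"
        by (rule Bochner_Integration.integrable_sum) (rule i)
    qed (use \<psi> in auto)
    finally show ?thesis .
  qed
  have ei: "e1 * I \<le> e"
    using I assms by (simp add: e1_def divide_simps mult_left_mono)
  have ind_mult: "(LINT x|\<mu>. indicator (P i) x *\<^sub>R (v * \<psi> x)) = c i * v" for i v
  proof -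
    have "(LINT x|\<mu>. indicator (P i) x *\<^sub>R (v * \<psi> x)) = (LINT x|\<mu>. v * (indicator (P i) x *\<^sub>R \<psi> x))"
      by simp
    also have "\<dots> = v * c i"
      unfolding c_def by (rule integral_mult_right_zero)
    finally show ?thesis
      by (simp only: mult.commute)
  qed
  have ind_int: "integrable \<mu> (\<lambda>x. indicator (P i) x *\<^sub>R (v * \<psi> x))" for i v
    using \<psi> by (intro integrable_mult_indicator) auto
  have "T k \<psi> y - (\<Sum>i<n. c i * Q k (z i) y) =
      (\<Sum>i<n. LINT x|\<mu>. indicator (P i) x *\<^sub>R ((Q k x y - Q k (z i) y) * \<psi> x))" for y
  proof -
    have ii: "integrable \<mu> (\<lambda>x. indicator (P i) x *\<^sub>R (Q k x y * \<psi> x))" for i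
      using integrable_Q_mult[OF \<psi>(1)] by (intro integrable_mult_indicator) auto
    have "T k \<psi> y = (LINT x|\<mu>. (\<Sum>i<n. indicator (P i) x *\<^sub>R (Q k x y * \<psi> x)))"
      unfolding T_def split[of _ "\<lambda>x. Q k x y"] ..
    also have "\<dots> = (\<Sum>i<n. LINT x|\<mu>. indicator (P i) x *\<^sub>R (Q k x y * \<psi> x))"
      using ii by (intro Bochner_Integration.integral_sum) auto
    finally have "T k \<psi> y - (\<Sum>i<n. c i * Q k (z i) y) =
        (\<Sum>i<n. (LINT x|\<mu>. indicator (P i) x *\<^sub>R (Q k x y * \<psi> x)) -
          (LINT x|\<mu>. indicator (P i) x *\<^sub>R (Q k (z i) y * \<psi> x)))"
      by (simp only: sum_subtractf ind_mult)
    also have "\<dots> = (\<Sum>i<n. LINT x|\<mu>. indicator (P i) x *\<^sub>R ((Q k x y - Q k (z i) y) * \<psi> x))"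
      by (intro sum.cong refl, subst Bochner_Integration.integral_diff[symmetric])
        (auto simp: ii ind_int left_diff_distrib scaleR_right_diff_distrib simp del: mult_scaleR_left mult_scaleR_right)
    finally show ?thesis .
  qed
  then have "(\<lambda>y. T k \<psi> y - (\<Sum>i<n. c i * Q k (z i) y)) =
      (\<lambda>y. \<Sum>i<n. LINT x|\<mu>. indicator (P i) x *\<^sub>R ((Q k x y - Q k (z i) y) * \<psi> x))"
    by (rule ext)
  moreover have "tb \<beta> \<gamma> (\<lambda>y. \<Sum>i<n. LINT x|\<mu>. indicator (P i) x *\<^sub>R ((Q k x y - Q k (z i) y) * \<psi> x))
      (\<Sum>i<n. e1 * (LINT x|\<mu>. indicator (P i) x * norm (\<psi> x)))"
    using Qd \<psi>(1) e1 by (intro tb_sum tb_integral(1)) auto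
  moreover have "(\<Sum>i<n. e1 * (LINT x|\<mu>. indicator (P i) x * norm (\<psi> x))) \<le> e"
    using mult_left_mono[OF nsum, of e1] ei e1 by (simp add: sum_distrib_left)
  ultimately have 1: "tb \<beta> \<gamma> (\<lambda>y. T k \<psi> y - (\<Sum>i<n. c i * Q k (z i) y)) e"
    using tb_mono by auto
  have 2: "norm ((LINT x|\<mu>. \<psi> x * G x) - (\<Sum>i<n. c i * G (z i))) \<le> B * e"
    if [measurable]: "G \<in> borel_measurable \<mu>" and GA: "\<And>x. norm (G x) \<le> A" and "0 \<le> B"
      and GB: "\<And>x x' C. tb \<beta> \<gamma> (\<lambda>y. Q k x y - Q k x' y) C \<Longrightarrow> norm (G x - G x') \<le> B * C" for G A B
  proof -
    have "integrable \<mu> (\<lambda>x. G x * \<psi> x)"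
    proof (rule norm_integral_le(1))
      show "norm (G x * \<psi> x) \<le> A * norm (\<psi> x)" for x
        using GA[of x] by (simp add: norm_mult mult_right_mono)
    qed (use \<psi> in auto)
    then have ii: "integrable \<mu> (\<lambda>x. indicator (P i) x *\<^sub>R (G x * \<psi> x))" for i
      by (intro integrable_mult_indicator) auto
    have "(LINT x|\<mu>. \<psi> x * G x) = (LINT x|\<mu>. (\<Sum>i<n. indicator (P i) x *\<^sub>R (G x * \<psi> x)))"
      unfolding split by (simp add: mult.commute)
    also have "\<dots> = (\<Sum>i<n. LINT x|\<mu>. indicator (P i) x *\<^sub>R (G x * \<psi> x))"
      using ii by (intro Bochner_Integration.integral_sum) auto
    finally have "(LINT x|\<mu>. \<psi> x * G x) - (\<Sum>i<n. c i * G (z i)) =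
        (\<Sum>i<n. (LINT x|\<mu>. indicator (P i) x *\<^sub>R (G x * \<psi> x)) -
          (LINT x|\<mu>. indicator (P i) x *\<^sub>R (G (z i) * \<psi> x)))"
      by (simp only: sum_subtractf ind_mult)
    also have "\<dots> = (\<Sum>i<n. LINT x|\<mu>. indicator (P i) x *\<^sub>R ((G x - G (z i)) * \<psi> x))"
      by (intro sum.cong refl, subst Bochner_Integration.integral_diff[symmetric])
        (auto simp: ii ind_int left_diff_distrib scaleR_right_diff_distrib simp del: mult_scaleR_left mult_scaleR_right)
    also have "norm \<dots> \<le> (\<Sum>i<n. B * e1 * (LINT x|\<mu>. indicator (P i) x * norm (\<psi> x)))"
    proof (rule sum_norm_le)
      fix i assume i: "i \<in> {..<n}"
      have "norm (LINT x|\<mu>. indicator (P i) x *\<^sub>R ((G x - G (z i)) * \<psi> x)) \<le>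
          (LINT x|\<mu>. B * e1 * (indicator (P i) x * norm (\<psi> x)))"
      proof (rule norm_integral_le(2))
        show "integrable \<mu> (\<lambda>x. B * e1 * (indicator (P i) x * norm (\<psi> x)))"
          using integrable_mult_indicator[OF P(1) integrable_norm[OF \<psi>(1)], of i] by simp
        show "norm (indicator (P i) x *\<^sub>R ((G x - G (z i)) * \<psi> x)) \<le> B * e1 * (indicator (P i) x * norm (\<psi> x))" for x
        proof (cases "x \<in> P i")
          case True
          then show ?thesis
            using GB[OF Qd] i by (simp add: norm_mult mult_right_mono)
        qed simp
      qed measurable
      then show "norm (LINT x|\<mu>. indicator (P i) x *\<^sub>R ((G x - G (z i)) * \<psi> x)) \<le>
          B * e1 * (LINT x|\<mu>. indicator (P i) x * norm (\<psi> x))"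
        by simp
    qed
    also have "\<dots> = B * e1 * (\<Sum>i<n. LINT x|\<mu>. indicator (P i) x * norm (\<psi> x))"
      by (simp add: sum_distrib_left)
    also have "\<dots> \<le> B * e1 * I"
      using \<open>0 \<le> B\<close> e1 nsum by (intro mult_left_mono) auto
    also have "\<dots> \<le> B * e"
      using \<open>0 \<le> B\<close> ei mult_left_mono[OF ei, of B] by (simp add: mult.assoc)
    finally show ?thesis .
  qed
  show ?thesis
    using 1 2 by (intro exI[of _ n] exI[of _ c] exI[of _ z]) blast
qed

text \<open>\<phi> splits into its clamped part and a remainder of bounded support. The clamped part
  is small in the test norm, hence negligible after \<open>T k\<close> and, being small in L1 too,
  also against a \<open>G\<close> bounded by \<open>A\<close>; this is the source of the term
  \<open>A * e\<close>.\<close>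

lemma riemann_sum:
  assumes "0 < \<beta>" "\<beta> < \<eta>" "0 < \<gamma>" "\<gamma> < \<eta>" "0 < e" and \<phi>: "tb \<eta> \<eta> \<phi> b"
  shows "\<exists>(n::nat) c z. tb \<beta> \<gamma> (\<lambda>y. T k \<phi> y - (\<Sum>i<n. c i * Q k (z i) y)) e \<and>
    (\<forall>G A B. G \<in> borel_measurable \<mu> \<longrightarrow> (\<forall>x. norm (G x) \<le> A) \<longrightarrow> 0 \<le> B \<longrightarrow>
      (\<forall>x x' C. tb \<beta> \<gamma> (\<lambda>y. Q k x y - Q k x' y) C \<longrightarrow> norm (G x - G x') \<le> B * C) \<longrightarrow>
      norm ((LINT x|\<mu>. \<phi> x * G x) - (\<Sum>i<n. c i * G (z i))) \<le> (A + B) * e)"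
proof -
  have le: "\<beta> \<le> \<eta>" "\<gamma> \<le> \<eta>"
    using assms by auto
  obtain C where C: "0 < C" "\<And>\<psi> b. tb \<beta> \<gamma> \<psi> b \<Longrightarrow> tb \<beta> \<gamma> (T k \<psi>) (C * b)"
    by (rule T_bounded[OF assms(1) le(1) assms(3) le(2), of k]) (use that in auto)
  \<comment> \<open>The two entries control the clamped part after \<open>T k\<close>, by its
    operator bound \<open>C\<close>, and in L1, by \<open>tail_const \<gamma>\<close>.\<close>
  define e' where "e' = min (e / (2 * C)) (e / tail_const \<gamma>)"
  have tail_const: "0 < tail_const \<gamma>"
    using assms by (intro tail_const_pos)
  have e': "0 < e'" "C * e' \<le> e / 2" "e' * tail_const \<gamma> \<le> e"
    using assms C tail_const by (auto simp: e'_def min_def field_simps)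
  obtain t where t: "0 < t" "tb \<beta> \<gamma> (\<lambda>x. clamp t (\<phi> x)) e'"
    using tb_clamp[OF \<phi> assms(1-4) e'(1)] by blast
  obtain M where M: "\<And>x. M \<le> d x0 x \<Longrightarrow> norm (\<phi> x) \<le> t"
    using tb_small_outside[OF \<phi> \<eta>(1) t(1)] by blast
  define \<psi> where "\<psi> x = \<phi> x - clamp t (\<phi> x)" for x
  have i1: "integrable \<mu> \<phi>"
    using tb_integrable(1)[OF \<phi>] \<eta> by simp
  have i2: "integrable \<mu> (\<lambda>x. clamp t (\<phi> x))"
    using tb_integrable(1)[OF t(2)] assms by simp
  have i3: "integrable \<mu> \<psi>"
    unfolding \<psi>_def using i1 i2 by simp
  have \<psi>0: "\<psi> x = 0" if "M \<le> d x0 x" for x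
    using M[OF that] clamp_eq[OF t(1)] by (simp add: \<psi>_def)
  have "0 < e / 2"
    using assms by simp
  from riemann_sum_bounded_support[OF assms(1) le(1) assms(3) le(2) this i3 \<psi>0, of M k]
  obtain n :: nat and c z where n: "tb \<beta> \<gamma> (\<lambda>y. T k \<psi> y - (\<Sum>i<n. c i * Q k (z i) y)) (e / 2)"
    "\<forall>G A B. G \<in> borel_measurable \<mu> \<longrightarrow> (\<forall>x. norm (G x) \<le> A) \<longrightarrow> 0 \<le> B \<longrightarrow>
      (\<forall>x x' C. tb \<beta> \<gamma> (\<lambda>y. Q k x y - Q k x' y) C \<longrightarrow> norm (G x - G x') \<le> B * C) \<longrightarrow>
      norm ((LINT x|\<mu>. \<psi> x * G x) - (\<Sum>i<n. c i * G (z i))) \<le> B * (e / 2)"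
    by blast
  have Teq: "T k \<phi> y = T k \<psi> y + T k (\<lambda>x. clamp t (\<phi> x)) y" for y
  proof -
    have "T k \<psi> y = (LINT x|\<mu>. Q k x y * \<phi> x - Q k x y * clamp t (\<phi> x))"
      by (simp add: T_def \<psi>_def right_diff_distrib)
    also have "\<dots> = T k \<phi> y - T k (\<lambda>x. clamp t (\<phi> x)) y"
      unfolding T_def by (intro Bochner_Integration.integral_diff integrable_Q_mult i1 i2)
    finally show ?thesis
      by simp
  qed
  have "tb \<beta> \<gamma> (\<lambda>y. (T k \<psi> y - (\<Sum>i<n. c i * Q k (z i) y)) + T k (\<lambda>x. clamp t (\<phi> x)) y) (e / 2 + e / 2)"
    by (intro tb_add n(1) tb_mono[OF C(2)[OF t(2)] e'(2)])
  then have 1: "tb \<beta> \<gamma> (\<lambda>y. T k \<phi> y - (\<Sum>i<n. c i * Q k (z i) y)) e"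
    by (simp add: Teq algebra_simps)
  have 2: "norm ((LINT x|\<mu>. \<phi> x * G x) - (\<Sum>i<n. c i * G (z i))) \<le> (A + B) * e"
    if [measurable]: "G \<in> borel_measurable \<mu>" and GA: "\<forall>x. norm (G x) \<le> A" and "0 \<le> B"
      and GB: "\<forall>x x' C. tb \<beta> \<gamma> (\<lambda>y. Q k x y - Q k x' y) C \<longrightarrow> norm (G x - G x') \<le> B * C" for G A B
  proof -
    have A: "0 \<le> A"
      using GA norm_ge_zero order_trans by blast
    have g: "norm (f x * G x) \<le> A * norm (f x)" for f :: "'a \<Rightarrow> complex" and x
      using GA by (simp add: norm_mult mult.commute mult_right_mono)
    have ii: "integrable \<mu> (\<lambda>x. f x * G x)" if "integrable \<mu> f" for f
      using that by (intro norm_integral_le(1)[OF _ _ g]) auto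
    have "norm (LINT x|\<mu>. clamp t (\<phi> x) * G x) \<le> (LINT x|\<mu>. A * norm (clamp t (\<phi> x)))"
      using i2 by (intro norm_integral_le(2)[OF _ _ g]) auto
    also have "\<dots> \<le> A * (e' * tail_const \<gamma>)"
      using tb_integrable(2)[OF t(2) assms(1,3)] A by (simp add: mult_left_mono)
    also have "\<dots> \<le> A * e"
      using A e' by (intro mult_left_mono) auto
    finally have a: "norm (LINT x|\<mu>. clamp t (\<phi> x) * G x) \<le> A * e" .
    have b: "norm ((LINT x|\<mu>. \<psi> x * G x) - (\<Sum>i<n. c i * G (z i))) \<le> B * (e / 2)"
      using n(2) \<open>G \<in> borel_measurable \<mu>\<close> GA GB \<open>0 \<le> B\<close> by blast
    have "(LINT x|\<mu>. \<phi> x * G x) = (LINT x|\<mu>. \<psi> x * G x + clamp t (\<phi> x) * G x)"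
      by (simp add: \<psi>_def algebra_simps)
    also have "\<dots> = (LINT x|\<mu>. \<psi> x * G x) + (LINT x|\<mu>. clamp t (\<phi> x) * G x)"
      by (intro Bochner_Integration.integral_add ii i2 i3)
    finally have "(LINT x|\<mu>. \<phi> x * G x) - (\<Sum>i<n. c i * G (z i)) =
        ((LINT x|\<mu>. \<psi> x * G x) - (\<Sum>i<n. c i * G (z i))) + (LINT x|\<mu>. clamp t (\<phi> x) * G x)"
      by simp
    also have "norm \<dots> \<le> B * (e / 2) + A * e"
      by (intro order_trans[OF norm_triangle_ineq] add_mono a b)
    also have "\<dots> \<le> (A + B) * e"
      using \<open>0 \<le> B\<close> assms by (simp add: algebra_simps)
    finally show ?thesis .
  qed
  show ?thesis
    by (intro exI[of _ n] exI[of _ c] exI[of _ z] conjI allI impI 1 2) blast+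
qed

end

section \<open>The reproducing formula\<close>

text \<open>Pairing \<open>j\<close> with \<open>- j\<close> turns symmetric partial sums over the
  integers into partial sums of an ordinary series.\<close>

lemma sum_symmetric_int:
  fixes f :: "int \<Rightarrow> 'b::comm_monoid_add"
  shows "(\<Sum>k = - int n..int n. f k) = (\<Sum>j\<le>n. if j = 0 then f 0 else f (int j) + f (- int j))"
proof (induction n)
  case (Suc n)
  have "{- int (Suc n)..int (Suc n)} = insert (int (Suc n)) (insert (- int (Suc n)) {- int n..int n})"
    by auto
  then have "(\<Sum>k = - int (Suc n)..int (Suc n). f k) =
      f (int (Suc n)) + (f (- int (Suc n)) + (\<Sum>k = - int n..int n. f k))"
    by simp
  then show ?case
    using Suc by (simp add: ac_simps)
qed simp

lemma scaleR_indicator: "indicator A x *\<^sub>R (c :: complex) = indicator A x * c"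
  by (simp add: indicator_def)

lemma complex_of_real_indicator: "(\<lambda>x. complex_of_real (indicator A x)) = indicator A"
  by (auto simp: indicator_def)

lemma L2_fun_add:
  assumes "f \<in> L2_fun M" "g \<in> L2_fun M" shows "(\<lambda>x. f x + g x) \<in> L2_fun M"
proof -
  have [measurable]: "f \<in> borel_measurable M" "g \<in> borel_measurable M"
    using assms by (auto simp: L2_fun_def)
  have i: "integrable M (\<lambda>x. 2 * (norm (f x))\<^sup>2 + 2 * (norm (g x))\<^sup>2)"
    using assms by (auto simp: L2_fun_def)
  have "(norm (f x + g x))\<^sup>2 \<le> 2 * (norm (f x))\<^sup>2 + 2 * (norm (g x))\<^sup>2" for x
  proof -
    have "(norm (f x + g x))\<^sup>2 \<le> (norm (f x) + norm (g x))\<^sup>2"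
      by (intro power_mono norm_triangle_ineq) auto
    also have "\<dots> \<le> 2 * (norm (f x))\<^sup>2 + 2 * (norm (g x))\<^sup>2"
      using sum_squares_bound[of "norm (f x)" "norm (g x)"] by (simp add: power2_sum)
    finally show ?thesis .
  qed
  then have "integrable M (\<lambda>x. (norm (f x + g x))\<^sup>2)"
    by (intro Bochner_Integration.integrable_bound[OF i]) auto
  then show ?thesis
    by (simp add: L2_fun_def)
qed

lemma L2_fun_sum: "(\<And>k. k \<in> I \<Longrightarrow> f k \<in> L2_fun M) \<Longrightarrow> (\<lambda>x. \<Sum>k\<in>I. f k x) \<in> L2_fun M"
  by (induction I rule: infinite_finite_induct) (simp_all add: L2_fun_add, simp_all add: L2_fun_def)

lemma L2_fun_uminus: "f \<in> L2_fun M \<Longrightarrow> (\<lambda>x. - f x) \<in> L2_fun M"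
  by (auto simp: L2_fun_def)

text \<open>A weak form of the Cauchy-Schwarz inequality, obtained from 2ab \<le> t a^2 + b^2 / t.
  For fixed \<open>f\<close> it gives a bound linear in the norm of \<open>u\<close>, which is what
  passing to the limit requires.\<close>

lemma L2_pairing_le:
  assumes "f \<in> L2_fun M" "u \<in> L2_fun M"
  shows "norm (LINT x|M. f x * u x) \<le> ((LINT x|M. (norm (f x))\<^sup>2) + 1) / 2 * L2_nrm M u"
proof (rule field_le_epsilon)
  fix e :: real assume e: "0 < e"
  have [measurable]: "f \<in> borel_measurable M" "u \<in> borel_measurable M"
    using assms by (auto simp: L2_fun_def)
  define \<Phi> where "\<Phi> = (LINT x|M. (norm (f x))\<^sup>2)"
  define a where "a = L2_nrm M u"
  have \<Phi>: "0 \<le> \<Phi>"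
    by (simp add: \<Phi>_def)
  have a: "0 \<le> a" "a\<^sup>2 = (LINT x|M. (norm (u x))\<^sup>2)"
    by (simp_all add: a_def L2_nrm_def)
  \<comment> \<open>Slightly more than the norm \<open>a\<close>, so that it is positive even for
    \<open>a = 0\<close>; the excess contributes exactly \<open>e\<close>.\<close>
  define t where "t = a + 2 * e / (\<Phi> + 1)"
  have t: "0 < t" "a \<le> t"
    using a e \<Phi> by (auto simp: t_def intro!: add_nonneg_pos)
  have i: "integrable M (\<lambda>x. (t * (norm (f x))\<^sup>2 + (norm (u x))\<^sup>2 / t) / 2)"
    using assms by (auto simp: L2_fun_def)
  have "norm (f x * u x) \<le> (t * (norm (f x))\<^sup>2 + (norm (u x))\<^sup>2 / t) / 2" for x
    using sum_squares_bound[of "t * norm (f x)" "norm (u x)"] t(1)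
    by (simp add: norm_mult power2_eq_square field_simps)
  then have "norm (LINT x|M. f x * u x) \<le> (LINT x|M. (t * (norm (f x))\<^sup>2 + (norm (u x))\<^sup>2 / t) / 2)"
    by (intro norm_integral_le(2)[OF _ i]) auto
  also have "\<dots> = (t * \<Phi> + a\<^sup>2 / t) / 2"
    using assms by (simp add: L2_fun_def \<Phi>_def a(2))
  also have "a\<^sup>2 / t \<le> t"
    using mult_mono[OF t(2) t(2)] a(1) t(1) by (simp add: power2_eq_square[of a] divide_le_eq)
  finally have "norm (LINT x|M. f x * u x) \<le> t * (\<Phi> + 1) / 2"
    by (simp add: algebra_simps)
  also have "\<dots> = (\<Phi> + 1) / 2 * a + e"
    using \<Phi> by (simp add: t_def field_simps)
  finally show "norm (LINT x|M. f x * u x) \<le> ((LINT x|M. (norm (f x))\<^sup>2) + 1) / 2 * L2_nrm M u + e"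
    by (simp add: \<Phi>_def a_def)
qed

locale reproducing_kernels = decaying_kernels +
  fixes \<beta> \<gamma> :: real
  assumes \<beta>: "0 < \<beta>" "\<beta> < \<eta>" and \<gamma>: "0 < \<gamma>" "\<gamma> < \<eta>"
    and Q_L2: "L2_bounded_kernel \<mu> (Q k)"
    and Q_identity: "sums_to_identity_L2 \<mu> Q"
begin

abbreviation "tests \<equiv> test_completion d A0 \<mu> x0 \<eta> \<beta> \<gamma>"
abbreviation "smooth \<equiv> test_space0 d A0 \<mu> x0 \<eta> \<eta>"

lemma exponents_le: "\<beta> \<le> \<eta>" "\<gamma> \<le> \<eta>"
  using \<beta> \<gamma> by auto

lemma test_space0_add:
  assumes "f \<in> test_space0 d A0 \<mu> x0 b c" "g \<in> test_space0 d A0 \<mu> x0 b c"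
  shows "(\<lambda>x. f x + g x) \<in> test_space0 d A0 \<mu> x0 b c"
  using assms has_bochner_integral_add[of \<mu> f 0 g 0] unfolding test_space0_iff by (auto intro: tb_add)

lemma test_space0_cmult:
  assumes "f \<in> test_space0 d A0 \<mu> x0 b c"
  shows "(\<lambda>x. a * f x) \<in> test_space0 d A0 \<mu> x0 b c"
  using assms has_bochner_integral_mult_right[of a \<mu> f 0] unfolding test_space0_iff by (auto intro: tb_cmult)

lemma test_space0_zero: "(\<lambda>x. 0) \<in> test_space0 d A0 \<mu> x0 b c"
  unfolding test_space0_iff using tb_zero by (auto simp: has_bochner_integral_zero)

lemmas tests_iff = test_completion_iff[OF exponents_le]

lemma tests_test_space0: "f \<in> tests \<Longrightarrow> f \<in> test_space0 d A0 \<mu> x0 \<beta> \<gamma>"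
  by (simp add: tests_iff)

lemma tests_tb: "f \<in> tests \<Longrightarrow> \<exists>C. tb \<beta> \<gamma> f C"
  using tests_test_space0 by (simp add: test_space0_iff)

lemma tests_integral: "f \<in> tests \<Longrightarrow> integral\<^sup>L \<mu> f = 0" "f \<in> tests \<Longrightarrow> integrable \<mu> f"
  using tests_test_space0 by (simp_all add: test_space0_iff has_bochner_integral_iff)

lemma smooth_tests: "f \<in> smooth \<Longrightarrow> f \<in> tests"
  unfolding tests_iff
proof (intro conjI allI impI)
  assume f: "f \<in> smooth"
  then show "f \<in> test_space0 d A0 \<mu> x0 \<beta> \<gamma>"
    using exponents_le by (auto simp: test_space0_iff intro: tb_exponents)
  fix e :: real assume "0 < e"
  have "tb \<beta> \<gamma> (\<lambda>x. f x - f x) e"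
    using tb_mono[OF tb_zero, of e] \<open>0 < e\<close> by simp
  then show "\<exists>\<phi>\<in>smooth. tb \<beta> \<gamma> (\<lambda>x. \<phi> x - f x) e"
    using f by blast
qed

lemma tests_add:
  assumes "f \<in> tests" "g \<in> tests"
  shows "(\<lambda>x. f x + g x) \<in> tests"
  unfolding tests_iff
proof (intro conjI allI impI)
  show "(\<lambda>x. f x + g x) \<in> test_space0 d A0 \<mu> x0 \<beta> \<gamma>"
    using assms by (intro test_space0_add tests_test_space0)
  fix e :: real assume "0 < e"
  then have "0 < e / 2"
    by simp
  then obtain u v where uv: "u \<in> smooth" "tb \<beta> \<gamma> (\<lambda>x. u x - f x) (e / 2)"
      "v \<in> smooth" "tb \<beta> \<gamma> (\<lambda>x. v x - g x) (e / 2)"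
    using assms unfolding tests_iff by blast
  have "tb \<beta> \<gamma> (\<lambda>x. (u x - f x) + (v x - g x)) (e / 2 + e / 2)"
    by (intro tb_add uv)
  then have "tb \<beta> \<gamma> (\<lambda>x. (u x + v x) - (f x + g x)) e"
    by (simp add: algebra_simps)
  then show "\<exists>\<phi>\<in>smooth. tb \<beta> \<gamma> (\<lambda>x. \<phi> x - (f x + g x)) e"
    by (rule bexI[where x = "\<lambda>x. u x + v x"]) (rule test_space0_add[OF uv(1,3)])
qed

lemma tests_cmult:
  assumes "f \<in> tests"
  shows "(\<lambda>x. a * f x) \<in> tests"
  unfolding tests_iff
proof (intro conjI allI impI)
  show "(\<lambda>x. a * f x) \<in> test_space0 d A0 \<mu> x0 \<beta> \<gamma>"
    using assms by (intro test_space0_cmult tests_test_space0)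
  fix e :: real assume "0 < e"
  then have "0 < e / (norm a + 1)"
    by (simp add: add_nonneg_pos)
  then obtain u where u: "u \<in> smooth" "tb \<beta> \<gamma> (\<lambda>x. u x - f x) (e / (norm a + 1))"
    using assms unfolding tests_iff by blast
  have "norm a * (e / (norm a + 1)) \<le> e"
  proof -
    have "norm a / (norm a + 1) \<le> 1"
      by (simp add: divide_le_eq_1_pos add_nonneg_pos)
    from mult_right_mono[OF this, of e] show ?thesis
      using \<open>0 < e\<close> by simp
  qed
  from tb_mono[OF tb_cmult[OF u(2), of a] this] have "tb \<beta> \<gamma> (\<lambda>x. a * u x - a * f x) e"
    by (simp add: right_diff_distrib)
  then show "\<exists>\<phi>\<in>smooth. tb \<beta> \<gamma> (\<lambda>x. \<phi> x - a * f x) e"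
    by (rule bexI[where x = "\<lambda>x. a * u x"]) (rule test_space0_cmult[OF u(1)])
qed

lemma tests_diff: "f \<in> tests \<Longrightarrow> g \<in> tests \<Longrightarrow> (\<lambda>x. f x - g x) \<in> tests"
  using tests_add[OF _ tests_cmult[of g "-1"], of f] by simp

lemma tests_sum: "(\<And>i. i \<in> I \<Longrightarrow> f i \<in> tests) \<Longrightarrow> (\<lambda>x. \<Sum>i\<in>I. f i x) \<in> tests"
  by (induction I rule: infinite_finite_induct) (auto intro: tests_add smooth_tests test_space0_zero)

lemma row_tests: "Q k x \<in> tests"
  by (rule smooth_tests[OF row_test_space0])

text \<open>Continuity is measured against \<open>tb\<close> instead of the infimum norm, and
  nothing is prescribed outside \<open>tests\<close>, so that an integral against a fixed function
  qualifies without being restricted.\<close>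

definition functional :: "(('a \<Rightarrow> complex) \<Rightarrow> complex) \<Rightarrow> real \<Rightarrow> bool" where
  "functional L B \<longleftrightarrow> 0 \<le> B \<and> (\<forall>f\<in>tests. \<forall>g\<in>tests. L (\<lambda>x. f x + g x) = L f + L g)
     \<and> (\<forall>f\<in>tests. \<forall>c. L (\<lambda>x. c * f x) = c * L f)
     \<and> (\<forall>f\<in>tests. \<forall>C. tb \<beta> \<gamma> f C \<longrightarrow> norm (L f) \<le> B * C)"

lemma functionalD:
  assumes "functional L B"
  shows "0 \<le> B" "f \<in> tests \<Longrightarrow> g \<in> tests \<Longrightarrow> L (\<lambda>x. f x + g x) = L f + L g"
    "f \<in> tests \<Longrightarrow> L (\<lambda>x. c * f x) = c * L f"
    "f \<in> tests \<Longrightarrow> tb \<beta> \<gamma> f C \<Longrightarrow> norm (L f) \<le> B * C"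
  using assms by (auto simp: functional_def)

lemma functional_diff:
  assumes "functional L B" "f \<in> tests" "g \<in> tests"
  shows "L (\<lambda>x. f x - g x) = L f - L g"
  using functionalD(2)[OF assms(1,2) tests_cmult[OF assms(3), of "-1"]]
    functionalD(3)[OF assms(1,3), of "-1"] by simp

lemma functional_sum:
  assumes L: "functional L B" and "finite I" "\<And>i. i \<in> I \<Longrightarrow> f i \<in> tests"
  shows "L (\<lambda>x. \<Sum>i\<in>I. f i x) = (\<Sum>i\<in>I. L (f i))"
  using assms(2,3)
proof (induction I)
  case empty
  have "L (\<lambda>x. 0 * (0::complex)) = 0 * L (\<lambda>x. 0)"
    by (rule functionalD(3)[OF L smooth_tests[OF test_space0_zero]])
  then show ?case
    by simp
next
  case (insert i I)
  then show ?case
    by (simp add: functionalD(2)[OF L] tests_sum)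
qed

text \<open>The rows depend Hoelder continuously on \<open>x\<close> in the test norm, locally
  uniformly, and \<open>L\<close> preserves this. It makes \<open>x \<mapsto> L (Q k x)\<close>
  measurable.\<close>

lemma functional_row_continuous:
  assumes L: "functional L B"
  shows "quasi_continuous (\<lambda>x. L (Q k x))"
proof (rule quasi_continuous_hoelder[OF \<eta>(1)])
  fix x
  obtain C where "\<And>i v x'. d x0 v \<le> d x0 x \<Longrightarrow> R k \<le> R i \<Longrightarrow> d v x' \<le> R i \<Longrightarrow>
      tb \<beta> \<gamma> (\<lambda>y. Q i v y - Q i x' y) (C * (d v x' / R i) powr \<eta> * R i powr \<gamma>)"
    by (rule rows_tb[OF \<beta>(1) exponents_le(1) \<gamma>(1) exponents_le(2) R_pos[of k], of "d x0 x"]) (use that in auto)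
  note C = this[OF order_refl order_refl]
  have "norm (L (Q k x) - L (Q k x')) \<le> B * C * R k powr \<gamma> / R k powr \<eta> * d x x' powr \<eta>"
    if "d x x' < R k" for x'
  proof -
    have "norm (L (\<lambda>y. Q k x y - Q k x' y)) \<le> B * (C * (d x x' / R k) powr \<eta> * R k powr \<gamma>)"
      using that by (intro functionalD(4)[OF L] tests_diff row_tests C) simp
    then show ?thesis
      by (simp add: functional_diff[OF L row_tests row_tests] powr_divide mult_ac)
  qed
  then show "\<exists>c r. 0 < r \<and> (\<forall>y. d x y < r \<longrightarrow> norm (L (Q k x) - L (Q k y)) \<le> c * d x y powr \<eta>)"
    using R_pos[of k] by blast
qed

lemma smooth_riemann_sum:
  assumes "\<phi> \<in> smooth" "0 < e"
  obtains n :: nat and c z where "tb \<beta> \<gamma> (\<lambda>y. T k \<phi> y - (\<Sum>i<n. c i * Q k (z i) y)) e"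
    "\<And>G A B. G \<in> borel_measurable \<mu> \<Longrightarrow> (\<forall>x. norm (G x) \<le> A) \<Longrightarrow> 0 \<le> B \<Longrightarrow>
      (\<forall>x x' C. tb \<beta> \<gamma> (\<lambda>y. Q k x y - Q k x' y) C \<longrightarrow> norm (G x - G x') \<le> B * C) \<Longrightarrow>
      norm ((LINT x|\<mu>. \<phi> x * G x) - (\<Sum>i<n. c i * G (z i))) \<le> (A + B) * e"
    "(\<lambda>y. \<Sum>i<n. c i * Q k (z i) y) \<in> smooth"
proof -
  obtain b where b: "tb \<eta> \<eta> \<phi> b"
    using assms by (auto simp: test_space0_iff)
  have "(\<lambda>y. \<Sum>i<n. c i * Q k (z i) y) \<in> smooth" for n :: nat and c z
    by (induction n) (simp_all add: test_space0_zero test_space0_add test_space0_cmult row_test_space0)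
  then show ?thesis
    using riemann_sum[OF \<beta> \<gamma> assms(2) b, of k] that by blast
qed

lemma T_tb_smooth:
  assumes "\<phi> \<in> smooth"
  shows "\<exists>C. tb \<beta> \<gamma> (T k \<phi>) C"
proof -
  obtain b where b: "tb \<eta> \<eta> \<phi> b"
    using assms by (auto simp: test_space0_iff)
  obtain C where "\<And>\<psi> b. tb \<beta> \<gamma> \<psi> b \<Longrightarrow> tb \<beta> \<gamma> (T k \<psi>) (C * b)"
    by (rule T_bounded[OF \<beta>(1) exponents_le(1) \<gamma>(1) exponents_le(2), of k]) (use that in auto)
  from this[OF tb_exponents[OF b exponents_le]] show ?thesis
    by blast
qed

lemma small_imp_zero:
  fixes v :: complex
  assumes "\<And>e. 0 < e \<Longrightarrow> norm v \<le> K * e"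
  shows "v = 0"
proof -
  have "norm v \<le> 0"
  proof (rule field_le_epsilon)
    fix e :: real assume e: "0 < e"
    have "norm v \<le> K * (e / (\<bar>K\<bar> + 1))"
      using e by (intro assms) (simp add: add_nonneg_pos)
    also have "\<dots> \<le> (\<bar>K\<bar> + 1) * (e / (\<bar>K\<bar> + 1))"
      using e by (intro mult_right_mono) (auto simp: add_nonneg_pos less_imp_le)
    finally show "norm v \<le> 0 + e"
      using add_nonneg_pos[of "\<bar>K\<bar>" 1] by simp
  qed
  then show ?thesis
    by simp
qed

text \<open>Riemann sums are finite combinations of rows, hence smooth with mean zero. Their
  convergence gives at once the vanishing mean of \<open>T k \<phi>\<close>, without exchanging
  integrals, and the approximability that the completion demands.\<close>

lemma T_tests:
  assumes "\<phi> \<in> smooth"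
  shows "T k \<phi> \<in> tests"
  unfolding tests_iff
proof (intro conjI allI impI)
  obtain C where C: "tb \<beta> \<gamma> (T k \<phi>) C"
    using T_tb_smooth[OF assms] by blast
  note int = tb_integrable(1)[OF C \<beta>(1) \<gamma>(1)]
  have "integral\<^sup>L \<mu> (T k \<phi>) = 0"
  proof (rule small_imp_zero)
    fix e :: real assume "0 < e"
    then obtain n :: nat and c z where n: "tb \<beta> \<gamma> (\<lambda>y. T k \<phi> y - (\<Sum>i<n. c i * Q k (z i) y)) e"
      "(\<lambda>y. \<Sum>i<n. c i * Q k (z i) y) \<in> smooth"
      by (rule smooth_riemann_sum[OF assms, where k = k])
    have "integral\<^sup>L \<mu> (T k \<phi>) = integral\<^sup>L \<mu> (T k \<phi>) - (LINT y|\<mu>. (\<Sum>i<n. c i * Q k (z i) y))"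
      unfolding tests_integral(1)[OF smooth_tests[OF n(2)]] by simp
    also have "\<dots> = (LINT y|\<mu>. T k \<phi> y - (\<Sum>i<n. c i * Q k (z i) y))"
      by (rule Bochner_Integration.integral_diff[symmetric, OF int tests_integral(2)[OF smooth_tests[OF n(2)]]])
    also have "norm \<dots> \<le> e * tail_const \<gamma>"
      by (rule order_trans[OF integral_norm_bound tb_integrable(2)[OF n(1) \<beta>(1) \<gamma>(1)]])
    finally show "norm (integral\<^sup>L \<mu> (T k \<phi>)) \<le> tail_const \<gamma> * e"
      by (simp add: mult.commute)
  qed
  then show "T k \<phi> \<in> test_space0 d A0 \<mu> x0 \<beta> \<gamma>"
    unfolding test_space0_iff using C int by (auto simp: has_bochner_integral_iff)
  fix e :: real assume "0 < e"
  then obtain n :: nat and c z where n: "tb \<beta> \<gamma> (\<lambda>y. T k \<phi> y - (\<Sum>i<n. c i * Q k (z i) y)) e"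
    "(\<lambda>y. \<Sum>i<n. c i * Q k (z i) y) \<in> smooth"
    by (rule smooth_riemann_sum[OF assms, where k = k])
  show "\<exists>\<psi>\<in>smooth. tb \<beta> \<gamma> (\<lambda>x. \<psi> x - T k \<phi> x) e"
    by (rule bexI[where x = "\<lambda>y. \<Sum>i<n. c i * Q k (z i) y"]) (rule tb_minus_commute[OF n(1)], rule n(2))
qed

text \<open>Moves \<open>L\<close> under the integral that defines \<open>T k \<phi>\<close>. For
  finite sums this is linearity, and the common nodes make both sides close to the same finite
  sum.\<close>

lemma functional_T:
  assumes L: "functional L B" and A: "\<And>x. norm (L (Q k x)) \<le> A" and \<phi>: "\<phi> \<in> smooth"
  shows "L (T k \<phi>) = (LINT x|\<mu>. \<phi> x * L (Q k x))"
proof -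
  have "L (T k \<phi>) - (LINT x|\<mu>. \<phi> x * L (Q k x)) = 0"
  proof (rule small_imp_zero)
    fix e :: real assume "0 < e"
    then obtain n :: nat and c z where n: "tb \<beta> \<gamma> (\<lambda>y. T k \<phi> y - (\<Sum>i<n. c i * Q k (z i) y)) e"
      "\<And>G A B. G \<in> borel_measurable \<mu> \<Longrightarrow> (\<forall>x. norm (G x) \<le> A) \<Longrightarrow> 0 \<le> B \<Longrightarrow>
        (\<forall>x x' C. tb \<beta> \<gamma> (\<lambda>y. Q k x y - Q k x' y) C \<longrightarrow> norm (G x - G x') \<le> B * C) \<Longrightarrow>
        norm ((LINT x|\<mu>. \<phi> x * G x) - (\<Sum>i<n. c i * G (z i))) \<le> (A + B) * e"
      "(\<lambda>y. \<Sum>i<n. c i * Q k (z i) y) \<in> smooth"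
      by (rule smooth_riemann_sum[OF \<phi>, where k = k]) (use that in auto)
    have 1: "norm ((LINT x|\<mu>. \<phi> x * L (Q k x)) - (\<Sum>i<n. c i * L (Q k (z i)))) \<le> (A + B) * e"
    proof (rule n(2))
      show "\<forall>x x' C. tb \<beta> \<gamma> (\<lambda>y. Q k x y - Q k x' y) C \<longrightarrow> norm (L (Q k x) - L (Q k x')) \<le> B * C"
      proof (intro allI impI)
        fix x x' C assume "tb \<beta> \<gamma> (\<lambda>y. Q k x y - Q k x' y) C"
        from functionalD(4)[OF L tests_diff[OF row_tests row_tests] this]
        show "norm (L (Q k x) - L (Q k x')) \<le> B * C"
          by (simp add: functional_diff[OF L row_tests row_tests])
      qed
    qed (use A functionalD(1)[OF L] quasi_continuous_measurable[OF functional_row_continuous[OF L]] in auto)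
    have "L (\<lambda>y. \<Sum>i<n. c i * Q k (z i) y) = (\<Sum>i<n. c i * L (Q k (z i)))"
      by (simp add: functional_sum[OF L] functionalD(3)[OF L] tests_cmult row_tests)
    then have "L (T k \<phi>) - (\<Sum>i<n. c i * L (Q k (z i))) = L (\<lambda>y. T k \<phi> y - (\<Sum>i<n. c i * Q k (z i) y))"
      using functional_diff[OF L T_tests[OF \<phi>] smooth_tests[OF n(3)]] by simp
    also have "norm \<dots> \<le> B * e"
      by (rule functionalD(4)[OF L tests_diff[OF T_tests[OF \<phi>] smooth_tests[OF n(3)]] n(1)])
    finally have 2: "norm (L (T k \<phi>) - (\<Sum>i<n. c i * L (Q k (z i)))) \<le> B * e" .
    show "norm (L (T k \<phi>) - (LINT x|\<mu>. \<phi> x * L (Q k x))) \<le> (A + 2 * B) * e"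
      using norm_triangle_ineq4[of "L (T k \<phi>) - (\<Sum>i<n. c i * L (Q k (z i)))"
          "(LINT x|\<mu>. \<phi> x * L (Q k x)) - (\<Sum>i<n. c i * L (Q k (z i)))"] 1 2
      by (simp add: algebra_simps)
  qed
  then show ?thesis
    by simp
qed

section \<open>Identification of the sum by testing against balls\<close>

lemma ball_functional: "functional (\<lambda>f. LINT x|\<mu>. indicator (qball d w r) x * f x) (tail_const \<gamma>)"
proof -
  have i: "integrable \<mu> (\<lambda>x. indicator (qball d w r) x * f x)" if "f \<in> tests" for f
    using integrable_mult_indicator[OF sets_qball tests_integral(2)[OF that], of w r]
    by (simp add: scaleR_indicator)
  show ?thesis
    unfolding functional_def
  proof (intro conjI ballI allI impI)
    show "0 \<le> tail_const \<gamma>"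
      using tail_const_pos[OF \<gamma>(1)] by simp
    fix f assume f: "f \<in> tests"
    show "(LINT x|\<mu>. indicator (qball d w r) x * (f x + g x)) =
        (LINT x|\<mu>. indicator (qball d w r) x * f x) + (LINT x|\<mu>. indicator (qball d w r) x * g x)"
      if "g \<in> tests" for g
      using i[OF f] i[OF that] by (simp add: distrib_left)
    show "(LINT x|\<mu>. indicator (qball d w r) x * (c * f x)) = c * (LINT x|\<mu>. indicator (qball d w r) x * f x)" for c
      by (simp add: mult.left_commute)
    fix C assume C: "tb \<beta> \<gamma> f C"
    have "norm (LINT x|\<mu>. indicator (qball d w r) x * f x) \<le> (LINT x|\<mu>. norm (f x))"
      using i[OF f] tests_integral(2)[OF f]
      by (intro norm_integral_le(2)) (auto simp: norm_mult indicator_def)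
    also have "\<dots> \<le> C * tail_const \<gamma>"
      by (rule tb_integrable(2)[OF C \<beta>(1) \<gamma>(1)])
    finally show "norm (LINT x|\<mu>. indicator (qball d w r) x * f x) \<le> tail_const \<gamma> * C"
      by (simp add: mult.commute)
  qed
qed

lemma L2_fun_bounded_integrable:
  assumes "integrable \<mu> f" "\<And>x. norm (f x) \<le> K"
  shows "f \<in> L2_fun \<mu>"
proof -
  have "integrable \<mu> (\<lambda>x. (norm (f x))\<^sup>2)"
  proof (rule Bochner_Integration.integrable_bound)
    show "integrable \<mu> (\<lambda>x. K * norm (f x))"
      using assms(1) by simp
    show "AE x in \<mu>. norm ((norm (f x))\<^sup>2) \<le> norm (K * norm (f x))"
      using assms(2) by (intro AE_I2) (auto simp: power2_eq_square abs_mult intro!: mult_right_mono order_trans[OF assms(2)])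
  qed (use assms in auto)
  then show ?thesis
    using assms(1) by (simp add: L2_fun_def)
qed

text \<open>The L2 identity is applied to the indicator of the ball, and \<phi>, which lies in L2
  because it is bounded and integrable, is only paired with the result. So the transposed series is
  identified weakly, from the identity for the original operators.\<close>

lemma ball_pairing_limit:
  fixes w :: 'a and r :: real
  defines "f \<equiv> indicator (qball d w r)"
  assumes \<phi>: "\<phi> \<in> smooth"
  shows "(\<lambda>n. \<Sum>k = - int n..int n. LINT x|\<mu>. \<phi> x * (LINT y|\<mu>. f y * Q k x y)) \<longlonglongrightarrow> (LINT x|\<mu>. f x * \<phi> x)"
proof -
  have f: "f \<in> L2_fun \<mu>"
  proof (rule L2_fun_bounded_integrable)
    have "integrable \<mu> (indicator (qball d w r) :: 'a \<Rightarrow> real)"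
      using emeasure_qball_less_top by simp
    then have "integrable \<mu> (\<lambda>x. complex_of_real (indicator (qball d w r) x))"
      by (rule integrable_of_real)
    then show "integrable \<mu> f"
      by (simp only: f_def complex_of_real_indicator)
    show "norm (f x) \<le> 1" for x
      by (simp add: f_def indicator_def)
  qed
  obtain b where b: "tb \<eta> \<eta> \<phi> b"
    using \<phi> by (auto simp: test_space0_iff)
  have i\<phi>: "integrable \<mu> \<phi>"
    by (rule tb_integrable(1)[OF b \<eta>(1) \<eta>(1)])
  have "norm (\<phi> x) \<le> b * (1 / V x0 1)" for x
  proof -
    have "pd \<eta> x \<le> 1 / V x0 1"
      unfolding pw_def using \<eta>
      by (intro frac_le V_mono V_pos) (auto intro!: powr_le1 simp: divide_le_eq_1_pos)
    then show ?thesis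
      using tb_size[OF b, of x] tb_nonneg[OF b] by (meson mult_left_mono order_trans)
  qed
  then have \<phi>2: "\<phi> \<in> L2_fun \<mu>"
    by (rule L2_fun_bounded_integrable[OF i\<phi>])
  define u where "u n x = (\<Sum>k = - int n..int n. kernel_op \<mu> (Q k) f x) - f x" for n :: nat and x
  have K: "kernel_op \<mu> (Q k) f \<in> L2_fun \<mu>" for k
    using Q_L2[of k] f unfolding L2_bounded_kernel_def by blast
  have u: "u n \<in> L2_fun \<mu>" for n
    unfolding u_def using L2_fun_add[OF L2_fun_sum[of "{- int n..int n}" "\<lambda>k. kernel_op \<mu> (Q k) f"] L2_fun_uminus[OF f]] K
    by simp
  \<comment> \<open>The two-parameter convergence is restricted to the diagonal, where the partial
    sums are symmetric.\<close>
  have "filterlim (\<lambda>n. (n, n)) (sequentially \<times>\<^sub>F sequentially) sequentially"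
    by (intro filterlim_Pair filterlim_ident)
  from filterlim_compose[OF Q_identity[unfolded sums_to_identity_L2_def, rule_format, OF f] this]
  have lim: "(\<lambda>n. L2_nrm \<mu> (u n)) \<longlonglongrightarrow> 0"
    by (simp add: u_def[abs_def])
  have "(\<lambda>n. LINT x|\<mu>. \<phi> x * u n x) \<longlonglongrightarrow> 0"
  proof (rule Lim_null_comparison)
    show "\<forall>\<^sub>F n in sequentially. norm (LINT x|\<mu>. \<phi> x * u n x) \<le> ((LINT x|\<mu>. (norm (\<phi> x))\<^sup>2) + 1) / 2 * L2_nrm \<mu> (u n)"
      by (intro always_eventually allI L2_pairing_le \<phi>2 u)
    show "(\<lambda>n. ((LINT x|\<mu>. (norm (\<phi> x))\<^sup>2) + 1) / 2 * L2_nrm \<mu> (u n)) \<longlonglongrightarrow> 0"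
      using tendsto_mult_left[OF lim] by simp
  qed
  moreover have "(LINT x|\<mu>. \<phi> x * u n x) =
      (\<Sum>k = - int n..int n. LINT x|\<mu>. \<phi> x * (LINT y|\<mu>. f y * Q k x y)) - (LINT x|\<mu>. f x * \<phi> x)" for n
  proof -
    have prod: "integrable \<mu> (\<lambda>x. \<phi> x * g x)" if g: "g \<in> L2_fun \<mu>" for g
    proof (rule norm_integral_le(1))
      show "integrable \<mu> (\<lambda>x. (norm (\<phi> x))\<^sup>2 + (norm (g x))\<^sup>2)"
        using g \<phi>2 by (auto simp: L2_fun_def)
      show "norm (\<phi> x * g x) \<le> (norm (\<phi> x))\<^sup>2 + (norm (g x))\<^sup>2" for x
        using sum_squares_bound[of "norm (\<phi> x)" "norm (g x)"]
          mult_nonneg_nonneg[OF norm_ge_zero norm_ge_zero, of "\<phi> x" "g x"]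
        unfolding norm_mult by linarith
      show "(\<lambda>x. \<phi> x * g x) \<in> borel_measurable \<mu>"
        using g \<phi>2 by (auto simp: L2_fun_def)
    qed
    have "(LINT x|\<mu>. \<phi> x * u n x) =
        (LINT x|\<mu>. (\<Sum>k = - int n..int n. \<phi> x * kernel_op \<mu> (Q k) f x) - \<phi> x * f x)"
      by (simp add: u_def right_diff_distrib sum_distrib_left)
    also have "\<dots> = (\<Sum>k = - int n..int n. LINT x|\<mu>. \<phi> x * kernel_op \<mu> (Q k) f x) - (LINT x|\<mu>. \<phi> x * f x)"
      using prod[OF K] prod[OF f]
      by (simp add: Bochner_Integration.integral_diff Bochner_Integration.integral_sum)
    finally show ?thesis
      by (simp add: kernel_op_def mult.commute)
  qed
  ultimately have "(\<lambda>n. (\<Sum>k = - int n..int n. LINT x|\<mu>. \<phi> x * (LINT y|\<mu>. f y * Q k x y)) - (LINT x|\<mu>. f x * \<phi> x)) \<longlonglongrightarrow> 0"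
    by simp
  then show ?thesis
    by (simp add: Lim_null[symmetric])
qed

text \<open>On a small ball about \<open>x\<close> the function stays within half of
  \<open>norm (v x)\<close> of its value at \<open>x\<close>, so its integral over this ball cannot
  vanish unless \<open>v x\<close> does.\<close>

lemma quasi_continuous_zero:
  assumes "quasi_continuous v" "\<And>w r. (LINT x|\<mu>. indicator (qball d w r) x * v x) = 0"
  shows "v x = 0"
proof (rule ccontr)
  assume "v x \<noteq> 0"
  then have "0 < norm (v x) / 2"
    by simp
  then obtain r where r: "0 < r" "\<And>y. d x y < r \<Longrightarrow> norm (v x - v y) < norm (v x) / 2"
    using assms(1) unfolding quasi_continuous_def by blast
  define f where "f = (indicator (qball d x r) :: 'a \<Rightarrow> complex)"
  have ir: "integrable \<mu> (indicator (qball d x r) :: 'a \<Rightarrow> real)"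
    using emeasure_qball_less_top by simp
  have fr: "f y = complex_of_real (indicator (qball d x r) y)" for y
    by (simp add: f_def indicator_def)
  have if': "integrable \<mu> f"
    unfolding fr[abs_def] using ir by simp
  have [measurable]: "v \<in> borel_measurable \<mu>" "f \<in> borel_measurable \<mu>"
    using quasi_continuous_measurable[OF assms(1)] if' by auto
  have b: "norm (f y * v x - f y * v y) \<le> norm (v x) / 2 * indicator (qball d x r) y" for y
    using r(2)[of y] by (auto simp: f_def indicator_def qball_def less_imp_le)
  have i2: "integrable \<mu> (\<lambda>y. norm (v x) / 2 * indicator (qball d x r) y)"
    using ir by simp
  have i3: "integrable \<mu> (\<lambda>y. f y * v x - f y * v y)"
    by (rule norm_integral_le(1)[OF _ i2 b]) measurable
  have "integrable \<mu> (\<lambda>y. f y * v x)"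
    using if' by simp
  from Bochner_Integration.integrable_diff[OF this i3] have i4: "integrable \<mu> (\<lambda>y. f y * v y)"
    by simp
  have "(LINT y|\<mu>. f y * v x - f y * v y) = (LINT y|\<mu>. f y) * v x"
    using if' i4 assms(2)[of x r] by (simp add: f_def)
  also have "(LINT y|\<mu>. f y) = complex_of_real (V x r)"
    unfolding fr[abs_def] by (simp add: Vol_def)
  finally have "norm (LINT y|\<mu>. f y * v x - f y * v y) = V x r * norm (v x)"
    by (simp add: norm_mult)
  moreover have "norm (LINT y|\<mu>. f y * v x - f y * v y) \<le> (LINT y|\<mu>. norm (v x) / 2 * indicator (qball d x r) y)"
    by (rule norm_integral_le(2)[OF _ i2 b]) measurable
  moreover have "(LINT y|\<mu>. norm (v x) / 2 * indicator (qball d x r) y) = norm (v x) / 2 * V x r"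
    by (simp add: Vol_def)
  ultimately show False
    using V_pos[OF r(1), of x] \<open>v x \<noteq> 0\<close> by simp
qed

text \<open>Geometric decay gives a limit \<open>h\<close> with tails bounded in the test norm; that
  \<open>h\<close> is \<phi> is a separate matter. The integral of the partial sums over a ball
  tends to that of \<open>h\<close> by norm convergence and to that of \<phi> by
  \<open>ball_pairing_limit\<close>, and both functions are continuous.\<close>

proposition reproducing_formula:
  assumes \<phi>: "\<phi> \<in> smooth"
  obtains \<tau> where "\<tau> \<longlonglongrightarrow> 0" "\<And>n. tb \<beta> \<gamma> (\<lambda>y. \<phi> y - (\<Sum>k = - int n..int n. T k \<phi> y)) (\<tau> n)"
proof -
  obtain b where b: "tb \<eta> \<eta> \<phi> b"
    using \<phi> by (auto simp: test_space0_iff)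
  have int0: "integral\<^sup>L \<mu> \<phi> = 0"
    using \<phi> by (auto simp: test_space0_iff has_bochner_integral_iff)
  obtain C \<epsilon> where C: "0 < C" "0 < \<epsilon>" "\<And>k. tb \<beta> \<gamma> (T k \<phi>) (C * \<delta> powr (\<epsilon> * \<bar>real_of_int k\<bar>) * b)"
    by (rule T_decay[OF \<beta> \<gamma>]) (use that b int0 in auto)
  define \<rho> where "\<rho> = \<delta> powr \<epsilon>"
  have \<rho>: "0 < \<rho>" "\<rho> < 1"
    using \<delta> C powr_less_mono'[of \<delta> 0 \<epsilon>] by (auto simp: \<rho>_def)
  \<comment> \<open>The factor 2 accounts for the two scales \<open>j\<close> and \<open>- j\<close>
    that are grouped together.\<close>
  define D where "D = 2 * C * b"
  have D: "0 \<le> D"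
    using C tb_nonneg[OF b] by (simp add: D_def)
  have Tk: "tb \<beta> \<gamma> (T k \<phi>) (C * b * \<rho> ^ nat \<bar>k\<bar>)" for k
  proof -
    have "\<delta> powr (\<epsilon> * \<bar>real_of_int k\<bar>) = \<rho> powr real (nat \<bar>k\<bar>)"
      by (simp add: \<rho>_def powr_powr)
    also have "\<dots> = \<rho> ^ nat \<bar>k\<bar>"
      using \<rho> by (intro powr_realpow)
    finally show ?thesis
      using C(3)[of k] by (simp add: mult_ac)
  qed
  define v where "v j y = (if j = 0 then T 0 \<phi> y else T (int j) \<phi> y + T (- int j) \<phi> y)" for j :: nat and y
  have vtb: "tb \<beta> \<gamma> (v j) (D * \<rho> ^ j)" for j
  proof (cases "j = 0")
    case True
    then have "v j = T 0 \<phi>"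
      by (auto simp: v_def)
    then show ?thesis
      using True tb_mono[OF Tk[of 0], of D] C tb_nonneg[OF b] by (simp add: D_def)
  next
    case False
    then have "v j = (\<lambda>y. T (int j) \<phi> y + T (- int j) \<phi> y)"
      by (auto simp: v_def)
    then show ?thesis
      using tb_add[OF Tk[of "int j"] Tk[of "- int j"]] by (simp add: D_def mult_ac)
  qed
  have S: "(\<Sum>k = - int n..int n. T k \<phi> y) = (\<Sum>j\<le>n. v j y)" for n y
    by (simp add: sum_symmetric_int v_def)
  have vs: "summable (\<lambda>j. v j y)" for y
  proof (rule summable_comparison_test')
    show "summable (\<lambda>j. D * pd \<gamma> y * \<rho> ^ j)"
      using \<rho> by (intro summable_mult summable_geometric) simp
    show "norm (v j y) \<le> D * pd \<gamma> y * \<rho> ^ j" if "0 \<le> j" for j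
      using tb_size[OF vtb[of j], of y] by (simp add: mult_ac)
  qed
  define h where "h y = (\<Sum>j. v j y)" for y
  define \<tau> where "\<tau> n = D * (\<rho> ^ Suc n / (1 - \<rho>))" for n
  have "(\<lambda>n. D * (\<rho> ^ Suc n / (1 - \<rho>))) \<longlonglongrightarrow> D * (0 / (1 - \<rho>))"
    using \<rho> by (intro tendsto_intros LIMSEQ_Suc LIMSEQ_power_zero) auto
  then have \<tau>: "\<tau> \<longlonglongrightarrow> 0"
    by (simp add: \<tau>_def[abs_def])
  have tail: "tb \<beta> \<gamma> (\<lambda>y. h y - (\<Sum>k = - int n..int n. T k \<phi> y)) (\<tau> n)" for n
  proof (rule tb_limit)
    show "tb \<beta> \<gamma> (\<lambda>y. \<Sum>j<m. v (j + Suc n) y) (\<tau> n)" for m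
    proof (rule tb_mono)
      show "tb \<beta> \<gamma> (\<lambda>y. \<Sum>j<m. v (j + Suc n) y) (\<Sum>j<m. D * \<rho> ^ (j + Suc n))"
        by (intro tb_sum vtb) simp
      have "(\<Sum>j<m. \<rho> ^ j) \<le> (\<Sum>j. \<rho> ^ j)"
        using \<rho> by (intro sum_le_suminf summable_geometric) auto
      also have "\<dots> = 1 / (1 - \<rho>)"
        using \<rho> by (intro suminf_geometric) simp
      finally have "D * \<rho> ^ Suc n * (\<Sum>j<m. \<rho> ^ j) \<le> D * \<rho> ^ Suc n * (1 / (1 - \<rho>))"
        using D \<rho> by (intro mult_left_mono) auto
      then show "(\<Sum>j<m. D * \<rho> ^ (j + Suc n)) \<le> \<tau> n"
        by (simp add: \<tau>_def sum_distrib_left power_add mult_ac)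
    qed
    show "(\<lambda>m. \<Sum>j<m. v (j + Suc n) y) \<longlonglongrightarrow> h y - (\<Sum>k = - int n..int n. T k \<phi> y)" for y
    proof -
      have "(\<lambda>j. v (j + Suc n) y) sums (h y - (\<Sum>j<Suc n. v j y))"
        unfolding h_def by (rule sums_split_initial_segment[OF summable_sums[OF vs]])
      then show ?thesis
        unfolding S sums_def by (simp add: lessThan_Suc_atMost del: sum.lessThan_Suc)
    qed
  qed
  obtain E where E: "tb \<beta> \<gamma> h E"
  proof -
    obtain E0 where "tb \<beta> \<gamma> (T 0 \<phi>) E0"
      using T_tb_smooth[OF \<phi>] by blast
    from tb_add[OF tail[of 0] this] show ?thesis
      using that by simp
  qed
  have \<phi>\<beta>: "tb \<beta> \<gamma> \<phi> b"
    by (rule tb_exponents[OF b exponents_le])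
  have hb: "integrable \<mu> (\<lambda>x. indicator (qball d w r) x * g x)" if "tb \<beta> \<gamma> g G" for w r and g :: "'a \<Rightarrow> complex" and G
    using integrable_mult_indicator[OF sets_qball tb_integrable(1)[OF that \<beta>(1) \<gamma>(1)], of w r]
    by (simp add: scaleR_indicator)
  have eq: "(LINT x|\<mu>. indicator (qball d w r) x * (h x - \<phi> x)) = 0" for w r
  proof -
    define f where "f = (indicator (qball d w r) :: 'a \<Rightarrow> complex)"
    define L where "L g = (LINT x|\<mu>. f x * g x)" for g
    have L: "functional L (tail_const \<gamma>)"
      unfolding L_def f_def by (rule ball_functional)
    \<comment> \<open>Integration over a ball is bounded on rows because their L1 norms are bounded,
      uniformly in \<open>k\<close> and \<open>x\<close>; this permits the use of
      \<open>functional_T\<close>.\<close>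
    have LQ: "norm (L (Q k x)) \<le> Cq * tail_const 3" for k x
    proof -
      have "norm (L (Q k x)) \<le> (LINT y|\<mu>. Cq * pw (R k) 3 x y)"
        unfolding L_def
      proof (rule norm_integral_le(2))
        show "integrable \<mu> (\<lambda>y. Cq * pw (R k) 3 x y)"
          by (intro integrable_mult_right integrable_pw R_pos) simp
        show "norm (f y * Q k x y) \<le> Cq * pw (R k) 3 x y" for y
          using Q_size[of k x y] order_trans[OF norm_ge_zero Q_size] by (auto simp: f_def indicator_def norm_mult)
      qed (auto simp: f_def)
      also have "\<dots> \<le> Cq * tail_const 3"
        using integral_pw_le[of 3 "R k" x] Cq by (simp add: mult_left_mono)
      finally show ?thesis .
    qed
    have "L (\<lambda>y. \<Sum>k = - int n..int n. T k \<phi> y) = (\<Sum>k = - int n..int n. LINT x|\<mu>. \<phi> x * L (Q k x))" for n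
      using functional_sum[OF L, of "{- int n..int n}" "\<lambda>k. T k \<phi>"] functional_T[OF L LQ \<phi>] T_tests[OF \<phi>]
      by simp
    then have lim1: "(\<lambda>n. L (\<lambda>y. \<Sum>k = - int n..int n. T k \<phi> y)) \<longlonglongrightarrow> L \<phi>"
      using ball_pairing_limit[OF \<phi>, of w r] by (simp add: L_def f_def)
    have "(\<lambda>n. L h - L (\<lambda>y. \<Sum>k = - int n..int n. T k \<phi> y)) \<longlonglongrightarrow> 0"
    proof (rule Lim_null_comparison)
      show "\<forall>\<^sub>F n in sequentially. norm (L h - L (\<lambda>y. \<Sum>k = - int n..int n. T k \<phi> y)) \<le> \<tau> n * tail_const \<gamma>"
      proof (intro always_eventually allI)
        fix n
        have S': "(\<lambda>y. \<Sum>k = - int n..int n. T k \<phi> y) \<in> tests"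
          by (intro tests_sum T_tests \<phi>)
        obtain G where G: "tb \<beta> \<gamma> (\<lambda>y. \<Sum>k = - int n..int n. T k \<phi> y) G"
          using tests_tb[OF S'] by blast
        have "L h - L (\<lambda>y. \<Sum>k = - int n..int n. T k \<phi> y) =
            L (\<lambda>y. h y - (\<Sum>k = - int n..int n. T k \<phi> y))"
          unfolding L_def f_def using hb[OF E] hb[OF G] by (simp add: right_diff_distrib)
        also have "norm \<dots> \<le> (LINT y|\<mu>. norm (h y - (\<Sum>k = - int n..int n. T k \<phi> y)))"
          unfolding L_def f_def using hb[OF tail] tb_integrable(1)[OF tail \<beta>(1) \<gamma>(1)]
          by (intro norm_integral_le(2)) (auto simp: norm_mult indicator_def simp del: Bochner_Integration.integrable_diff Bochner_Integration.integrable_sum)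
        also have "\<dots> \<le> \<tau> n * tail_const \<gamma>"
          by (rule tb_integrable(2)[OF tail \<beta>(1) \<gamma>(1)])
        finally show "norm (L h - L (\<lambda>y. \<Sum>k = - int n..int n. T k \<phi> y)) \<le> \<tau> n * tail_const \<gamma>" .
      qed
      show "(\<lambda>n. \<tau> n * tail_const \<gamma>) \<longlonglongrightarrow> 0"
        using tendsto_mult_right[OF \<tau>] by simp
    qed
    then have "(\<lambda>n. L (\<lambda>y. \<Sum>k = - int n..int n. T k \<phi> y)) \<longlonglongrightarrow> L h"
      using tendsto_diff[OF tendsto_const[of "L h"]] by fastforce
    then have "L h = L \<phi>"
      using lim1 LIMSEQ_unique by blast
    then show ?thesis
      using hb[OF E] hb[OF \<phi>\<beta>] by (simp add: L_def f_def right_diff_distrib)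
  qed
  have "quasi_continuous (\<lambda>x. h x - \<phi> x)"
    by (rule tb_quasi_continuous[OF tb_diff[OF E \<phi>\<beta>] \<beta>(1)])
  from quasi_continuous_zero[OF this eq] have "h = \<phi>"
    by (auto simp: fun_eq_iff)
  then show ?thesis
    using that[OF \<tau>] tail by simp
qed

text \<open>The bound on the rows may depend on \<open>k\<close>: for each scale it is used
  separately in \<open>functional_T\<close>, while convergence comes from the test norm of the
  remainder.\<close>

corollary functional_reproducing:
  assumes L: "functional L B" and A: "\<And>k x. norm (L (Q k x)) \<le> A k" and \<phi>: "\<phi> \<in> smooth"
  shows "(\<lambda>n. \<Sum>k = - int n..int n. LINT x|\<mu>. \<phi> x * L (Q k x)) \<longlonglongrightarrow> L \<phi>"
proof -
  obtain \<tau> where \<tau>: "\<tau> \<longlonglongrightarrow> 0" "\<And>n. tb \<beta> \<gamma> (\<lambda>y. \<phi> y - (\<Sum>k = - int n..int n. T k \<phi> y)) (\<tau> n)"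
    by (rule reproducing_formula[OF \<phi>]) (use that in auto)
  have eq: "(\<Sum>k = - int n..int n. LINT x|\<mu>. \<phi> x * L (Q k x)) = L (\<lambda>y. \<Sum>k = - int n..int n. T k \<phi> y)" for n
    using functional_sum[OF L, of "{- int n..int n}" "\<lambda>k. T k \<phi>"] functional_T[OF L A \<phi>] T_tests[OF \<phi>]
    by simp
  have "(\<lambda>n. L \<phi> - (\<Sum>k = - int n..int n. LINT x|\<mu>. \<phi> x * L (Q k x))) \<longlonglongrightarrow> 0"
  proof (rule Lim_null_comparison)
    show "\<forall>\<^sub>F n in sequentially. norm (L \<phi> - (\<Sum>k = - int n..int n. LINT x|\<mu>. \<phi> x * L (Q k x))) \<le> B * \<tau> n"
    proof (intro always_eventually allI)
      fix n
      have S: "(\<lambda>y. \<Sum>k = - int n..int n. T k \<phi> y) \<in> tests"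
        by (intro tests_sum T_tests \<phi>)
      show "norm (L \<phi> - (\<Sum>k = - int n..int n. LINT x|\<mu>. \<phi> x * L (Q k x))) \<le> B * \<tau> n"
        unfolding eq functional_diff[OF L smooth_tests[OF \<phi>] S, symmetric]
        by (rule functionalD(4)[OF L tests_diff[OF smooth_tests[OF \<phi>] S] \<tau>(2)])
    qed
    show "(\<lambda>n. B * \<tau> n) \<longlonglongrightarrow> 0"
      using tendsto_mult_left[OF \<tau>(1)] by simp
  qed
  from tendsto_diff[OF tendsto_const[of "L \<phi>"] this] show ?thesis
    by simp
qed

end

section \<open>Hoelder and Besov spaces\<close>

lemma sum_powr_int_ge:
  fixes \<delta> p :: real
  assumes "0 < \<delta>" "\<delta> < 1" "0 < p" "finite I" "\<And>k. k \<in> I \<Longrightarrow> k0 \<le> k"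
  shows "(\<Sum>k\<in>I. \<delta> powr (p * real_of_int k)) \<le> \<delta> powr (p * real_of_int k0) / (1 - \<delta> powr p)"
proof -
  define q where "q = \<delta> powr p"
  have q: "0 < q" "q < 1"
    using assms powr_less_mono'[of \<delta> 0 p] by (auto simp: q_def)
  define h where "h k = nat (k - k0)" for k
  have tm: "\<delta> powr (p * real_of_int k) = \<delta> powr (p * real_of_int k0) * q ^ h k" if "k \<in> I" for k
  proof -
    have eq: "real_of_int k = real_of_int k0 + real (h k)"
      using assms(5)[OF that] by (simp add: h_def)
    have pow: "q ^ h k = \<delta> powr (p * real (h k))"
      using q by (simp add: q_def powr_powr flip: powr_realpow)
    show ?thesis
      by (simp only: eq pow distrib_left powr_add)
  qed
  have inj: "inj_on h I"
  proof (rule inj_onI)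
    fix a b assume "a \<in> I" "b \<in> I" "h a = h b"
    with assms(5)[of a] assms(5)[of b] show "a = b"
      by (simp add: h_def)
  qed
  have "(\<Sum>k\<in>I. \<delta> powr (p * real_of_int k)) = \<delta> powr (p * real_of_int k0) * (\<Sum>k\<in>I. q ^ h k)"
    by (simp add: tm sum_distrib_left)
  also have "(\<Sum>k\<in>I. q ^ h k) = (\<Sum>j\<in>h ` I. q ^ j)"
    by (simp add: sum.reindex[OF inj])
  also have "\<dots> \<le> (\<Sum>j. q ^ j)"
    using q assms(4) by (intro sum_le_suminf summable_geometric) auto
  also have "\<dots> = 1 / (1 - q)"
    using q by (intro suminf_geometric) simp
  finally show ?thesis
    by (simp add: q_def mult_left_mono)
qed

lemma sum_powr_int_le:
  fixes \<delta> p :: real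
  assumes "0 < \<delta>" "\<delta> < 1" "0 < p" "finite I" "\<And>k. k \<in> I \<Longrightarrow> k \<le> k0"
  shows "(\<Sum>k\<in>I. \<delta> powr (- p * real_of_int k)) \<le> \<delta> powr (- p * real_of_int k0) / (1 - \<delta> powr p)"
proof -
  have "(\<Sum>k\<in>I. \<delta> powr (- p * real_of_int k)) = (\<Sum>k\<in>uminus ` I. \<delta> powr (p * real_of_int k))"
    by (subst sum.reindex) (auto simp: inj_on_def)
  also have "\<dots> \<le> \<delta> powr (p * real_of_int (- k0)) / (1 - \<delta> powr p)"
    using assms by (intro sum_powr_int_ge) auto
  finally show ?thesis
    by simp
qed

lemma hoelder_norm_le_ennreal_iff:
  "hoelder_norm d s f \<le> ennreal H \<longleftrightarrow> (\<forall>x y. x \<noteq> y \<longrightarrow> norm (f x - f y) / d x y powr s \<le> H)"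
  if "0 \<le> H"
  using that by (auto simp: hoelder_norm_def SUP_le_iff ennreal_le_iff)

context reproducing_kernels
begin

lemma hoelder_norm_le_iff:
  assumes "0 \<le> H" "0 < s"
  shows "hoelder_norm d s f \<le> ennreal H \<longleftrightarrow> (\<forall>x y. norm (f x - f y) \<le> H * d x y powr s)"
proof -
  have "norm (f x - f y) / d x y powr s \<le> H \<longleftrightarrow> norm (f x - f y) \<le> H * d x y powr s" if "x \<noteq> y" for x y
    using that by (subst pos_divide_le_eq) auto
  moreover have "norm (f x - f x) \<le> H * d x x powr s" for x
    by simp
  ultimately show ?thesis
    unfolding hoelder_norm_le_ennreal_iff[OF assms(1)] by metis
qed

lemma hoelder_quasi_continuous:
  assumes "0 < s" "\<And>x y. norm (f x - f y) \<le> H * d x y powr s"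
  shows "quasi_continuous f"
proof (rule quasi_continuous_hoelder[OF assms(1)])
  show "\<exists>c r. 0 < r \<and> (\<forall>y. d x y < r \<longrightarrow> norm (f x - f y) \<le> c * d x y powr s)" for x
    using assms(2) by (intro exI[of _ H] exI[of _ "1::real"]) auto
qed

lemma hoelder_space_iff:
  assumes "0 < s"
  shows "f \<in> hoelder_space d s \<longleftrightarrow> (\<exists>H\<ge>0. hoelder_norm d s f = ennreal H \<and> (\<forall>x y. norm (f x - f y) \<le> H * d x y powr s))"
proof
  assume f: "f \<in> hoelder_space d s"
  define H where "H = enn2real (hoelder_norm d s f)"
  have "hoelder_norm d s f = ennreal H"
    using f by (simp add: H_def hoelder_space_def less_top)
  moreover have "0 \<le> H"
    by (simp add: H_def)
  ultimately show "\<exists>H\<ge>0. hoelder_norm d s f = ennreal H \<and> (\<forall>x y. norm (f x - f y) \<le> H * d x y powr s)"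
    using hoelder_norm_le_iff[of H s f] assms by auto
next
  assume "\<exists>H\<ge>0. hoelder_norm d s f = ennreal H \<and> (\<forall>x y. norm (f x - f y) \<le> H * d x y powr s)"
  then show "f \<in> hoelder_space d s"
    using quasi_continuous_continuous_map[OF hoelder_quasi_continuous[OF assms]]
    by (auto simp: hoelder_space_def less_top)
qed

lemma functional_test_norm:
  assumes L: "functional L B" and f: "f \<in> tests"
  shows "norm (L f) \<le> B * doubling_const 2 * test_norm d A0 \<mu> x0 \<beta> \<gamma> f"
proof (rule field_le_epsilon)
  fix e :: real assume e: "0 < e"
  obtain C where C: "tb \<beta> \<gamma> f C"
    using tests_tb[OF f] by blast
  have B: "0 \<le> B"
    by (rule functionalD(1)[OF L])
  \<comment> \<open>Slack for the infimum in the test norm, which need not be attained.\<close>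
  define t where "t = e / (B * doubling_const 2 + 1)"
  have pos: "0 < B * doubling_const 2 + 1"
    using B doubling_const_pos[of 2] by (simp add: add_nonneg_pos)
  have t: "0 < t" "B * doubling_const 2 * t \<le> e"
    using e pos by (auto simp: t_def field_simps)
  have "tb \<beta> \<gamma> f (doubling_const 2 * (test_norm d A0 \<mu> x0 \<beta> \<gamma> f + t))"
    using t by (intro test_norm_less[OF C]) simp
  from functionalD(4)[OF L f this]
  show "norm (L f) \<le> B * doubling_const 2 * test_norm d A0 \<mu> x0 \<beta> \<gamma> f + e"
    using t by (simp add: algebra_simps)
qed

lemma distribution_functional:
  assumes "F \<in> distributions d A0 \<mu> x0 \<eta> \<beta> \<gamma>"
  shows "\<exists>B. functional F B"
proof -
  obtain B where B: "\<And>\<phi>. \<phi> \<in> tests \<Longrightarrow> norm (F \<phi>) \<le> B * test_norm d A0 \<mu> x0 \<beta> \<gamma> \<phi>"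
    using assms unfolding distributions_def by blast
  have "norm (F \<phi>) \<le> \<bar>B\<bar> * 2 * C" if "\<phi> \<in> tests" "tb \<beta> \<gamma> \<phi> C" for \<phi> C
  proof -
    have "norm (F \<phi>) \<le> B * test_norm d A0 \<mu> x0 \<beta> \<gamma> \<phi>"
      by (rule B[OF that(1)])
    also have "\<dots> \<le> \<bar>B\<bar> * test_norm d A0 \<mu> x0 \<beta> \<gamma> \<phi>"
      using test_norm_nonneg[OF that(2)] by (intro mult_right_mono) auto
    also have "\<dots> \<le> \<bar>B\<bar> * (2 * C)"
      using test_norm_le[OF that(2)] by (intro mult_left_mono) auto
    finally show ?thesis
      by simp
  qed
  then have "functional F (\<bar>B\<bar> * 2)"
    using assms unfolding distributions_def functional_def by auto
  then show ?thesis
    by blast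
qed

lemma functional_distribution:
  assumes L: "functional L B"
  shows "restrict L tests \<in> distributions d A0 \<mu> x0 \<eta> \<beta> \<gamma>"
  unfolding distributions_def
proof (intro CollectI conjI ballI allI)
  show "\<exists>B. \<forall>\<phi>\<in>tests. norm (restrict L tests \<phi>) \<le> B * test_norm d A0 \<mu> x0 \<beta> \<gamma> \<phi>"
    using functional_test_norm[OF L] by (intro exI[of _ "B * doubling_const 2"]) simp
qed (use functionalD[OF L] tests_add tests_cmult in auto)

section \<open>Pairing Hoelder functions with test functions\<close>

text \<open>A Hoelder function grows at most like \<open>d x0 x powr s\<close>, which the decay of
  order \<gamma> absorbs since s < \<gamma>. The norm bound compares \<open>f\<close> with
  \<open>f x0\<close>, which a mean-zero \<phi> does not see.\<close>

lemma hoelder_pairing: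
  assumes s: "0 < s" "s < \<gamma>" and f: "\<And>x y. norm (f x - f y) \<le> H * d x y powr s"
    and H0: "0 \<le> H" and \<phi>: "tb \<beta> \<gamma> \<phi> C"
  shows "integrable \<mu> (\<lambda>x. d x0 x powr s * norm (\<phi> x))" "integrable \<mu> (\<lambda>x. f x * \<phi> x)"
    "integral\<^sup>L \<mu> \<phi> = 0 \<Longrightarrow> norm (LINT x|\<mu>. f x * \<phi> x) \<le> H * tail_const (\<gamma> - s) * C"
proof -
  have \<gamma>s: "0 < \<gamma> - s"
    using s by simp
  have [measurable]: "f \<in> borel_measurable \<mu>" "\<phi> \<in> borel_measurable \<mu>"
    using quasi_continuous_measurable[OF hoelder_quasi_continuous[OF s(1) f]] tb_measurable[OF \<phi> \<beta>(1)] by auto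
  have C: "0 \<le> C"
    by (rule tb_nonneg[OF \<phi>])
  have p: "d x0 x powr s * norm (\<phi> x) \<le> C * pd (\<gamma> - s) x" for x
  proof -
    have "d x0 x powr s * norm (\<phi> x) \<le> d x0 x powr s * (C * pd \<gamma> x)"
      using tb_size[OF \<phi>] by (intro mult_left_mono) auto
    also have "\<dots> = C * (d x0 x powr s * pd \<gamma> x)"
      by simp
    also have "\<dots> \<le> C * pd (\<gamma> - s) x"
      using C s by (intro mult_left_mono powr_d_pd_le) auto
    finally show ?thesis .
  qed
  show i: "integrable \<mu> (\<lambda>x. d x0 x powr s * norm (\<phi> x))"
  proof (rule Bochner_Integration.integrable_bound)
    show "integrable \<mu> (\<lambda>x. C * pd (\<gamma> - s) x)"
      using integrable_pw[OF \<gamma>s] by simp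
    show "AE x in \<mu>. norm (d x0 x powr s * norm (\<phi> x)) \<le> norm (C * pd (\<gamma> - s) x)"
      using p C by (intro AE_I2) simp
  qed measurable
  have b: "norm ((f x - f x0) * \<phi> x) \<le> H * (d x0 x powr s * norm (\<phi> x))" for x
    using f[of x x0] by (simp add: norm_mult d_commute mult_right_mono flip: mult.assoc)
  have iH: "integrable \<mu> (\<lambda>x. H * (d x0 x powr s * norm (\<phi> x)))"
    using i by simp
  have i1: "integrable \<mu> (\<lambda>x. (f x - f x0) * \<phi> x)"
    by (rule norm_integral_le(1)[OF _ iH b]) measurable
  have i2: "integrable \<mu> (\<lambda>x. f x0 * \<phi> x)"
    using tb_integrable(1)[OF \<phi> \<beta>(1) \<gamma>(1)] by simp
  from Bochner_Integration.integrable_add[OF i1 i2] show "integrable \<mu> (\<lambda>x. f x * \<phi> x)"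
    by (simp add: algebra_simps)
  assume int0: "integral\<^sup>L \<mu> \<phi> = 0"
  have "(LINT x|\<mu>. f x * \<phi> x) = (LINT x|\<mu>. (f x - f x0) * \<phi> x + f x0 * \<phi> x)"
    by (simp add: algebra_simps)
  also have "\<dots> = (LINT x|\<mu>. (f x - f x0) * \<phi> x)"
    using Bochner_Integration.integral_add[OF i1 i2] int0 by simp
  also have "norm \<dots> \<le> (LINT x|\<mu>. H * (d x0 x powr s * norm (\<phi> x)))"
    by (rule norm_integral_le(2)[OF _ iH b]) measurable
  also have "\<dots> \<le> H * tail_const (\<gamma> - s) * C"
  proof -
    have "(LINT x|\<mu>. d x0 x powr s * norm (\<phi> x)) \<le> (LINT x|\<mu>. C * pd (\<gamma> - s) x)"
      using i p integrable_pw[OF \<gamma>s] by (intro integral_mono) auto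
    also have "\<dots> \<le> C * tail_const (\<gamma> - s)"
      using C integral_pw_le[OF \<gamma>s, of 1 x0] by (simp add: mult_left_mono)
    finally have "H * (LINT x|\<mu>. d x0 x powr s * norm (\<phi> x)) \<le> H * (C * tail_const (\<gamma> - s))"
      using H0 by (intro mult_left_mono)
    then show ?thesis
      by (subst integral_mult_right_zero) (simp only: mult_ac)
  qed
  finally show "norm (LINT x|\<mu>. f x * \<phi> x) \<le> H * tail_const (\<gamma> - s) * C" .
qed

lemma hoelder_functional:
  assumes s: "0 < s" "s < \<gamma>" and f: "\<And>x y. norm (f x - f y) \<le> H * d x y powr s" and H: "0 \<le> H"
  shows "functional (\<lambda>\<phi>. LINT x|\<mu>. f x * \<phi> x) (H * tail_const (\<gamma> - s))"
proof -
  have i: "integrable \<mu> (\<lambda>x. f x * \<phi> x)" if "\<phi> \<in> tests" for \<phi>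
    using tests_tb[OF that] hoelder_pairing(2)[OF s f H] by blast
  show ?thesis
    unfolding functional_def
  proof (intro conjI ballI allI impI)
    show "0 \<le> H * tail_const (\<gamma> - s)"
      using H tail_const_pos[of "\<gamma> - s"] s by simp
    fix \<phi> assume \<phi>: "\<phi> \<in> tests"
    show "(LINT x|\<mu>. f x * (\<phi> x + \<psi> x)) = (LINT x|\<mu>. f x * \<phi> x) + (LINT x|\<mu>. f x * \<psi> x)" if "\<psi> \<in> tests" for \<psi>
      using i[OF \<phi>] i[OF that] by (simp add: distrib_left)
    show "(LINT x|\<mu>. f x * (c * \<phi> x)) = c * (LINT x|\<mu>. f x * \<phi> x)" for c
      by (simp add: mult.left_commute)
    show "norm (LINT x|\<mu>. f x * \<phi> x) \<le> H * tail_const (\<gamma> - s) * C" if "tb \<beta> \<gamma> \<phi> C" for C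
      by (rule hoelder_pairing(3)[OF s f H that tests_integral(1)[OF \<phi>]])
  qed
qed

lemma hoelder_row_bound:
  assumes s: "0 < s" "s < \<gamma>" and f: "\<And>x y. norm (f x - f y) \<le> H * d x y powr s" and H: "0 \<le> H"
  shows "norm (LINT y|\<mu>. f y * Q k x y) \<le> H * Cq * tail_const 2 * R k powr s"
proof -
  have [measurable]: "f \<in> borel_measurable \<mu>"
    using quasi_continuous_measurable[OF hoelder_quasi_continuous[OF s(1) f]] by auto
  obtain C where C: "tb \<beta> \<gamma> (Q k x) C"
    using tests_tb[OF row_tests] by blast
  have i1: "integrable \<mu> (\<lambda>y. f y * Q k x y)"
    by (rule hoelder_pairing(2)[OF s f H C])
  have i2: "integrable \<mu> (\<lambda>y. f x * Q k x y)"
    using tests_integral(2)[OF row_tests] by simp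
  have "(LINT y|\<mu>. f y * Q k x y) = (LINT y|\<mu>. f y * Q k x y) - (LINT y|\<mu>. f x * Q k x y)"
    using tests_integral(1)[OF row_tests, of k x] by simp
  also have "\<dots> = (LINT y|\<mu>. f y * Q k x y - f x * Q k x y)"
    by (rule Bochner_Integration.integral_diff[symmetric, OF i1 i2])
  also have "norm \<dots> \<le> (LINT y|\<mu>. H * Cq * R k powr s * pw (R k) 2 x y)"
  proof (rule norm_integral_le(2))
    show "integrable \<mu> (\<lambda>y. H * Cq * R k powr s * pw (R k) 2 x y)"
      by (intro integrable_mult_right integrable_pw) auto
    fix y
    have "norm (f y * Q k x y - f x * Q k x y) = norm (f x - f y) * norm (Q k x y)"
      by (simp add: norm_mult norm_minus_commute flip: left_diff_distrib)
    also have "\<dots> \<le> (H * d x y powr s) * (Cq * pw (R k) 3 x y)"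
      using H by (intro mult_mono f Q_size) auto
    also have "\<dots> = H * Cq * R k powr s * ((d x y / R k) powr s * pw (R k) 3 x y)"
      using \<delta> by (simp add: powr_divide)
    also have "\<dots> \<le> H * Cq * R k powr s * pw (R k) 2 x y"
      using H Cq s \<gamma> \<eta> by (intro mult_left_mono powr_d_pw_le) auto
    finally show "norm (f y * Q k x y - f x * Q k x y) \<le> H * Cq * R k powr s * pw (R k) 2 x y" .
  qed measurable
  also have "\<dots> = H * Cq * R k powr s * (LINT y|\<mu>. pw (R k) 2 x y)"
    by (rule integral_mult_right_zero)
  also have "\<dots> \<le> H * Cq * R k powr s * tail_const 2"
    using H Cq by (intro mult_left_mono integral_pw_le) auto
  finally show ?thesis
    by (simp add: mult_ac)
qed

lemma R_powr_s: "\<delta> powr (- (real_of_int k * s)) * R k powr s = 1"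
  using \<delta> by (simp add: R_eq powr_powr powr_minus)

proposition hoelder_imp_besov:
  assumes s: "0 < s" "s < \<gamma>" and f: "f \<in> hoelder_space d s"
  shows "\<forall>\<phi>\<in>tests. integrable \<mu> (\<lambda>x. f x * \<phi> x)"
    "distribution_of d A0 \<mu> x0 \<eta> \<beta> \<gamma> f \<in> besov_space d A0 \<mu> x0 \<eta> \<beta> \<gamma> \<delta> Q s"
    "besov_norm \<mu> \<delta> Q s (distribution_of d A0 \<mu> x0 \<eta> \<beta> \<gamma> f) \<le> ennreal (Cq * tail_const 2) * hoelder_norm d s f"
proof -
  obtain H where H: "0 \<le> H" "hoelder_norm d s f = ennreal H" "\<And>x y. norm (f x - f y) \<le> H * d x y powr s"
    using f hoelder_space_iff[OF s(1)] by auto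
  show "\<forall>\<phi>\<in>tests. integrable \<mu> (\<lambda>x. f x * \<phi> x)"
    using tests_tb hoelder_pairing(2)[OF s H(3,1)] by blast
  define L where "L \<phi> = (LINT x|\<mu>. f x * \<phi> x)" for \<phi>
  have L: "functional L (H * tail_const (\<gamma> - s))"
    unfolding L_def by (rule hoelder_functional[OF s H(3,1)])
  have F: "distribution_of d A0 \<mu> x0 \<eta> \<beta> \<gamma> f = restrict L tests"
    by (simp add: distribution_of_def L_def[abs_def])
  have t: "0 < tail_const 2"
    by (rule tail_const_pos) simp
  have "ennreal (\<delta> powr (- (real_of_int k * s))) * esssup \<mu> (\<lambda>x. ennreal (norm (restrict L tests (Q k x))))
      \<le> ennreal (Cq * tail_const 2 * H)" for k
  proof -
    have [measurable]: "(\<lambda>x. L (Q k x)) \<in> borel_measurable \<mu>"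
      by (rule quasi_continuous_measurable[OF functional_row_continuous[OF L]])
    have LQ: "norm (L (Q k x)) \<le> H * Cq * tail_const 2 * R k powr s" for x
      unfolding L_def by (rule hoelder_row_bound[OF s H(3,1)])
    have "esssup \<mu> (\<lambda>x. ennreal (norm (L (Q k x)))) \<le> ennreal (H * Cq * tail_const 2 * R k powr s)"
      by (intro esssup_I AE_I2 ennreal_leI LQ) measurable
    then have "ennreal (\<delta> powr (- (real_of_int k * s))) * esssup \<mu> (\<lambda>x. ennreal (norm (L (Q k x))))
        \<le> ennreal (\<delta> powr (- (real_of_int k * s))) * ennreal (H * Cq * tail_const 2 * R k powr s)"
      by (intro mult_left_mono) auto
    also have "\<dots> = ennreal (H * Cq * tail_const 2 * (\<delta> powr (- (real_of_int k * s)) * R k powr s))"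
      using H(1) Cq t by (subst ennreal_mult[symmetric]) (auto simp: mult_ac)
    also have "\<dots> = ennreal (Cq * tail_const 2 * H)"
      unfolding R_powr_s by (simp add: mult_ac)
    finally show ?thesis
      by (simp add: row_tests)
  qed
  then have "besov_norm \<mu> \<delta> Q s (restrict L tests) \<le> ennreal (Cq * tail_const 2 * H)"
    unfolding besov_norm_def by (intro SUP_least)
  also have "\<dots> = ennreal (Cq * tail_const 2) * hoelder_norm d s f"
    using H Cq t by (simp add: ennreal_mult)
  finally show le: "besov_norm \<mu> \<delta> Q s (distribution_of d A0 \<mu> x0 \<eta> \<beta> \<gamma> f) \<le> ennreal (Cq * tail_const 2) * hoelder_norm d s f"
    by (simp add: F)
  have "ennreal (Cq * tail_const 2) * hoelder_norm d s f < \<infinity>"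
    by (simp add: H(2) ennreal_mult_less_top)
  from le_less_trans[OF le this]
  show "distribution_of d A0 \<mu> x0 \<eta> \<beta> \<gamma> f \<in> besov_space d A0 \<mu> x0 \<eta> \<beta> \<gamma> \<delta> Q s"
    using functional_distribution[OF L] by (simp add: besov_space_def F)
qed

section \<open>From Besov distributions to Hoelder functions\<close>

lemma besov_bound:
  assumes F: "F \<in> besov_space d A0 \<mu> x0 \<eta> \<beta> \<gamma> \<delta> Q s"
  shows "\<exists>A\<ge>0. besov_norm \<mu> \<delta> Q s F = ennreal A \<and> (\<forall>k x. norm (F (Q k x)) \<le> A * R k powr s)"
proof -
  define A where "A = enn2real (besov_norm \<mu> \<delta> Q s F)"
  have A: "0 \<le> A" "besov_norm \<mu> \<delta> Q s F = ennreal A"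
    using F by (auto simp: A_def besov_space_def less_top)
  obtain B where L: "functional F B"
    using F distribution_functional by (auto simp: besov_space_def)
  have "norm (F (Q k x)) \<le> A * R k powr s" for k x
  proof (rule AE_imp_quasi_continuous[OF functional_row_continuous[OF L]])
    define c where "c = \<delta> powr (- (real_of_int k * s))"
    define S where "S = esssup \<mu> (\<lambda>x. ennreal (norm (F (Q k x))))"
    have c: "0 < c" "c * R k powr s = 1"
      using \<delta> by (auto simp: c_def R_powr_s)
    have "ennreal c * S \<le> ennreal A"
      unfolding A(2)[symmetric] besov_norm_def c_def S_def by (rule SUP_upper) simp
    then have "ennreal (R k powr s) * (ennreal c * S) \<le> ennreal (R k powr s) * ennreal A"
      by (intro mult_left_mono) auto
    moreover have "ennreal (R k powr s) * (ennreal c * S) = S"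
    proof -
      have "ennreal (R k powr s) * ennreal c = 1"
        using c by (simp add: ennreal_mult[symmetric] mult.commute)
      then show ?thesis
        by (simp add: mult.assoc[symmetric])
    qed
    ultimately have S: "S \<le> ennreal (A * R k powr s)"
      using A(1) by (simp add: ennreal_mult mult.commute)
    have "AE x in \<mu>. ennreal (norm (F (Q k x))) \<le> S"
      unfolding S_def by (rule esssup_AE)
    then show "AE x in \<mu>. norm (F (Q k x)) \<le> A * R k powr s"
    proof eventually_elim
      case (elim x)
      then have "ennreal (norm (F (Q k x))) \<le> ennreal (A * R k powr s)"
        using S by (rule order_trans)
      then show ?case
        using A(1) by (simp add: ennreal_le_iff)
    qed
  qed
  with A show ?thesis
    by auto
qed

lemma R_powr: "R k powr p = \<delta> powr (p * real_of_int k)"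
  by (simp add: R_eq powr_powr mult.commute)

lemma geometric_below_1: "0 < p \<Longrightarrow> \<delta> powr p < 1"
  using \<delta> powr_less_mono'[of \<delta> 0 p] by simp

text \<open>The factor \<open>(\<delta> powr p) ^ N\<close>, gained because only scales at least
  \<open>N\<close> steps coarser than \<open>k\<close> enter, is what makes absorption
  possible.\<close>

lemma coarse_scale_sum:
  assumes "0 < p" "finite I" "\<And>l. l \<in> I \<Longrightarrow> l \<le> k - int N"
  shows "(\<Sum>l\<in>I. R l powr (- p)) * R k powr p \<le> (\<delta> powr p) ^ N / (1 - \<delta> powr p)"
proof -
  have q: "\<delta> powr p < 1"
    by (rule geometric_below_1[OF assms(1)])
  have "(\<Sum>l\<in>I. R l powr (- p)) \<le> \<delta> powr (- p * real_of_int (k - int N)) / (1 - \<delta> powr p)"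
    unfolding R_powr by (rule sum_powr_int_le[OF \<delta> assms])
  then have "(\<Sum>l\<in>I. R l powr (- p)) * R k powr p \<le>
      \<delta> powr (- p * real_of_int (k - int N)) / (1 - \<delta> powr p) * R k powr p"
    by (intro mult_right_mono) auto
  also have "\<dots> = (\<delta> powr (- p * real_of_int (k - int N)) * \<delta> powr (p * real_of_int k)) / (1 - \<delta> powr p)"
    by (simp add: R_powr)
  also have "\<delta> powr (- p * real_of_int (k - int N)) * \<delta> powr (p * real_of_int k) = \<delta> powr (p * real N)"
    by (simp add: powr_add[symmetric] algebra_simps)
  also have "\<dots> = (\<delta> powr p) ^ N"
    using \<delta> by (simp add: powr_powr flip: powr_realpow)
  finally show ?thesis .
qed

text \<open>Admitting also the \<open>N\<close> scales just coarser than \<open>k\<close> costs a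
  power of 1/\<delta>, which enters only the final constant.\<close>

lemma fine_scale_sum:
  assumes "0 < p" "finite I" "\<And>l. l \<in> I \<Longrightarrow> k - int N \<le> l"
  shows "(\<Sum>l\<in>I. R l powr p) \<le> \<delta> powr (- p * real N) / (1 - \<delta> powr p) * R k powr p"
proof -
  have "(\<Sum>l\<in>I. R l powr p) \<le> \<delta> powr (p * real_of_int (k - int N)) / (1 - \<delta> powr p)"
    unfolding R_powr by (rule sum_powr_int_ge[OF \<delta> assms])
  also have "\<delta> powr (p * real_of_int (k - int N)) = \<delta> powr (- p * real N) * \<delta> powr (p * real_of_int k)"
    by (simp add: powr_add[symmetric] algebra_simps)
  finally show ?thesis
    by (simp add: R_powr)
qed

text \<open>Regularity of \<open>x \<mapsto> L (Q\<^sub>k(x, \<cdot>))\<close> is bootstrapped: expanding \<open>L (Q\<^sub>k(x, \<cdot>) - Q\<^sub>k(x', \<cdot>))\<close> by the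
  reproducing formula, the scales coarser than \<open>k - N\<close> contribute at most half of the
  regularity constant at these scales. The continuity of \<open>L\<close> supplies an a priori bound that may grow
  like \<open>\<delta>\<^bsup>k(\<gamma>-s)\<^esup>\<close> as \<open>k\<close> tends to \<open>-\<infinity>\<close>; iterating removes it.\<close>

lemma bootstrap_step:
  assumes L: "functional L B" and s: "0 < s" "s < \<gamma>" and "0 \<le> A"
    and A: "\<And>k x. norm (L (Q k x)) \<le> A * R k powr s"
    and N: "Cq * tail_const 2 * ((\<delta> powr (\<eta> - s)) ^ N / (1 - \<delta> powr (\<eta> - s))) \<le> 1 / 2"
      "Cq * tail_const 2 * ((\<delta> powr (\<eta> - \<gamma>)) ^ N / (1 - \<delta> powr (\<eta> - \<gamma>))) \<le> 1 / 2"
    and "0 \<le> a" "0 \<le> K"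
    and IH: "\<And>k x'. k \<le> k0 \<Longrightarrow> d x x' \<le> R k \<Longrightarrow> norm (L (Q k x) - L (Q k x')) \<le>
      (a + K * R k powr (\<gamma> - s)) * (d x x' / R k) powr \<eta> * R k powr s"
    and k: "k \<le> k0" "d x x' \<le> R k"
  shows "norm (L (Q k x) - L (Q k x')) \<le>
    (Cq * tail_const 3 * (\<delta> powr (- s * real N) / (1 - \<delta> powr s)) * A + (a + 2 * A) / 2 + K / 2 * R k powr (\<gamma> - s))
      * (d x x' / R k) powr \<eta> * R k powr s"
proof -
  define v where "v = (d x x' / R k) powr \<eta>"
  define u where "u k x = L (Q k x)" for k x
  define \<phi> where "\<phi> y = Q k x y - Q k x' y" for y
  have v: "0 \<le> v"
    by (simp add: v_def)
  have s\<eta>: "s < \<eta>"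
    using s \<gamma> by simp
  have t: "0 < tail_const 2" "0 < tail_const 3"
    by (auto intro: tail_const_pos)
  have \<phi>s: "\<phi> \<in> smooth"
    using test_space0_add[OF row_test_space0 test_space0_cmult[OF row_test_space0, of "-1"], of k x k x']
    by (simp add: \<phi>_def[abs_def])
  have \<phi>b: "norm (\<phi> y) \<le> Cq * v * pw (R k) 3 x y" for y
    unfolding \<phi>_def v_def by (rule Q_reg1[OF k(2)])
  have int0: "integral\<^sup>L \<mu> \<phi> = 0" and i\<phi>: "integrable \<mu> \<phi>"
    using tests_integral[OF smooth_tests[OF \<phi>s]] by auto
  have [measurable]: "\<phi> \<in> borel_measurable \<mu>" "u l \<in> borel_measurable \<mu>" for l
    using i\<phi> quasi_continuous_measurable[OF functional_row_continuous[OF L, of l]]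
    by (auto simp: u_def[abs_def])
  have ip: "integrable \<mu> (\<lambda>y. c * pw (R k) \<kappa> x y)" if "0 < \<kappa>" for c \<kappa>
    using integrable_pw[OF that R_pos] by (rule integrable_mult_right)
  have ile: "(LINT y|\<mu>. c * pw (R k) \<kappa> x y) \<le> c * tail_const \<kappa>" if "0 < \<kappa>" "0 \<le> c" for c \<kappa>
    using integral_pw_le[OF that(1) R_pos] that(2) by (simp add: mult_left_mono)
  \<comment> \<open>At fine scales sizes suffice, since \<open>R l powr s\<close> is summable
    there.\<close>
  have fine: "norm (LINT y|\<mu>. \<phi> y * u l y) \<le> Cq * tail_const 3 * v * A * R l powr s" for l
  proof -
    have "norm (LINT y|\<mu>. \<phi> y * u l y) \<le> (LINT y|\<mu>. Cq * v * (A * R l powr s) * pw (R k) 3 x y)"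
    proof (rule norm_integral_le(2)[OF _ ip])
      show "norm (\<phi> y * u l y) \<le> Cq * v * (A * R l powr s) * pw (R k) 3 x y" for y
        using mult_mono[OF \<phi>b[of y] A[of l y]] Cq v by (simp add: norm_mult u_def mult_ac)
    qed auto
    also have "\<dots> \<le> Cq * v * (A * R l powr s) * tail_const 3"
      using Cq v \<open>0 \<le> A\<close> by (intro ile) auto
    finally show ?thesis
      by (simp add: mult_ac)
  qed
  \<comment> \<open>Coefficient of \<open>d x y powr \<eta>\<close> in the increment of
    \<open>u l\<close>. Within \<open>R l\<close> the increment is bounded by the hypothesis on
    regularity; beyond \<open>R l\<close> the size bound \<open>2 * A * R l powr s\<close> is
    absorbed by the extra \<open>2 * A\<close>.\<close>
  define w where "w l = (a + 2 * A) * R l powr (- (\<eta> - s)) + K * R l powr (- (\<eta> - \<gamma>))" for l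
  have w: "0 \<le> w l" for l
    using \<open>0 \<le> a\<close> \<open>0 \<le> A\<close> \<open>0 \<le> K\<close> by (simp add: w_def)
  \<comment> \<open>As \<phi> has mean zero, \<open>u l\<close> may be replaced by its increment
    from \<open>x\<close>, whose growth costs one power of the decay of \<phi>.\<close>
  have coarse: "norm (LINT y|\<mu>. \<phi> y * u l y) \<le> Cq * tail_const 2 * v * R k powr \<eta> * w l" if l: "l \<le> k0" for l
  proof -
    have diff: "norm (u l y - u l x) \<le> w l * d x y powr \<eta>" for y
    proof -
      have w_eq: "w l * d x y powr \<eta> = (a + K * R l powr (\<gamma> - s) + 2 * A) * (d x y / R l) powr \<eta> * R l powr s"
      proof -
        have "R l powr (- (\<eta> - s)) = R l powr s / R l powr \<eta>"
          by (simp add: powr_diff[symmetric])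
        moreover have "R l powr (- (\<eta> - \<gamma>)) = R l powr (\<gamma> - s) * R l powr s / R l powr \<eta>"
          by (simp add: powr_diff[symmetric] powr_add[symmetric])
        ultimately show ?thesis
          by (simp add: w_def powr_divide algebra_simps add_divide_distrib)
      qed
      show ?thesis
      proof (cases "d x y \<le> R l")
        case True
        have "norm (u l y - u l x) \<le> (a + K * R l powr (\<gamma> - s)) * (d x y / R l) powr \<eta> * R l powr s"
          using IH[OF l True] by (simp add: u_def norm_minus_commute)
        also have "\<dots> \<le> (a + K * R l powr (\<gamma> - s) + 2 * A) * (d x y / R l) powr \<eta> * R l powr s"
          using \<open>0 \<le> A\<close> by (intro mult_right_mono) auto
        finally show ?thesis
          by (simp add: w_eq)
      next
        case False
        have "norm (u l y - u l x) \<le> 2 * A * 1 * R l powr s"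
          using norm_triangle_ineq4[of "u l y" "u l x"] A[of l y] A[of l x] by (simp add: u_def)
        also have "\<dots> \<le> (a + K * R l powr (\<gamma> - s) + 2 * A) * (d x y / R l) powr \<eta> * R l powr s"
          using \<open>0 \<le> A\<close> \<open>0 \<le> a\<close> \<open>0 \<le> K\<close> False \<eta>
          by (intro mult_right_mono mult_mono one_le_powr_ratio) auto
        finally show ?thesis
          by (simp add: w_eq)
      qed
    qed
    define D where "D = Cq * v * (w l * R k powr \<eta>)"
    have D: "0 \<le> D"
      using Cq v w by (simp add: D_def)
    have b: "norm (\<phi> y * (u l y - u l x)) \<le> D * pw (R k) 2 x y" for y
    proof -
      have "norm (\<phi> y * (u l y - u l x)) \<le> (Cq * v * pw (R k) 3 x y) * (w l * d x y powr \<eta>)"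
        unfolding norm_mult using Cq v by (intro mult_mono \<phi>b diff) auto
      also have "d x y powr \<eta> = (d x y / R k) powr \<eta> * R k powr \<eta>"
        using \<delta> by (simp add: powr_divide)
      also have "(Cq * v * pw (R k) 3 x y) * (w l * ((d x y / R k) powr \<eta> * R k powr \<eta>)) =
          D * ((d x y / R k) powr \<eta> * pw (R k) 3 x y)"
        by (simp add: D_def mult_ac)
      also have "\<dots> \<le> D * pw (R k) 2 x y"
        using D \<eta> by (intro mult_left_mono powr_d_pw_le) auto
      finally show ?thesis .
    qed
    have ipD: "integrable \<mu> (\<lambda>y. D * pw (R k) 2 x y)"
      by (rule ip) simp
    have i1: "integrable \<mu> (\<lambda>y. \<phi> y * (u l y - u l x))"
      by (rule norm_integral_le(1)[OF _ ipD b]) measurable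
    have i2: "integrable \<mu> (\<lambda>y. \<phi> y * u l x)"
      using i\<phi> by simp
    have "(LINT y|\<mu>. \<phi> y * u l y) = (LINT y|\<mu>. \<phi> y * (u l y - u l x) + \<phi> y * u l x)"
      by (simp add: algebra_simps)
    also have "\<dots> = (LINT y|\<mu>. \<phi> y * (u l y - u l x))"
      using Bochner_Integration.integral_add[OF i1 i2] int0 by simp
    also have "norm \<dots> \<le> (LINT y|\<mu>. D * pw (R k) 2 x y)"
      by (rule norm_integral_le(2)[OF _ ipD b]) measurable
    also have "\<dots> \<le> D * tail_const 2"
      using D by (intro ile) auto
    finally show ?thesis
      by (simp add: D_def mult_ac)
  qed
  define U where "U = (Cq * tail_const 3 * (\<delta> powr (- s * real N) / (1 - \<delta> powr s)) * A + (a + 2 * A) / 2 +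
      K / 2 * R k powr (\<gamma> - s)) * v * R k powr s"
  \<comment> \<open>The bound holds for every finite set of scales, hence for all symmetric partial
    sums and for their limit \<open>L \<phi>\<close>.\<close>
  have partial: "norm (\<Sum>l\<in>I. LINT y|\<mu>. \<phi> y * u l y) \<le> U" if I: "finite I" for I
  proof -
    define I1 where "I1 = {l \<in> I. k - int N \<le> l}"
    define I2 where "I2 = {l \<in> I. l < k - int N}"
    have fin: "finite I1" "finite I2" "I1 \<inter> I2 = {}" "I = I1 \<union> I2"
      using I by (auto simp: I1_def I2_def)
    have 1: "(\<Sum>l\<in>I1. norm (LINT y|\<mu>. \<phi> y * u l y)) \<le>
        Cq * tail_const 3 * v * A * (\<delta> powr (- s * real N) / (1 - \<delta> powr s) * R k powr s)"
    proof -
      have "(\<Sum>l\<in>I1. norm (LINT y|\<mu>. \<phi> y * u l y)) \<le> (\<Sum>l\<in>I1. Cq * tail_const 3 * v * A * R l powr s)"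
        by (intro sum_mono fine)
      also have "\<dots> = Cq * tail_const 3 * v * A * (\<Sum>l\<in>I1. R l powr s)"
        by (simp add: sum_distrib_left)
      also have "\<dots> \<le> Cq * tail_const 3 * v * A * (\<delta> powr (- s * real N) / (1 - \<delta> powr s) * R k powr s)"
        by (rule mult_left_mono[OF fine_scale_sum[OF s(1) fin(1)]])
          (use Cq t v \<open>0 \<le> A\<close> in \<open>auto simp: I1_def\<close>)
      finally show ?thesis .
    qed
    have 2: "(\<Sum>l\<in>I2. norm (LINT y|\<mu>. \<phi> y * u l y)) \<le> ((a + 2 * A) / 2 + K / 2 * R k powr (\<gamma> - s)) * v * R k powr s"
    proof -
      have "(\<Sum>l\<in>I2. norm (LINT y|\<mu>. \<phi> y * u l y)) \<le> (\<Sum>l\<in>I2. Cq * tail_const 2 * v * R k powr \<eta> * w l)"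
        using k by (intro sum_mono coarse) (auto simp: I2_def)
      also have "\<dots> = Cq * tail_const 2 * v * R k powr \<eta> *
          ((a + 2 * A) * (\<Sum>l\<in>I2. R l powr (- (\<eta> - s))) + K * (\<Sum>l\<in>I2. R l powr (- (\<eta> - \<gamma>))))"
        by (simp only: w_def sum_distrib_left[symmetric] sum.distrib)
      also have "\<dots> = v * ((a + 2 * A) * R k powr s * (Cq * tail_const 2 * ((\<Sum>l\<in>I2. R l powr (- (\<eta> - s))) * R k powr (\<eta> - s))) +
          K * (R k powr (\<gamma> - s) * R k powr s) * (Cq * tail_const 2 * ((\<Sum>l\<in>I2. R l powr (- (\<eta> - \<gamma>))) * R k powr (\<eta> - \<gamma>))))"
      proof -
        define S1 where "S1 = (\<Sum>l\<in>I2. R l powr (- (\<eta> - s)))"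
        define S2 where "S2 = (\<Sum>l\<in>I2. R l powr (- (\<eta> - \<gamma>)))"
        have e: "R k powr s * R k powr (\<eta> - s) = R k powr \<eta>"
          "R k powr (\<gamma> - s) * R k powr s * R k powr (\<eta> - \<gamma>) = R k powr \<eta>"
          by (simp_all add: powr_add[symmetric])
        have "v * ((a + 2 * A) * R k powr s * (Cq * tail_const 2 * (S1 * R k powr (\<eta> - s))) +
            K * (R k powr (\<gamma> - s) * R k powr s) * (Cq * tail_const 2 * (S2 * R k powr (\<eta> - \<gamma>)))) =
          Cq * tail_const 2 * v * ((a + 2 * A) * S1 * (R k powr s * R k powr (\<eta> - s)) +
            K * S2 * (R k powr (\<gamma> - s) * R k powr s * R k powr (\<eta> - \<gamma>)))"
          by (simp only: ring_distribs mult_ac)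
        also have "\<dots> = Cq * tail_const 2 * v * R k powr \<eta> * ((a + 2 * A) * S1 + K * S2)"
          unfolding e by (simp only: ring_distribs mult_ac)
        finally show ?thesis
          by (simp only: S1_def S2_def)
      qed
      also have "\<dots> \<le> v * ((a + 2 * A) * R k powr s * (1 / 2) + K * (R k powr (\<gamma> - s) * R k powr s) * (1 / 2))"
      proof -
        have c: "0 \<le> Cq * tail_const 2"
          using Cq t by simp
        have "(Cq * tail_const 2 * ((\<Sum>l\<in>I2. R l powr (- (\<eta> - s))) * R k powr (\<eta> - s))) \<le> 1 / 2"
          by (rule order_trans[OF mult_left_mono[OF coarse_scale_sum[of "\<eta> - s" I2 k N] c] N(1)])
            (use s\<eta> fin(2) in \<open>auto simp: I2_def\<close>)
        from mult_left_mono[OF this, of "(a + 2 * A) * R k powr s"]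
        have t1: "(a + 2 * A) * R k powr s * (Cq * tail_const 2 * ((\<Sum>l\<in>I2. R l powr (- (\<eta> - s))) * R k powr (\<eta> - s))) \<le> (a + 2 * A) * R k powr s * (1 / 2)"
          using \<open>0 \<le> a\<close> \<open>0 \<le> A\<close> by simp
        have "(Cq * tail_const 2 * ((\<Sum>l\<in>I2. R l powr (- (\<eta> - \<gamma>))) * R k powr (\<eta> - \<gamma>))) \<le> 1 / 2"
          by (rule order_trans[OF mult_left_mono[OF coarse_scale_sum[of "\<eta> - \<gamma>" I2 k N] c] N(2)])
            (use \<gamma> fin(2) in \<open>auto simp: I2_def\<close>)
        from mult_left_mono[OF this, of "K * (R k powr (\<gamma> - s) * R k powr s)"]
        have t2: "K * (R k powr (\<gamma> - s) * R k powr s) * (Cq * tail_const 2 * ((\<Sum>l\<in>I2. R l powr (- (\<eta> - \<gamma>))) * R k powr (\<eta> - \<gamma>))) \<le>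
            K * (R k powr (\<gamma> - s) * R k powr s) * (1 / 2)"
          using \<open>0 \<le> K\<close> by simp
        show ?thesis
          by (rule mult_left_mono[OF add_mono[OF t1 t2] v])
      qed
      finally show ?thesis
        by (simp add: field_simps)
    qed
    have "norm (\<Sum>l\<in>I. LINT y|\<mu>. \<phi> y * u l y) \<le> (\<Sum>l\<in>I. norm (LINT y|\<mu>. \<phi> y * u l y))"
      by (rule norm_sum)
    also have "\<dots> = (\<Sum>l\<in>I1. norm (LINT y|\<mu>. \<phi> y * u l y)) + (\<Sum>l\<in>I2. norm (LINT y|\<mu>. \<phi> y * u l y))"
      unfolding fin(4) using fin(1-3) by (rule sum.union_disjoint)
    also have "\<dots> \<le> U"
      using 1 2 by (simp add: U_def algebra_simps)
    finally show ?thesis .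
  qed
  have lim: "(\<lambda>n. \<Sum>l = - int n..int n. LINT y|\<mu>. \<phi> y * u l y) \<longlonglongrightarrow> L \<phi>"
    unfolding u_def by (rule functional_reproducing[OF L A \<phi>s])
  have "norm (L \<phi>) \<le> U"
    by (rule Lim_norm_ubound[OF sequentially_bot lim]) (intro always_eventually allI partial, simp)
  moreover have "L \<phi> = L (Q k x) - L (Q k x')"
    unfolding \<phi>_def by (rule functional_diff[OF L row_tests row_tests])
  ultimately show ?thesis
    by (simp add: U_def v_def)
qed

text \<open>The constant must not depend on the norm \<open>B\<close> of the functional. That norm
  enters only through the a priori term with coefficient \<open>K\<close>, which each application of
  \<open>bootstrap_step\<close> halves; in the limit it disappears.\<close>

proposition row_regularity:
  assumes s: "0 < s" "s < \<gamma>"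
  obtains C where "0 < C" "\<And>L B A k x x'. functional L B \<Longrightarrow> 0 \<le> A \<Longrightarrow>
    (\<And>k x. norm (L (Q k x)) \<le> A * R k powr s) \<Longrightarrow> d x x' \<le> R k \<Longrightarrow>
    norm (L (Q k x) - L (Q k x')) \<le> C * A * (d x x' / R k) powr \<eta> * R k powr s"
proof -
  have s\<eta>: "s < \<eta>"
    using s \<gamma> by simp
  have t: "0 < tail_const 2" "0 < tail_const 3"
    by (auto intro: tail_const_pos)
  have small: "\<forall>\<^sub>F N in sequentially. Cq * tail_const 2 * ((\<delta> powr p) ^ N / (1 - \<delta> powr p)) \<le> 1 / 2" if p: "0 < p" for p
  proof -
    have "(\<lambda>N. Cq * tail_const 2 * ((\<delta> powr p) ^ N / (1 - \<delta> powr p))) \<longlonglongrightarrow> Cq * tail_const 2 * (0 / (1 - \<delta> powr p))"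
      using geometric_below_1[OF p] by (intro tendsto_intros LIMSEQ_power_zero) auto
    then have "\<forall>\<^sub>F N in sequentially. Cq * tail_const 2 * ((\<delta> powr p) ^ N / (1 - \<delta> powr p)) < 1 / 2"
      by (rule order_tendstoD) simp
    then show ?thesis
      by eventually_elim simp
  qed
  have "\<forall>\<^sub>F N in sequentially. Cq * tail_const 2 * ((\<delta> powr (\<eta> - s)) ^ N / (1 - \<delta> powr (\<eta> - s))) \<le> 1 / 2 \<and>
      Cq * tail_const 2 * ((\<delta> powr (\<eta> - \<gamma>)) ^ N / (1 - \<delta> powr (\<eta> - \<gamma>))) \<le> 1 / 2"
    using s\<eta> \<gamma> by (intro eventually_conj small) auto
  then obtain N where N: "Cq * tail_const 2 * ((\<delta> powr (\<eta> - s)) ^ N / (1 - \<delta> powr (\<eta> - s))) \<le> 1 / 2"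
      "Cq * tail_const 2 * ((\<delta> powr (\<eta> - \<gamma>)) ^ N / (1 - \<delta> powr (\<eta> - \<gamma>))) \<le> 1 / 2"
    by (auto simp: eventually_sequentially)
  define C1 where "C1 = Cq * tail_const 3 * (\<delta> powr (- s * real N) / (1 - \<delta> powr s))"
  have C1: "0 \<le> C1"
    using Cq t geometric_below_1[OF s(1)] by (simp add: C1_def)
  \<comment> \<open>\<open>C * A\<close> is the fixed point of the map from \<open>a\<close> to
    \<open>C1 * A + (a + 2 * A) / 2\<close>, so iteration leaves the main constant
    unchanged.\<close>
  define C where "C = 2 * C1 + 2"
  have "norm (L (Q k0 x) - L (Q k0 x')) \<le> C * A * (d x x' / R k0) powr \<eta> * R k0 powr s"
    if L: "functional L B" and A0: "0 \<le> A" and A: "\<And>k x. norm (L (Q k x)) \<le> A * R k powr s"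
      and xx: "d x x' \<le> R k0" for L B A k0 x x'
  proof -
    \<comment> \<open>Uniform over \<open>k0\<close> and all coarser scales, the only ones the
      induction refers to. \<open>K\<close> depends on \<open>B\<close>, \<open>x\<close> and
      \<open>k0\<close>, which is harmless because it is halved at every step.\<close>
    obtain E where E: "0 < E" "\<And>k w w'. d x0 w \<le> d x0 x \<Longrightarrow> R k0 \<le> R k \<Longrightarrow> d w w' \<le> R k \<Longrightarrow>
      tb \<beta> \<gamma> (\<lambda>y. Q k w y - Q k w' y) (E * (d w w' / R k) powr \<eta> * R k powr \<gamma>)"
      by (rule rows_tb[OF \<beta>(1) exponents_le(1) \<gamma>(1) exponents_le(2) R_pos[of k0], of "d x0 x"]) (use that in auto)
    define K where "K = B * E"
    have K: "0 \<le> K"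
      using functionalD(1)[OF L] E(1) by (simp add: K_def)
    have a: "0 \<le> C * A"
      using C1 A0 by (simp add: C_def)
    have step: "\<forall>k\<le>k0. \<forall>x'. d x x' \<le> R k \<longrightarrow> norm (L (Q k x) - L (Q k x')) \<le>
        (C * A + K / 2 ^ n * R k powr (\<gamma> - s)) * (d x x' / R k) powr \<eta> * R k powr s" for n :: nat
    proof (induction n)
      case 0
      show ?case
      proof (intro allI impI)
        fix k x' assume k: "k \<le> k0" and x': "d x x' \<le> R k"
        have "R k0 \<le> R k"
          unfolding R_eq using k \<delta> by (intro powr_mono') auto
        then have "norm (L (\<lambda>y. Q k x y - Q k x' y)) \<le> B * (E * (d x x' / R k) powr \<eta> * R k powr \<gamma>)"
          by (intro functionalD(4)[OF L] tests_diff row_tests E(2) x') auto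
        also have "R k powr \<gamma> = R k powr (\<gamma> - s) * R k powr s"
          by (simp add: powr_add[symmetric])
        also have "B * (E * (d x x' / R k) powr \<eta> * (R k powr (\<gamma> - s) * R k powr s)) =
            K / 2 ^ 0 * R k powr (\<gamma> - s) * (d x x' / R k) powr \<eta> * R k powr s"
          by (simp add: K_def)
        also have "\<dots> \<le> (C * A + K / 2 ^ 0 * R k powr (\<gamma> - s)) * (d x x' / R k) powr \<eta> * R k powr s"
          using a by (intro mult_right_mono) auto
        finally show "norm (L (Q k x) - L (Q k x')) \<le>
            (C * A + K / 2 ^ 0 * R k powr (\<gamma> - s)) * (d x x' / R k) powr \<eta> * R k powr s"
          by (simp add: functional_diff[OF L row_tests row_tests])
      qed
    next
      case (Suc n)
      show ?case
      proof (intro allI impI)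
        fix k x' assume k: "k \<le> k0" and x': "d x x' \<le> R k"
        have "norm (L (Q k x) - L (Q k x')) \<le>
            (C1 * A + (C * A + 2 * A) / 2 + K / 2 ^ n / 2 * R k powr (\<gamma> - s)) * (d x x' / R k) powr \<eta> * R k powr s"
          unfolding C1_def
          by (rule bootstrap_step[OF L s A0 A N a _ _ k x']) (use Suc K in auto)
        also have "C1 * A + (C * A + 2 * A) / 2 = C * A"
          by (simp add: C_def field_simps)
        finally show "norm (L (Q k x) - L (Q k x')) \<le>
            (C * A + K / 2 ^ Suc n * R k powr (\<gamma> - s)) * (d x x' / R k) powr \<eta> * R k powr s"
          by (simp add: mult.commute)
      qed
    qed
    have "(\<lambda>n. (C * A + K * inverse (2 ^ n) * R k0 powr (\<gamma> - s)) * (d x x' / R k0) powr \<eta> * R k0 powr s) \<longlonglongrightarrow>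
        (C * A + K * 0 * R k0 powr (\<gamma> - s)) * (d x x' / R k0) powr \<eta> * R k0 powr s"
      by (intro tendsto_intros LIMSEQ_inverse_realpow_zero) simp
    then show ?thesis
      by (intro LIMSEQ_le_const[of _ "C * A * (d x x' / R k0) powr \<eta> * R k0 powr s"])
        (use step xx in \<open>auto simp: divide_inverse\<close>)
  qed
  moreover have "0 < C"
    using C1 by (simp add: C_def)
  ultimately show ?thesis
    using that by blast
qed

text \<open>The sum is split at the scale comparable with \<open>r\<close>: at coarser scales
  regularity makes it geometric because s < \<eta>, at finer scales size does because s > 0. Both
  halves are of order \<open>r powr s\<close>.\<close>

lemma all_scales_sum:
  assumes s: "0 < s" "s < \<eta>" and r: "0 < r" and D: "0 \<le> D" and I: "finite I"
    and b: "\<And>l. r \<le> R l \<Longrightarrow> b l \<le> D * (r / R l) powr \<eta> * R l powr s" "\<And>l. b l \<le> D * R l powr s"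
  shows "(\<Sum>l\<in>I. b l) \<le> D * (1 / (1 - \<delta> powr (\<eta> - s)) + 1 / (1 - \<delta> powr s)) * r powr s"
proof -
  have q: "\<delta> powr (\<eta> - s) < 1" "\<delta> powr s < 1"
    using s by (auto intro: geometric_below_1)
  \<comment> \<open>The index with \<open>R (k1 + 1) \<le> r \<le> R k1\<close>; the floor points
    this way because the base \<delta> is below 1.\<close>
  define k1 where "k1 = \<lfloor>log \<delta> r\<rfloor>"
  have r_eq: "\<delta> powr log \<delta> r = r"
    using \<delta> r by simp
  have k1: "real_of_int k1 \<le> log \<delta> r" "log \<delta> r \<le> real_of_int (k1 + 1)"
    unfolding k1_def by linarith+
  have "\<delta> powr log \<delta> r \<le> R k1" "R (k1 + 1) \<le> \<delta> powr log \<delta> r"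
    unfolding R_eq using \<delta> k1 by (auto intro!: powr_mono')
  then have Rk1: "r \<le> R k1" "R (k1 + 1) \<le> r"
    by (simp_all add: r_eq)
  define I1 where "I1 = {l \<in> I. l \<le> k1}"
  define I2 where "I2 = {l \<in> I. k1 + 1 \<le> l}"
  have fin: "finite I1" "finite I2" "I1 \<inter> I2 = {}"
    using I by (auto simp: I1_def I2_def)
  have split: "I = I1 \<union> I2"
    by (auto simp: I1_def I2_def)
  have "(\<Sum>l\<in>I1. b l) \<le> (\<Sum>l\<in>I1. D * r powr \<eta> * R l powr (- (\<eta> - s)))"
  proof (rule sum_mono)
    fix l assume "l \<in> I1"
    then have "R k1 \<le> R l"
      unfolding R_eq using \<delta> by (intro powr_mono') (auto simp: I1_def)
    then have "b l \<le> D * (r / R l) powr \<eta> * R l powr s"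
      using Rk1 by (intro b) simp
    also have "\<dots> = D * r powr \<eta> * R l powr (- (\<eta> - s))"
      using r by (simp add: powr_divide powr_diff)
    finally show "b l \<le> D * r powr \<eta> * R l powr (- (\<eta> - s))" .
  qed
  also have "\<dots> = D * r powr \<eta> * (\<Sum>l\<in>I1. R l powr (- (\<eta> - s)))"
    by (simp only: sum_distrib_left)
  also have "\<dots> \<le> D * r powr \<eta> * (r powr (- (\<eta> - s)) / (1 - \<delta> powr (\<eta> - s)))"
  proof (rule mult_left_mono)
    have "(\<Sum>l\<in>I1. R l powr (- (\<eta> - s))) \<le> \<delta> powr (- (\<eta> - s) * real_of_int k1) / (1 - \<delta> powr (\<eta> - s))"
      unfolding R_powr using s fin(1) by (intro sum_powr_int_le \<delta>) (auto simp: I1_def)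
    also have "\<dots> = R k1 powr (- (\<eta> - s)) / (1 - \<delta> powr (\<eta> - s))"
      by (simp add: R_powr)
    also have "\<dots> \<le> r powr (- (\<eta> - s)) / (1 - \<delta> powr (\<eta> - s))"
      using q s r Rk1 by (intro divide_right_mono powr_mono2') auto
    finally show "(\<Sum>l\<in>I1. R l powr (- (\<eta> - s))) \<le> r powr (- (\<eta> - s)) / (1 - \<delta> powr (\<eta> - s))" .
  qed (use D in simp)
  also have "\<dots> = D * (1 / (1 - \<delta> powr (\<eta> - s))) * (r powr \<eta> * r powr (- (\<eta> - s)))"
    by simp
  also have "r powr \<eta> * r powr (- (\<eta> - s)) = r powr s"
    by (simp flip: powr_add)
  finally have 1: "(\<Sum>l\<in>I1. b l) \<le> D * (1 / (1 - \<delta> powr (\<eta> - s))) * r powr s" .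
  have "(\<Sum>l\<in>I2. b l) \<le> (\<Sum>l\<in>I2. D * R l powr s)"
    by (intro sum_mono b)
  also have "\<dots> = D * (\<Sum>l\<in>I2. R l powr s)"
    by (simp only: sum_distrib_left)
  also have "\<dots> \<le> D * (r powr s / (1 - \<delta> powr s))"
  proof (rule mult_left_mono[OF _ D])
    have "(\<Sum>l\<in>I2. R l powr s) \<le> \<delta> powr (s * real_of_int (k1 + 1)) / (1 - \<delta> powr s)"
      unfolding R_powr using s fin(2) by (intro sum_powr_int_ge \<delta>) (auto simp: I2_def)
    also have "\<dots> = R (k1 + 1) powr s / (1 - \<delta> powr s)"
      by (simp only: R_powr)
    also have "\<dots> \<le> r powr s / (1 - \<delta> powr s)"
      using q s r Rk1 by (intro divide_right_mono powr_mono2 R_nonneg) auto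
    finally show "(\<Sum>l\<in>I2. R l powr s) \<le> r powr s / (1 - \<delta> powr s)" .
  qed
  finally have 2: "(\<Sum>l\<in>I2. b l) \<le> D * (r powr s / (1 - \<delta> powr s))" .
  have "(\<Sum>l\<in>I. b l) = (\<Sum>l\<in>I1. b l) + (\<Sum>l\<in>I2. b l)"
    unfolding split using fin by (rule sum.union_disjoint)
  also have "\<dots> \<le> D * (1 / (1 - \<delta> powr (\<eta> - s))) * r powr s + D * (r powr s / (1 - \<delta> powr s))"
    by (rule add_mono[OF 1 2])
  also have "\<dots> = D * (1 / (1 - \<delta> powr (\<eta> - s)) + 1 / (1 - \<delta> powr s)) * r powr s"
    by (simp add: ring_distribs)
  finally show ?thesis .
qed

text \<open>Smooth test functions are dense in the completion by construction, and both functionals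
  are continuous.\<close>

lemma functionals_eq:
  assumes "functional L B" "functional L' B'" "\<And>\<phi>. \<phi> \<in> smooth \<Longrightarrow> L \<phi> = L' \<phi>" "f \<in> tests"
  shows "L f = L' f"
proof -
  have "L f - L' f = 0"
  proof (rule small_imp_zero)
    fix e :: real assume "0 < e"
    then obtain \<phi> where \<phi>: "\<phi> \<in> smooth" "tb \<beta> \<gamma> (\<lambda>x. \<phi> x - f x) e"
      using assms(4) tests_iff[of f] by blast
    note \<phi>t = smooth_tests[OF \<phi>(1)]
    have 1: "norm (L \<phi> - L f) \<le> B * e"
      unfolding functional_diff[OF assms(1) \<phi>t assms(4), symmetric]
      by (rule functionalD(4)[OF assms(1) tests_diff[OF \<phi>t assms(4)] \<phi>(2)])
    have 2: "norm (L' \<phi> - L' f) \<le> B' * e"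
      unfolding functional_diff[OF assms(2) \<phi>t assms(4), symmetric]
      by (rule functionalD(4)[OF assms(2) tests_diff[OF \<phi>t assms(4)] \<phi>(2)])
    have "L f - L' f = (L' \<phi> - L' f) - (L \<phi> - L f)"
      using assms(3)[OF \<phi>(1)] by simp
    then show "norm (L f - L' f) \<le> (B + B') * e"
      using 1 2 norm_triangle_ineq4[of "L' \<phi> - L' f" "L \<phi> - L f"] by (simp add: algebra_simps)
  qed
  then show ?thesis
    by simp
qed

text \<open>The values \<open>u l x\<close> alone are bounded by \<open>R l powr s\<close>, which is
  not summable towards coarse scales; increments are summable over all scales. Subtracting the value
  at \<open>x0\<close> therefore makes the series converge, and mean-zero test functions do not see
  the subtracted constants.\<close>

proposition besov_imp_hoelder:
  assumes s: "0 < s" "s < \<gamma>"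
  obtains C where "0 < C" "\<And>F. F \<in> besov_space d A0 \<mu> x0 \<eta> \<beta> \<gamma> \<delta> Q s \<Longrightarrow> \<exists>g\<in>hoelder_space d s.
    F = distribution_of d A0 \<mu> x0 \<eta> \<beta> \<gamma> g \<and> hoelder_norm d s g \<le> ennreal C * besov_norm \<mu> \<delta> Q s F"
proof -
  have s\<eta>: "s < \<eta>"
    using s \<gamma> by simp
  have q: "\<delta> powr (\<eta> - s) < 1" "\<delta> powr s < 1"
    using s s\<eta> by (auto intro: geometric_below_1)
  obtain C0 where C0: "0 < C0" "\<And>L B A k x x'. functional L B \<Longrightarrow> 0 \<le> A \<Longrightarrow>
      (\<And>k x. norm (L (Q k x)) \<le> A * R k powr s) \<Longrightarrow> d x x' \<le> R k \<Longrightarrow>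
      norm (L (Q k x) - L (Q k x')) \<le> C0 * A * (d x x' / R k) powr \<eta> * R k powr s"
    by (rule row_regularity[OF s]) (use that in auto)
  define c where "c = 1 / (1 - \<delta> powr (\<eta> - s)) + 1 / (1 - \<delta> powr s)"
  have c: "0 < c"
    using q by (simp add: c_def add_pos_pos)
  \<comment> \<open>\<open>C0 + 2\<close> dominates both constants needed at a single scale,
    \<open>C0\<close> for regularity and 2 for the difference of two sizes; \<open>c\<close> sums
    over the scales.\<close>
  define C where "C = (C0 + 2) * c"
  have "\<exists>g\<in>hoelder_space d s. F = distribution_of d A0 \<mu> x0 \<eta> \<beta> \<gamma> g \<and>
      hoelder_norm d s g \<le> ennreal C * besov_norm \<mu> \<delta> Q s F"
    if F: "F \<in> besov_space d A0 \<mu> x0 \<eta> \<beta> \<gamma> \<delta> Q s" for F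
  proof -
    obtain A where A: "0 \<le> A" "besov_norm \<mu> \<delta> Q s F = ennreal A" "\<And>k x. norm (F (Q k x)) \<le> A * R k powr s"
      using besov_bound[OF F] by auto
    have Fd: "F \<in> distributions d A0 \<mu> x0 \<eta> \<beta> \<gamma>"
      using F by (simp add: besov_space_def)
    obtain B where L: "functional F B"
      using distribution_functional[OF Fd] by blast
    define u where "u k x = F (Q k x)" for k x
    have ub: "norm (u k x) \<le> A * R k powr s" for k x
      unfolding u_def by (rule A(3))
    have ur: "norm (u k x - u k x') \<le> C0 * A * (d x x' / R k) powr \<eta> * R k powr s" if "d x x' \<le> R k" for k x x'
      unfolding u_def by (rule C0(2)[OF L A(1,3) that])
    define H where "H = C * A"
    have H: "0 \<le> H"
      using C0(1) c A(1) by (simp add: H_def C_def)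
    have sum_bound: "(\<Sum>l\<in>I. norm (u l x - u l x')) \<le> H * d x x' powr s" if I: "finite I" for I x x'
    proof (cases "x = x'")
      case True
      then show ?thesis
        by simp
    next
      case False
      have "(\<Sum>l\<in>I. norm (u l x - u l x')) \<le>
          ((C0 + 2) * A) * (1 / (1 - \<delta> powr (\<eta> - s)) + 1 / (1 - \<delta> powr s)) * d x x' powr s"
      proof (rule all_scales_sum[OF s(1) s\<eta> _ _ I])
        fix l
        show "norm (u l x - u l x') \<le> (C0 + 2) * A * (d x x' / R l) powr \<eta> * R l powr s" if "d x x' \<le> R l"
          using A(1) by (intro order_trans[OF ur[OF that]] mult_right_mono) auto
        have "norm (u l x - u l x') \<le> 2 * A * R l powr s"
          using norm_triangle_ineq4[of "u l x" "u l x'"] ub[of l x] ub[of l x'] by simp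
        also have "\<dots> \<le> (C0 + 2) * A * R l powr s"
          using A(1) C0(1) by (intro mult_right_mono) auto
        finally show "norm (u l x - u l x') \<le> (C0 + 2) * A * R l powr s" .
      qed (use False A(1) C0(1) in auto)
      also have "\<dots> = H * d x x' powr s"
        by (simp add: H_def C_def c_def)
      finally show ?thesis .
    qed
    define G where "G n x = (\<Sum>l = - int n..int n. u l x - u l x0)" for n :: nat and x
    have conv: "convergent (\<lambda>n. G n x)" for x
    proof -
      define v where "v j = (if j = 0 then u 0 x - u 0 x0 else
        (u (int j) x - u (int j) x0) + (u (- int j) x - u (- int j) x0))" for j :: nat
      have "summable (\<lambda>j. norm (v j))"
      proof (rule bounded_imp_summable)
        fix n
        have "(\<Sum>j\<le>n. norm (v j)) \<le> (\<Sum>j\<le>n. if j = 0 then norm (u 0 x - u 0 x0) else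
            norm (u (int j) x - u (int j) x0) + norm (u (- int j) x - u (- int j) x0))"
          by (intro sum_mono) (auto simp: v_def norm_triangle_ineq)
        also have "\<dots> = (\<Sum>l = - int n..int n. norm (u l x - u l x0))"
          by (rule sum_symmetric_int[symmetric])
        also have "\<dots> \<le> H * d x x0 powr s"
          by (rule sum_bound) simp
        finally show "(\<Sum>j\<le>n. norm (v j)) \<le> H * d x x0 powr s" .
      qed simp
      then have "summable v"
        by (rule summable_norm_cancel)
      then have "convergent (\<lambda>n. \<Sum>j\<le>n. v j)"
        by (simp add: summable_iff_convergent')
      then show ?thesis
        by (simp add: G_def sum_symmetric_int v_def)
    qed
    define g where "g x = lim (\<lambda>n. G n x)" for x
    have glim: "(\<lambda>n. G n x) \<longlonglongrightarrow> g x" for x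
      using conv[of x] by (simp add: g_def convergent_LIMSEQ_iff)
    have Gdiff: "norm (G n x - G n x') \<le> H * d x x' powr s" for n x x'
    proof -
      have "G n x - G n x' = (\<Sum>l = - int n..int n. u l x - u l x')"
        by (simp add: G_def flip: sum_subtractf)
      also have "norm \<dots> \<le> (\<Sum>l = - int n..int n. norm (u l x - u l x'))"
        by (rule norm_sum)
      also have "\<dots> \<le> H * d x x' powr s"
        by (rule sum_bound) simp
      finally show ?thesis .
    qed
    have gH: "norm (g x - g x') \<le> H * d x x' powr s" for x x'
      by (rule Lim_norm_ubound[OF sequentially_bot tendsto_diff[OF glim glim]])
        (intro always_eventually allI Gdiff)
    have gnorm: "hoelder_norm d s g \<le> ennreal H"
      using gH by (subst hoelder_norm_le_iff[OF H s(1)]) blast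
    have "hoelder_norm d s g < \<infinity>"
      using gnorm by (rule le_less_trans) simp
    then have gspace: "g \<in> hoelder_space d s"
      using quasi_continuous_continuous_map[OF hoelder_quasi_continuous[OF s(1) gH]]
      by (simp add: hoelder_space_def)
    have [measurable]: "g \<in> borel_measurable \<mu>" "G n \<in> borel_measurable \<mu>" for n
      using quasi_continuous_measurable[OF hoelder_quasi_continuous[OF s(1)]] gH Gdiff by blast+
    have Lg: "functional (\<lambda>\<phi>. LINT x|\<mu>. g x * \<phi> x) (H * tail_const (\<gamma> - s))"
      by (rule hoelder_functional[OF s gH H])
    have smooth_eq: "F \<phi> = (LINT x|\<mu>. g x * \<phi> x)" if \<phi>: "\<phi> \<in> smooth" for \<phi>
    proof -
      obtain b where b: "tb \<beta> \<gamma> \<phi> b"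
        using tests_tb[OF smooth_tests[OF \<phi>]] by blast
      have i\<phi>: "integrable \<mu> \<phi>" and int0: "integral\<^sup>L \<mu> \<phi> = 0"
        using tests_integral[OF smooth_tests[OF \<phi>]] by auto
      have [measurable]: "\<phi> \<in> borel_measurable \<mu>"
        using i\<phi> by simp
      have [measurable]: "u l \<in> borel_measurable \<mu>" for l
        using quasi_continuous_measurable[OF functional_row_continuous[OF L, of l]] by (simp add: u_def[abs_def])
      have iu: "integrable \<mu> (\<lambda>x. u l x * \<phi> x)" for l
      proof (rule norm_integral_le(1))
        show "norm (u l x * \<phi> x) \<le> A * R l powr s * norm (\<phi> x)" for x
          using ub[of l x] by (simp add: norm_mult mult_right_mono)
      qed (use i\<phi> in auto)
      have "(LINT x|\<mu>. G n x * \<phi> x) = (\<Sum>l = - int n..int n. LINT x|\<mu>. \<phi> x * u l x)" for n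
      proof -
        have i0: "integrable \<mu> (\<lambda>x. u l x0 * \<phi> x)" for l
          using i\<phi> by simp
        have "(LINT x|\<mu>. G n x * \<phi> x) = (LINT x|\<mu>. (\<Sum>l = - int n..int n. u l x * \<phi> x - u l x0 * \<phi> x))"
          by (simp only: G_def sum_distrib_right left_diff_distrib)
        also have "\<dots> = (\<Sum>l = - int n..int n. LINT x|\<mu>. u l x * \<phi> x - u l x0 * \<phi> x)"
          by (intro Bochner_Integration.integral_sum Bochner_Integration.integrable_diff iu i0)
        also have "\<dots> = (\<Sum>l = - int n..int n. LINT x|\<mu>. \<phi> x * u l x)"
        proof (rule sum.cong[OF refl])
          fix l
          have "(LINT x|\<mu>. u l x * \<phi> x - u l x0 * \<phi> x) = (LINT x|\<mu>. u l x * \<phi> x) - (LINT x|\<mu>. u l x0 * \<phi> x)"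
            by (rule Bochner_Integration.integral_diff[OF iu i0])
          also have "(LINT x|\<mu>. u l x0 * \<phi> x) = 0"
            using int0 by simp
          finally show "(LINT x|\<mu>. u l x * \<phi> x - u l x0 * \<phi> x) = (LINT x|\<mu>. \<phi> x * u l x)"
            by (simp add: mult.commute)
        qed
        finally show ?thesis .
      qed
      moreover have "(\<lambda>n. \<Sum>l = - int n..int n. LINT x|\<mu>. \<phi> x * u l x) \<longlonglongrightarrow> F \<phi>"
        unfolding u_def by (rule functional_reproducing[OF L A(3) \<phi>])
      ultimately have lim1: "(\<lambda>n. LINT x|\<mu>. G n x * \<phi> x) \<longlonglongrightarrow> F \<phi>"
        by simp
      \<comment> \<open>The partial sums vanish at \<open>x0\<close> and are Hoelder with the common
        constant \<open>H\<close>, so \<open>H * d x0 x powr s\<close> dominates them all, and this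
        is integrable against \<phi>.\<close>
      have lim2: "(\<lambda>n. LINT x|\<mu>. G n x * \<phi> x) \<longlonglongrightarrow> (LINT x|\<mu>. g x * \<phi> x)"
      proof (rule integral_dominated_convergence)
        show "integrable \<mu> (\<lambda>x. H * (d x0 x powr s * norm (\<phi> x)))"
          using hoelder_pairing(1)[OF s gH H b] by simp
        show "AE x in \<mu>. (\<lambda>n. G n x * \<phi> x) \<longlonglongrightarrow> g x * \<phi> x"
          by (intro AE_I2 tendsto_mult glim tendsto_const)
        show "AE x in \<mu>. norm (G n x * \<phi> x) \<le> H * (d x0 x powr s * norm (\<phi> x))" for n
        proof (rule AE_I2)
          fix x
          have "norm (G n x) \<le> H * d x0 x powr s"
            using Gdiff[of n x x0] by (simp add: G_def d_commute)
          then show "norm (G n x * \<phi> x) \<le> H * (d x0 x powr s * norm (\<phi> x))"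
            by (simp add: norm_mult mult_right_mono flip: mult.assoc)
        qed
      qed measurable
      show ?thesis
        by (rule LIMSEQ_unique[OF lim1 lim2])
    qed
    have "F = distribution_of d A0 \<mu> x0 \<eta> \<beta> \<gamma> g"
    proof (rule extensionalityI)
      show "F \<in> extensional tests"
        using Fd by (simp add: distributions_def)
      show "F f = distribution_of d A0 \<mu> x0 \<eta> \<beta> \<gamma> g f" if "f \<in> tests" for f
        using functionals_eq[OF L Lg smooth_eq that] that by (simp add: distribution_of_def)
    qed (simp add: distribution_of_def)
    moreover have "ennreal H = ennreal C * besov_norm \<mu> \<delta> Q s F"
      using C0(1) c A by (simp add: H_def C_def ennreal_mult)
    ultimately show ?thesis
      using gspace gnorm by auto
  qed
  moreover have "0 < C"
    using C0(1) c by (simp add: C_def)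
  ultimately show ?thesis
    by (rule that[rotated])
qed

end

section \<open>Passage from exponential to polynomial decay, and the conclusion\<close>

context homogeneous_space
begin

text \<open>The factor involving the distance to \<open>Y\<close> is at most 1, also when
  \<open>Y\<close> is empty and the factor is 0; hence one constant serves all levels
  \<open>k\<close>.\<close>

lemma exp_bound_le_pw:
  assumes "0 < \<nu>" "0 < a" "0 < \<delta>"
  shows "\<exists>C>0. \<forall>Y k x y. exp_bound d \<mu> \<delta> Y \<nu> a k x y \<le> C * pw (\<delta> powi k) 3 x y"
proof -
  obtain C where C: "0 < C" "\<And>R x y. 0 < R \<Longrightarrow>
      1 / sqrt (V x R * V y R) * exp (- \<nu> * (d x y / R) powr a) \<le> C * pw R 3 x y"
    using exp_le_pw[OF assms(1,2)] by blast
  have "exp_bound d \<mu> \<delta> Y \<nu> a k x y \<le> C * pw (\<delta> powi k) 3 x y" for Y k x y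
  proof -
    define w where "w = (if Y = {} then 0
        else exp (- \<nu> * (max (dist_to_set d x Y) (dist_to_set d y Y) / \<delta> powi k) powr a))"
    have w: "w \<le> 1"
      using assms by (simp add: w_def)
    have "exp_bound d \<mu> \<delta> Y \<nu> a k x y =
        1 / sqrt (V x (\<delta> powi k) * V y (\<delta> powi k)) * exp (- \<nu> * (d x y / \<delta> powi k) powr a) * w"
      by (simp add: exp_bound_def w_def)
    also have "\<dots> \<le> 1 / sqrt (V x (\<delta> powi k) * V y (\<delta> powi k)) * exp (- \<nu> * (d x y / \<delta> powi k) powr a) * 1"
      using w by (intro mult_left_mono) auto
    also have "\<dots> \<le> C * pw (\<delta> powi k) 3 x y"
      using C(2)[of "\<delta> powi k" x y] assms by simp
    finally show ?thesis .
  qed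
  with C(1) show ?thesis
    by blast
qed

end

theorem theorem6p6:
  fixes d :: "'a \<Rightarrow> 'a \<Rightarrow> real" and \<mu> :: "'a measure" and x0 :: 'a
    and A0 c0 C0 \<delta> \<eta> \<beta> \<gamma> s :: real
    and \<A> :: "int \<Rightarrow> 'i set" and z :: "int \<Rightarrow> 'i \<Rightarrow> 'a"
    and Q :: "int \<Rightarrow> 'a \<Rightarrow> 'a \<Rightarrow> complex"
  assumes "homogeneous_type_space d A0 \<mu>"
    and "emeasure \<mu> UNIV = \<infinity>"
    and "reference_points d A0 c0 C0 \<delta> \<A> z"
    and "0 < \<eta>" and "\<eta> < 1"
    and "exp_ATI d \<mu> \<delta> (new_points \<A> z) \<eta> Q"
    and "0 < \<beta>" and "\<beta> < \<eta>" and "0 < \<gamma>" and "\<gamma> < \<eta>"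
    and "0 < s" and "s < min \<beta> \<gamma>"
  shows "(\<exists>C::real. 0 < C \<and> (\<forall>f\<in>hoelder_space d s.
            (\<forall>\<phi>\<in>test_completion d A0 \<mu> x0 \<eta> \<beta> \<gamma>. integrable \<mu> (\<lambda>x. f x * \<phi> x))
            \<and> distribution_of d A0 \<mu> x0 \<eta> \<beta> \<gamma> f \<in> besov_space d A0 \<mu> x0 \<eta> \<beta> \<gamma> \<delta> Q s
            \<and> besov_norm \<mu> \<delta> Q s (distribution_of d A0 \<mu> x0 \<eta> \<beta> \<gamma> f)
                \<le> ennreal C * hoelder_norm d s f))
       \<and> (\<exists>C::real. 0 < C \<and> (\<forall>F\<in>besov_space d A0 \<mu> x0 \<eta> \<beta> \<gamma> \<delta> Q s.
            \<exists>g\<in>hoelder_space d s.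
              F = distribution_of d A0 \<mu> x0 \<eta> \<beta> \<gamma> g
              \<and> hoelder_norm d s g \<le> ennreal C * besov_norm \<mu> \<delta> Q s F))"
proof -
  have \<delta>: "0 < \<delta>" "\<delta> < 1"
    using assms(3) unfolding reference_points_def by linarith+
  have s: "0 < s" "s < \<gamma>"
    using assms by auto
  define Y where "Y = new_points \<A> z"
  interpret homogeneous_space d A0 \<mu>
    by standard (rule assms)
  note ATI = assms(6)[unfolded exp_ATI_def, folded Y_def]
  obtain C \<nu> a where C: "0 < C" "0 < \<nu>" "0 < a"
    and b1: "\<forall>k x y. norm (Q k x y) \<le> C * exp_bound d \<mu> \<delta> (Y k) \<nu> a k x y"
    and b2: "\<forall>k x x' y. d x x' \<le> \<delta> powi k \<longrightarrow>
      norm (Q k x y - Q k x' y) + norm (Q k y x - Q k y x')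
        \<le> C * (d x x' / \<delta> powi k) powr \<eta> * exp_bound d \<mu> \<delta> (Y k) \<nu> a k x y"
    and b3: "\<forall>k x x' y y'. d x x' \<le> \<delta> powi k \<and> d y y' \<le> \<delta> powi k \<longrightarrow>
      norm ((Q k x y - Q k x' y) - (Q k x y' - Q k x' y'))
        \<le> C * (d x x' / \<delta> powi k) powr \<eta> * (d y y' / \<delta> powi k) powr \<eta>
            * exp_bound d \<mu> \<delta> (Y k) \<nu> a k x y"
    using ATI by (elim conjE exE)
  obtain E where E: "0 < E" "\<And>Y k x y. exp_bound d \<mu> \<delta> Y \<nu> a k x y \<le> E * pw (\<delta> powi k) 3 x y"
    using exp_bound_le_pw[OF C(2,3) \<delta>(1)] by auto
  \<comment> \<open>The factor \<open>u\<close> carries the Hoelder ratios, so that one inequality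
    converts the size bound and all regularity bounds.\<close>
  have le: "v \<le> C * E * u * pw (\<delta> powi k) 3 x y"
    if "v \<le> C * u * exp_bound d \<mu> \<delta> (Y k) \<nu> a k x y" "0 \<le> u" for v u k x y
  proof -
    have "C * u * exp_bound d \<mu> \<delta> (Y k) \<nu> a k x y \<le> C * u * (E * pw (\<delta> powi k) 3 x y)"
      using that(2) C(1) by (intro mult_left_mono E) auto
    then show ?thesis
      using that(1) by (simp add: mult_ac)
  qed
  interpret reproducing_kernels d A0 \<mu> x0 \<delta> \<eta> "C * E" Q \<beta> \<gamma>
  proof
    show "norm (Q k x y) \<le> C * E * pw (\<delta> powi k) 3 x y" for k x y
      using le[of _ 1] b1 by simp
    show "norm (Q k x y - Q k x' y) \<le> C * E * (d x x' / \<delta> powi k) powr \<eta> * pw (\<delta> powi k) 3 x y"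
      "norm (Q k y x - Q k y x') \<le> C * E * (d x x' / \<delta> powi k) powr \<eta> * pw (\<delta> powi k) 3 x y"
      if "d x x' \<le> \<delta> powi k" for k x x' y
    proof -
      have b: "norm (Q k x y - Q k x' y) + norm (Q k y x - Q k y x')
          \<le> C * (d x x' / \<delta> powi k) powr \<eta> * exp_bound d \<mu> \<delta> (Y k) \<nu> a k x y"
        using b2 that by blast
      then show "norm (Q k x y - Q k x' y) \<le> C * E * (d x x' / \<delta> powi k) powr \<eta> * pw (\<delta> powi k) 3 x y"
        using norm_ge_zero[of "Q k y x - Q k y x'"] by (intro le) (linarith, simp)
      show "norm (Q k y x - Q k y x') \<le> C * E * (d x x' / \<delta> powi k) powr \<eta> * pw (\<delta> powi k) 3 x y"
        using b norm_ge_zero[of "Q k x y - Q k x' y"] by (intro le) (linarith, simp)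
    qed
    show "norm ((Q k x y - Q k x' y) - (Q k x y' - Q k x' y'))
        \<le> C * E * (d x x' / \<delta> powi k) powr \<eta> * (d y y' / \<delta> powi k) powr \<eta> * pw (\<delta> powi k) 3 x y"
      if "d x x' \<le> \<delta> powi k" "d y y' \<le> \<delta> powi k" for k x x' y y'
    proof -
      have "norm ((Q k x y - Q k x' y) - (Q k x y' - Q k x' y'))
        \<le> C * ((d x x' / \<delta> powi k) powr \<eta> * (d y y' / \<delta> powi k) powr \<eta>)
            * exp_bound d \<mu> \<delta> (Y k) \<nu> a k x y"
        using b3[rule_format, OF conjI[OF that]] by (simp add: mult.assoc)
      from le[OF this] show ?thesis
        by (simp add: mult.assoc)
    qed
  qed (use assms \<delta> C(1) E(1) ATI in auto)
  have "0 < C * E * tail_const 2"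
    using C(1) E(1) tail_const_pos[of 2] by simp
  then have "\<exists>C::real. 0 < C \<and> (\<forall>f\<in>hoelder_space d s.
      (\<forall>\<phi>\<in>test_completion d A0 \<mu> x0 \<eta> \<beta> \<gamma>. integrable \<mu> (\<lambda>x. f x * \<phi> x))
      \<and> distribution_of d A0 \<mu> x0 \<eta> \<beta> \<gamma> f \<in> besov_space d A0 \<mu> x0 \<eta> \<beta> \<gamma> \<delta> Q s
      \<and> besov_norm \<mu> \<delta> Q s (distribution_of d A0 \<mu> x0 \<eta> \<beta> \<gamma> f) \<le> ennreal C * hoelder_norm d s f)"
    using hoelder_imp_besov[OF s] by blast
  moreover have "\<exists>C::real. 0 < C \<and> (\<forall>F\<in>besov_space d A0 \<mu> x0 \<eta> \<beta> \<gamma> \<delta> Q s.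
      \<exists>g\<in>hoelder_space d s. F = distribution_of d A0 \<mu> x0 \<eta> \<beta> \<gamma> g
        \<and> hoelder_norm d s g \<le> ennreal C * besov_norm \<mu> \<delta> Q s F)"
    by (rule besov_imp_hoelder[OF s]) blast
  ultimately show ?thesis
    by (rule conjI)
qed

end
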